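(* Let $(R,\mathfrak{m})$ be a complete noetherian local ring of dimension $d\geq 2$. If $R$ is generalized Cohen--Macaulay, then $\operatorname{Ass}(\overline{R}/R)^{\geq 2}\subseteq\{\mathfrak{m}\}$. If in addition $R$ is reduced, then $\operatorname{Ass}(\overline{R}/R)^{\geq 2}=\{\mathfrak{m}\}$ if and only if $\operatorname{depth}(R)=1$.
   Context: The normalization $\overline{R}$ is the integral closure of $R$ in its total quotient ring $Q(R)$ (the localization of $R$ at all non-zerodivisors). For $X\subseteq\operatorname{Spec}(R)$, $X^{\geq i}:=\{\mathfrak{p}\in X:\operatorname{ht}(\mathfrak{p})\geq i\}$. $\operatorname{Ass}(M)$ is the set of associated primes of the $R$-module $M$. A local ring $(R,\mathfrak{m})$ is generalized Cohen--Macaulay if $H^i_{\mathfrak{m}}(R)$ has finite length for all $i<\dim R$. *)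

theory Defs
  imports
    "HOL-Algebra.Module"
    "HOL-Algebra.Ring_Divisibility"
    "HOL-Algebra.Ideal_Product"
    "HOL-Library.Extended_Nat"
begin

section \<open>Local rings, dimension, depth\<close>

definition local_ring :: "('a, 'b) ring_scheme \<Rightarrow> 'a set \<Rightarrow> bool" where
  "local_ring R m \<longleftrightarrow>
     cring R \<and> maximalideal m R \<and> (\<forall>n. maximalideal n R \<longrightarrow> n = m)"

abbreviation ideal_pow :: "('a, 'b) ring_scheme \<Rightarrow> 'a set \<Rightarrow> nat \<Rightarrow> 'a set" where
  "ideal_pow R I n \<equiv> I [^]\<^bsub>ideals_set R\<^esub> n"

text \<open>The canonical map from \<open>R\<close> to the inverse limit of the \<open>R/I^n\<close> is bijective: a compatible
  family of residue classes is given by representatives \<open>a n\<close>, and it must come from exactly one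
  element of \<open>R\<close> (so completeness includes separatedness).\<close>
definition adically_complete :: "('a, 'b) ring_scheme \<Rightarrow> 'a set \<Rightarrow> bool" where
  "adically_complete R I \<longleftrightarrow>
     (\<forall>a \<in> (UNIV :: nat set) \<rightarrow> carrier R.
        (\<forall>n. a (Suc n) \<ominus>\<^bsub>R\<^esub> a n \<in> ideal_pow R I n) \<longrightarrow>
        (\<exists>!x. x \<in> carrier R \<and> (\<forall>n. x \<ominus>\<^bsub>R\<^esub> a n \<in> ideal_pow R I n)))"

definition reduced_ring :: "('a, 'b) ring_scheme \<Rightarrow> bool" where
  "reduced_ring R \<longleftrightarrow>
     (\<forall>x \<in> carrier R. \<forall>n::nat. x [^]\<^bsub>R\<^esub> n = \<zero>\<^bsub>R\<^esub> \<longrightarrow> x = \<zero>\<^bsub>R\<^esub>)"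

definition prime_chain :: "('a, 'b) ring_scheme \<Rightarrow> (nat \<Rightarrow> 'a set) \<Rightarrow> nat \<Rightarrow> bool" where
  "prime_chain R P n \<longleftrightarrow> (\<forall>i\<le>n. primeideal (P i) R) \<and> (\<forall>i<n. P i \<subset> P (Suc i))"

definition krull_dim :: "('a, 'b) ring_scheme \<Rightarrow> enat" where
  "krull_dim R = Sup {enat n | n. \<exists>P. prime_chain R P n}"

definition height :: "('a, 'b) ring_scheme \<Rightarrow> 'a set \<Rightarrow> enat" where
  "height R p = Sup {enat n | n. \<exists>P. prime_chain R P n \<and> P n = p}"

definition height_ge :: "('a, 'b) ring_scheme \<Rightarrow> 'a set set \<Rightarrow> nat \<Rightarrow> 'a set set" where
  "height_ge R X i = {p \<in> X. enat i \<le> height R p}"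

text \<open>\<open>x 0, \<dots>, x (n - 1)\<close> lie in \<open>I\<close> and each \<open>x i\<close> is a non-zerodivisor modulo its predecessors.
  For proper \<open>I\<close> the usual requirement that the \<open>x i\<close> generate a proper ideal is automatic.\<close>
definition regular_sequence_in ::
    "('a, 'b) ring_scheme \<Rightarrow> 'a set \<Rightarrow> (nat \<Rightarrow> 'a) \<Rightarrow> nat \<Rightarrow> bool" where
  "regular_sequence_in R I x n \<longleftrightarrow>
     (\<forall>i<n. x i \<in> I \<and>
        (\<forall>y \<in> carrier R. x i \<otimes>\<^bsub>R\<^esub> y \<in> Idl\<^bsub>R\<^esub> (x ` {..<i}) \<longrightarrow> y \<in> Idl\<^bsub>R\<^esub> (x ` {..<i})))"

definition depth :: "('a, 'b) ring_scheme \<Rightarrow> 'a set \<Rightarrow> enat" where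
  "depth R m = Sup {enat n | n. \<exists>x. regular_sequence_in R m x n}"


section \<open>Modules\<close>

text \<open>The ring fields \<open>mult\<close> and \<open>one\<close> of a module record are irrelevant for module theory.\<close>

definition regular_module :: "('a, 'b) ring_scheme \<Rightarrow> ('a, 'a) module" where
  "regular_module R =
     \<lparr>carrier = carrier R, mult = mult R, one = \<one>\<^bsub>R\<^esub>, zero = \<zero>\<^bsub>R\<^esub>, add = add R, smult = mult R\<rparr>"

definition module_homs ::
    "('a, 'b) ring_scheme \<Rightarrow> ('a, 'm) module \<Rightarrow> ('a, 'n) module \<Rightarrow> ('m \<Rightarrow> 'n) set" where
  "module_homs R M N =
     {f \<in> carrier M \<rightarrow> carrier N.
        (\<forall>x \<in> carrier M. \<forall>y \<in> carrier M. f (x \<oplus>\<^bsub>M\<^esub> y) = f x \<oplus>\<^bsub>N\<^esub> f y) \<and>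
        (\<forall>r \<in> carrier R. \<forall>x \<in> carrier M. f (r \<odot>\<^bsub>M\<^esub> x) = r \<odot>\<^bsub>N\<^esub> f x)}"

definition quotient_module :: "('a, 'm) module \<Rightarrow> 'm set \<Rightarrow> ('a, 'm set) module" where
  "quotient_module M N =
     \<lparr>carrier = a_rcosets\<^bsub>M\<^esub> N, mult = (\<lambda>X Y. undefined), one = undefined, zero = N,
      add = set_add M, smult = (\<lambda>r X. \<Union>x \<in> X. N +>\<^bsub>M\<^esub> (r \<odot>\<^bsub>M\<^esub> x))\<rparr>"

definition Ass :: "('a, 'b) ring_scheme \<Rightarrow> ('a, 'm) module \<Rightarrow> 'a set set" where
  "Ass R M =
     {p. primeideal p R \<and> (\<exists>x \<in> carrier M. p = {r \<in> carrier R. r \<odot>\<^bsub>M\<^esub> x = \<zero>\<^bsub>M\<^esub>})}"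

definition module_length :: "('a, 'b) ring_scheme \<Rightarrow> ('a, 'm) module \<Rightarrow> enat" where
  "module_length R M =
     Sup {enat n | n. \<exists>C :: nat \<Rightarrow> 'm set.
            (\<forall>i\<le>n. submodule (C i) R M) \<and> (\<forall>i<n. C i \<subset> C (Suc i))}"

definition finite_length :: "('a, 'b) ring_scheme \<Rightarrow> ('a, 'm) module \<Rightarrow> bool" where
  "finite_length R M \<longleftrightarrow> module_length R M \<noteq> \<infinity>"


section \<open>Local cohomology\<close>

text \<open>HOL cannot quantify over the modules of all types inside a definition; the extension property
  is demanded for monomorphisms between modules whose elements have the type \<open>'a\<close> of the ring
  elements. These include the inclusions of ideals into \<open>R\<close>, so by Baer's criterion this is
  injectivity with respect to all modules.\<close>
definition injective_module :: "('a, 'b) ring_scheme \<Rightarrow> ('a, 'e) module \<Rightarrow> bool" where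
  "injective_module R E \<longleftrightarrow> module R E \<and>
     (\<forall>(M :: ('a, 'a) module) (N :: ('a, 'a) module) f g.
        module R M \<and> module R N \<and> f \<in> module_homs R M N \<and> inj_on f (carrier M) \<and>
        g \<in> module_homs R M E \<longrightarrow>
        (\<exists>h \<in> module_homs R N E. \<forall>x \<in> carrier M. h (f x) = g x))"

definition module_kernel :: "('a, 'm) module \<Rightarrow> ('a, 'n) module \<Rightarrow> ('m \<Rightarrow> 'n) \<Rightarrow> 'm set" where
  "module_kernel M N f = {x \<in> carrier M. f x = \<zero>\<^bsub>N\<^esub>}"

text \<open>Exactness of \<open>0 \<rightarrow> M \<rightarrow> E 0 \<rightarrow> E 1 \<rightarrow> \<dots>\<close> with augmentation \<open>\<epsilon>\<close> and differentials
  \<open>\<delta> i : E i \<rightarrow> E (i + 1)\<close>.\<close>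
definition injective_resolution ::
    "('a, 'b) ring_scheme \<Rightarrow> ('a, 'm) module \<Rightarrow> (nat \<Rightarrow> ('a, 'e) module) \<Rightarrow>
     ('m \<Rightarrow> 'e) \<Rightarrow> (nat \<Rightarrow> 'e \<Rightarrow> 'e) \<Rightarrow> bool" where
  "injective_resolution R M E \<epsilon> \<delta> \<longleftrightarrow>
     (\<forall>i. injective_module R (E i)) \<and>
     \<epsilon> \<in> module_homs R M (E 0) \<and> inj_on \<epsilon> (carrier M) \<and>
     (\<forall>i. \<delta> i \<in> module_homs R (E i) (E (Suc i))) \<and>
     \<epsilon> ` carrier M = module_kernel (E 0) (E 1) (\<delta> 0) \<and>
     (\<forall>i. \<delta> i ` carrier (E i) = module_kernel (E (Suc i)) (E (Suc (Suc i))) (\<delta> (Suc i)))"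

definition torsion_part :: "('a, 'b) ring_scheme \<Rightarrow> 'a set \<Rightarrow> ('a, 'm) module \<Rightarrow> 'm set" where
  "torsion_part R I M =
     {x \<in> carrier M. \<exists>n. \<forall>r \<in> ideal_pow R I n. r \<odot>\<^bsub>M\<^esub> x = \<zero>\<^bsub>M\<^esub>}"

text \<open>The \<open>i\<close>-th cohomology of the complex obtained by applying the \<open>I\<close>-torsion functor to
  \<open>E 0 \<rightarrow> E 1 \<rightarrow> \<dots>\<close>. If \<open>E\<close> is an injective resolution of \<open>M\<close>, this is the \<open>i\<close>-th local cohomology
  module of \<open>M\<close> with support in \<open>I\<close>; up to isomorphism it does not depend on \<open>E\<close>.\<close>
definition local_cohomology ::
    "('a, 'b) ring_scheme \<Rightarrow> 'a set \<Rightarrow> (nat \<Rightarrow> ('a, 'e) module) \<Rightarrow> (nat \<Rightarrow> 'e \<Rightarrow> 'e) \<Rightarrow>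
     nat \<Rightarrow> ('a, 'e set) module" where
  "local_cohomology R I E \<delta> i =
     quotient_module
       ((E i)\<lparr>carrier := torsion_part R I (E i) \<inter> module_kernel (E i) (E (Suc i)) (\<delta> i)\<rparr>)
       (case i of 0 \<Rightarrow> {\<zero>\<^bsub>E 0\<^esub>} | Suc j \<Rightarrow> \<delta> j ` torsion_part R I (E j))"

text \<open>The type argument is the type in which the injective resolution is realised. A theorem
  assuming this property for a type variable \<open>'e\<close> therefore covers resolutions of arbitrary size.\<close>
definition generalized_Cohen_Macaulay ::
    "'e itself \<Rightarrow> ('a, 'b) ring_scheme \<Rightarrow> 'a set \<Rightarrow> bool" where
  "generalized_Cohen_Macaulay (_ :: 'e itself) R m \<longleftrightarrow>
     (\<exists>(E :: nat \<Rightarrow> ('a, 'e) module) \<epsilon> \<delta>.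
        injective_resolution R (regular_module R) E \<epsilon> \<delta> \<and>
        (\<forall>i. enat i < krull_dim R \<longrightarrow> finite_length R (local_cohomology R m E \<delta> i)))"


section \<open>Normalization\<close>

definition nonzerodivisors :: "('a, 'b) ring_scheme \<Rightarrow> 'a set" where
  "nonzerodivisors R =
     {s \<in> carrier R. \<forall>x \<in> carrier R. s \<otimes>\<^bsub>R\<^esub> x = \<zero>\<^bsub>R\<^esub> \<longrightarrow> x = \<zero>\<^bsub>R\<^esub>}"

text \<open>The fraction \<open>a/s\<close> as an equivalence class of pairs; since denominators are
  non-zerodivisors, cross-multiplication is already an equivalence relation.\<close>
definition fraction :: "('a, 'b) ring_scheme \<Rightarrow> 'a \<Rightarrow> 'a \<Rightarrow> ('a \<times> 'a) set" where
  "fraction R a s =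
     {(b, t). b \<in> carrier R \<and> t \<in> nonzerodivisors R \<and> a \<otimes>\<^bsub>R\<^esub> t = b \<otimes>\<^bsub>R\<^esub> s}"

text \<open>As a module record the total quotient ring carries both its ring structure and its
  \<open>R\<close>-module structure.\<close>
definition total_quotient_ring :: "('a, 'b) ring_scheme \<Rightarrow> ('a, ('a \<times> 'a) set) module" where
  "total_quotient_ring R =
     \<lparr>carrier = {fraction R a s | a s. a \<in> carrier R \<and> s \<in> nonzerodivisors R},
      mult = (\<lambda>X Y. \<Union>(a, s) \<in> X. \<Union>(b, t) \<in> Y. fraction R (a \<otimes>\<^bsub>R\<^esub> b) (s \<otimes>\<^bsub>R\<^esub> t)),
      one = fraction R \<one>\<^bsub>R\<^esub> \<one>\<^bsub>R\<^esub>,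
      zero = fraction R \<zero>\<^bsub>R\<^esub> \<one>\<^bsub>R\<^esub>,
      add = (\<lambda>X Y. \<Union>(a, s) \<in> X. \<Union>(b, t) \<in> Y.
               fraction R (a \<otimes>\<^bsub>R\<^esub> t \<oplus>\<^bsub>R\<^esub> b \<otimes>\<^bsub>R\<^esub> s) (s \<otimes>\<^bsub>R\<^esub> t)),
      smult = (\<lambda>r X. \<Union>(a, s) \<in> X. fraction R (r \<otimes>\<^bsub>R\<^esub> a) s)\<rparr>"

text \<open>The roots \<open>q\<close> of monic polynomials \<open>X^n + c (n - 1) X^(n - 1) + \<dots> + c 0\<close> over \<open>R\<close>.\<close>
definition normalization :: "('a, 'b) ring_scheme \<Rightarrow> ('a \<times> 'a) set set" where
  "normalization R =
     (let Q = total_quotient_ring R in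
       {q \<in> carrier Q. \<exists>n::nat. n > 0 \<and> (\<exists>c \<in> {..<n} \<rightarrow> carrier R.
          q [^]\<^bsub>Q\<^esub> n \<oplus>\<^bsub>Q\<^esub> (\<Oplus>\<^bsub>Q\<^esub>i\<in>{..<n}. c i \<odot>\<^bsub>Q\<^esub> (q [^]\<^bsub>Q\<^esub> i)) = \<zero>\<^bsub>Q\<^esub>)})"

definition normalization_mod_base ::
    "('a, 'b) ring_scheme \<Rightarrow> ('a, ('a \<times> 'a) set set) module" where
  "normalization_mod_base R =
     quotient_module ((total_quotient_ring R)\<lparr>carrier := normalization R\<rparr>)
       ((\<lambda>a. fraction R a \<one>\<^bsub>R\<^esub>) ` carrier R)"

end

theory Submission
  imports Defs
begin

text \<open>
  Everything is reduced to the ideals \<open>(sR : a)\<close> with a non-zerodivisor \<open>s\<close>: such an ideal is the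
  annihilator of the class of \<open>a/s\<close> in \<open>Q(R)/R\<close>, so the members of \<open>Ass(R'/R)\<close>, with \<open>R'\<close> the
  normalization, are the primes of the form \<open>(sR : a)\<close> for which \<open>a/s\<close> is integral
  (\<open>Ass_normalization_mod_base\<close>).

  \<^bold>\<open>Inclusion.\<close> Let \<open>p = (sR : a)\<close> be prime and different from \<open>\<mm>\<close>. Since the local cohomology of
  \<open>R\<close> has finite length below degree \<open>d\<close>, it is annihilated there by a power of each \<open>x \<in> \<mm>\<close>.
  A chase through the double complex \<open>Hom(F, E)\<close>, with the injective resolution \<open>E\<close> of \<open>R\<close> and a
  free resolution \<open>F\<close> of \<open>R/\<mm>\<^sup>l\<close>, transports this to \<open>Ext\<^sup>j(R/\<mm>\<^sup>l, R)\<close> for \<open>j < d\<close>; the exponent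
  does not depend on \<open>l\<close> (\<open>ext_killed_ring\<close>). In the form of a statement about \<open>Ext\<close> computed from
  \<open>F\<close>, the property is easily carried over to cyclic modules: dividing by a non-zerodivisor costs
  one degree (\<open>ext_killed_mod_nonzerodivisor\<close>), dividing by \<open>\<mm>\<close>-torsion costs nothing
  (\<open>ext_killed_extend_ideal\<close>). So \<open>R/sR\<close> modulo its torsion has the property up to degree \<open>d - 2\<close>,
  and \<open>p\<close> is an associated prime of it. By an induction that cuts down by non-zerodivisors, this
  forces \<open>dim R/p \<ge> d - 1\<close> (\<open>exists_prime_chain_above_associated_prime\<close>). Hence \<open>p\<close> has height at
  most \<open>1\<close>.

  \<^bold>\<open>Equivalence.\<close> The maximal ideal has height \<open>d \<ge> 2\<close>, so the question is when it belongs to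
  \<open>Ass(R'/R)\<close>. If \<open>\<mm> = (sR : a)\<close>, then \<open>\<mm>\<close> is associated to \<open>R/tR\<close> for every non-zerodivisor
  \<open>t \<in> \<mm>\<close>, and no regular sequence has length \<open>2\<close> (\<open>no_regular_pair\<close>). Conversely, if the depth
  is \<open>1\<close>, some non-zerodivisor \<open>s \<in> \<mm>\<close> cannot be extended to a regular sequence, and prime avoidance
  gives \<open>a \<notin> sR\<close> with \<open>\<mm> a \<subseteq> sR\<close>. The fraction \<open>q = a/s\<close> satisfies \<open>\<mm> q \<subseteq> \<mm>\<close>, for otherwise
  \<open>\<mm>\<close> would be principal and \<open>dim R \<le> 1\<close> (\<open>mm_stable_under_fraction\<close>). Therefore \<open>q\<close> is integral
  (\<open>fraction_integral\<close>), and \<open>\<mm>\<close> is the annihilator of its class.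
\<close>

section \<open>Noetherian local rings\<close>

definition colon_ideal :: "('a, 'b) ring_scheme \<Rightarrow> 'a set \<Rightarrow> 'a \<Rightarrow> 'a set" where
  "colon_ideal R J a = {r \<in> carrier R. r \<otimes>\<^bsub>R\<^esub> a \<in> J}"

text \<open>The ideal \<open>J + xR\<close>, written out so that membership can be used directly.\<close>
definition adjoin :: "('a, 'b) ring_scheme \<Rightarrow> 'a set \<Rightarrow> 'a \<Rightarrow> 'a set" where
  "adjoin R J x = {j \<oplus>\<^bsub>R\<^esub> c \<otimes>\<^bsub>R\<^esub> x | j c. j \<in> J \<and> c \<in> carrier R}"

lemma (in cring) idealI':
  assumes I: "I \<subseteq> carrier R" "\<zero> \<in> I"
    and add: "\<And>x y. \<lbrakk>x \<in> I; y \<in> I\<rbrakk> \<Longrightarrow> x \<oplus> y \<in> I"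
    and mult: "\<And>r x. \<lbrakk>r \<in> carrier R; x \<in> I\<rbrakk> \<Longrightarrow> r \<otimes> x \<in> I"
  shows "ideal I R"
proof (rule idealI)
  have "\<ominus> x \<in> I" if "x \<in> I" for x
    using mult[of "\<ominus> \<one>" x] that I by (auto simp: l_minus)
  thus "subgroup I (add_monoid R)" using I add by unfold_locales (auto simp: a_inv_def)
  show "x \<otimes> r \<in> I" if "x \<in> I" "r \<in> carrier R" for x r
    using mult[OF that(2,1)] that I m_comm[of x r] by auto
qed (use ring_axioms mult in auto)

lemma (in cring) ideal_diff_closed:
  assumes "ideal J R" "x \<in> J" "y \<in> J"
  shows "x \<ominus> y \<in> J"
proof -
  interpret J: ideal J R by fact
  show ?thesis using assms J.a_inv_closed J.a_closed by (simp add: minus_eq)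
qed

lemma (in cring) ideal_cancel_right:
  assumes "ideal J R" "x \<oplus> y \<in> J" "y \<in> J" "x \<in> carrier R"
  shows "x \<in> J"
proof -
  interpret J: ideal J R by fact
  have "y \<in> carrier R" using assms J.Icarr by blast
  hence "x = (x \<oplus> y) \<ominus> y" using assms(4) by algebra
  thus ?thesis using ideal_diff_closed assms by metis
qed

lemma (in cring) ideal_colon:
  assumes "ideal J R" "a \<in> carrier R"
  shows "ideal (colon_ideal R J a) R"
proof -
  interpret J: ideal J R by fact
  show ?thesis
    by (rule idealI') (use assms(2) J.I_l_closed in \<open>auto simp: colon_ideal_def l_distr m_assoc\<close>)
qed

lemma (in cring) mem_adjoin:
  "z \<in> adjoin R J x \<longleftrightarrow> (\<exists>j\<in>J. \<exists>c\<in>carrier R. z = j \<oplus> c \<otimes> x)"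
  by (auto simp: adjoin_def)

lemma (in cring) ideal_adjoin:
  assumes "ideal J R" "x \<in> carrier R"
  shows "ideal (adjoin R J x) R" "J \<subseteq> adjoin R J x" "x \<in> adjoin R J x"
proof -
  interpret J: ideal J R by fact
  have "adjoin R J x = J <+>\<^bsub>R\<^esub> PIdl\<^bsub>R\<^esub> x"
    by (auto simp: adjoin_def set_add_def' cgenideal_def)
  thus "ideal (adjoin R J x) R" using add_ideals assms cgenideal_ideal by simp
  show "J \<subseteq> adjoin R J x"
  proof
    fix z assume z: "z \<in> J"
    hence "z = z \<oplus> \<zero> \<otimes> x" using assms(2) J.Icarr by simp
    thus "z \<in> adjoin R J x" using z mem_adjoin by blast
  qed
  have "x = \<zero> \<oplus> \<one> \<otimes> x" using assms(2) by simp
  thus "x \<in> adjoin R J x" using mem_adjoin J.zero_closed by blast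
qed

lemma (in noetherian_ring) obtain_maximal_ideal:
  assumes "P i0" and "\<And>i. P i \<Longrightarrow> ideal (f i) R"
  obtains i where "P i" "\<And>j. \<lbrakk>P j; f i \<subseteq> f j\<rbrakk> \<Longrightarrow> f j = f i"
proof -
  let ?S = "f ` Collect P"
  have "\<exists>M\<in>?S. \<forall>I\<in>?S. M \<subseteq> I \<longrightarrow> I = M"
  proof (rule subset_Zorn)
    fix C assume C: "subset.chain ?S C"
    show "\<exists>U\<in>?S. \<forall>X\<in>C. X \<subseteq> U"
    proof (cases "C = {}")
      case False
      have sub: "C \<subseteq> ?S" using C by (simp add: pred_on.chain_def)
      have "subset.chain {I. ideal I R} C"
        using C assms(2) unfolding pred_on.chain_def by auto
      hence "\<Union>C \<in> C" using ideal_chain_is_trivial False by metis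
      thus ?thesis using sub by (meson Union_upper subsetD)
    qed (use assms(1) in auto)
  qed
  then obtain i where i: "P i" "\<forall>I\<in>?S. f i \<subseteq> I \<longrightarrow> I = f i" by auto
  show thesis by (rule that[OF i(1)]) (use i(2) in simp)
qed

lemma (in noetherian_ring) ascending_ideals_stationary:
  fixes I :: "nat \<Rightarrow> 'a set"
  assumes "\<And>n. ideal (I n) R" and "\<And>n. I n \<subseteq> I (Suc n)"
  shows "\<exists>n. \<forall>k\<ge>n. I k = I n"
proof -
  obtain n where n: "\<And>k. I n \<subseteq> I k \<Longrightarrow> I k = I n"
    using obtain_maximal_ideal[of "\<lambda>_. True" 0 I] assms(1) by metis
  have "I n \<subseteq> I k" if "k \<ge> n" for k
    using that assms(2) lift_Suc_mono_le by metis
  thus ?thesis using n by blast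
qed

lemma (in noetherian_ring) finite_generating_subset:
  assumes "T \<subseteq> carrier R"
  obtains F where "finite F" "F \<subseteq> T" "Idl F = Idl T"
proof -
  have gen: "ideal (Idl F) R" if "finite F \<and> F \<subseteq> T" for F
    using that assms by (intro genideal_ideal) blast
  obtain F where F: "finite F \<and> F \<subseteq> T"
    and max: "\<And>F'. \<lbrakk>finite F' \<and> F' \<subseteq> T; Idl F \<subseteq> Idl F'\<rbrakk> \<Longrightarrow> Idl F' = Idl F"
    by (rule obtain_maximal_ideal[of "\<lambda>F. finite F \<and> F \<subseteq> T" "{}" "genideal R"])
      (use gen in auto)
  have "t \<in> Idl F" if "t \<in> T" for t
  proof -
    have "Idl F \<subseteq> Idl (insert t F)"
      using F that assms by (intro subset_Idl_subset) auto
    hence "Idl (insert t F) = Idl F" using max[of "insert t F"] F that by auto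
    moreover have "t \<in> Idl (insert t F)" using genideal_self[of "insert t F"] F that assms by auto
    ultimately show ?thesis by simp
  qed
  hence "Idl T \<subseteq> Idl F" using genideal_minimal genideal_ideal F assms by (meson order_trans subsetI)
  moreover have "Idl F \<subseteq> Idl T" using F assms subset_Idl_subset by blast
  ultimately show thesis using F that by blast
qed

locale noetherian_local_ring = cring R + noetherian_ring R for R (structure) +
  fixes \<mm> :: "'a set"
  assumes local_ring: "local_ring R \<mm>"
begin

lemma maximalideal_mm: "maximalideal \<mm> R"
  using local_ring by (simp add: local_ring_def)

lemma ideal_mm: "ideal \<mm> R"
  using maximalideal_mm maximalideal.axioms(1) by blast

lemma mm_subset: "\<mm> \<subseteq> carrier R"
  using ideal_mm ideal.Icarr by fast

lemma one_notin_mm: "\<one> \<notin> \<mm>"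
  using ideal.one_imp_carrier[OF ideal_mm] maximalideal.I_notcarr[OF maximalideal_mm] by blast

lemma primeideal_mm: "primeideal \<mm> R"
  using maximalideal_prime maximalideal_mm by blast

lemma proper_ideal_subset_mm:
  assumes "ideal I R" "\<one> \<notin> I"
  shows "I \<subseteq> \<mm>"
proof -
  obtain M where M: "ideal M R \<and> I \<subseteq> M \<and> \<one> \<notin> M"
    and max: "\<And>J. \<lbrakk>ideal J R \<and> I \<subseteq> J \<and> \<one> \<notin> J; M \<subseteq> J\<rbrakk> \<Longrightarrow> J = M"
    by (rule obtain_maximal_ideal[of "\<lambda>J. ideal J R \<and> I \<subseteq> J \<and> \<one> \<notin> J" I id])
      (use assms in auto)
  have "maximalideal M R"
  proof (rule maximalidealI)
    show "carrier R \<noteq> M" using M by auto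
    show "J = M \<or> J = carrier R" if "ideal J R" "M \<subseteq> J" "J \<subseteq> carrier R" for J
      using max[of J] that M ideal.one_imp_carrier[of J R] by blast
  qed (use M in simp)
  thus ?thesis using M local_ring by (simp add: local_ring_def)
qed

lemma primeideal_subset_mm:
  assumes "primeideal P R"
  shows "P \<subseteq> \<mm>"
  using assms proper_ideal_subset_mm primeideal.I_notcarr ideal.one_imp_carrier primeideal.axioms(1)
  by metis

lemma unit_if_notin_mm:
  assumes "u \<in> carrier R" "u \<notin> \<mm>"
  obtains v where "v \<in> carrier R" "v \<otimes> u = \<one>"
proof -
  have "\<one> \<in> PIdl u"
    using proper_ideal_subset_mm[of "PIdl u"] assms cgenideal_ideal cgenideal_self by blast
  thus thesis using that by (auto simp: cgenideal_def)
qed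

lemma one_minus_notin_mm:
  assumes "x \<in> \<mm>"
  shows "\<one> \<ominus> x \<notin> \<mm>"
proof
  assume a: "\<one> \<ominus> x \<in> \<mm>"
  have x: "x \<in> carrier R" using assms mm_subset by blast
  have "\<one> = (\<one> \<ominus> x) \<oplus> x" using x by algebra
  hence "\<one> \<in> \<mm>" using a assms ideal_mm
    by (metis additive_subgroup.a_closed ideal.axioms(1))
  thus False using one_notin_mm by simp
qed

text \<open>A form of Nakayama's lemma, for sets. Dividing an element of \<open>S\<close> by \<open>x\<close> again and
  again gives elements \<open>y 0, y 1, \<dots>\<close> and an ascending chain of ideals \<open>J + (y n)\<close>; where it becomes stationary, \<open>y (n + 1)\<close> is a multiple of \<open>x y (n + 1)\<close> modulo
  \<open>J\<close>, hence lies in \<open>J\<close>, since \<open>1 - c x\<close> is a unit.\<close>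
lemma divisible_subset_ideal:
  assumes J: "ideal J R" and S: "S \<subseteq> carrier R" and x: "x \<in> \<mm>"
    and div: "\<And>y. y \<in> S \<Longrightarrow> \<exists>y'\<in>S. y \<ominus> x \<otimes> y' \<in> J"
  shows "S \<subseteq> J"
proof
  fix y0 assume y0: "y0 \<in> S"
  interpret J: ideal J R by fact
  have xc: "x \<in> carrier R" using x mm_subset by blast
  from div have "\<exists>f. \<forall>y\<in>S. f y \<in> S \<and> y \<ominus> x \<otimes> f y \<in> J" by (intro bchoice) blast
  then obtain f where f: "\<And>y. y \<in> S \<Longrightarrow> f y \<in> S \<and> y \<ominus> x \<otimes> f y \<in> J" by blast
  define y where "y n = (f ^^ n) y0" for n
  have yS: "y n \<in> S" for n by (induction n) (use y0 f in \<open>auto simp: y_def\<close>)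
  have yc: "y n \<in> carrier R" for n using yS S by blast
  have y_step: "y n \<ominus> x \<otimes> y (Suc n) \<in> J" for n
    using f[OF yS[of n]] by (simp add: y_def)
  have idl: "ideal (adjoin R J (y n)) R" for n using ideal_adjoin(1) J yc by blast
  have "\<exists>n. \<forall>k\<ge>n. adjoin R J (y k) = adjoin R J (y n)"
  proof (rule ascending_ideals_stationary[OF idl])
    fix n show "adjoin R J (y n) \<subseteq> adjoin R J (y (Suc n))"
    proof
      fix z assume "z \<in> adjoin R J (y n)"
      then obtain j c where z: "j \<in> J" "c \<in> carrier R" "z = j \<oplus> c \<otimes> y n"
        using mem_adjoin by blast
      have jc: "j \<in> carrier R" using z J.Icarr by blast
      have "z = (j \<oplus> c \<otimes> (y n \<ominus> x \<otimes> y (Suc n))) \<oplus> (c \<otimes> x) \<otimes> y (Suc n)"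
        using z(2,3) jc xc yc[of n] yc[of "Suc n"] by algebra
      moreover have "j \<oplus> c \<otimes> (y n \<ominus> x \<otimes> y (Suc n)) \<in> J"
        using z y_step J.I_l_closed J.a_closed by blast
      ultimately show "z \<in> adjoin R J (y (Suc n))"
        using mem_adjoin z(2) xc by blast
    qed
  qed
  then obtain n where n: "adjoin R J (y (Suc n)) = adjoin R J (y n)" by (metis le_Suc_eq order_refl)
  have "y (Suc n) \<in> adjoin R J (y n)" using n ideal_adjoin(3) J yc by blast
  then obtain j c where jc: "j \<in> J" "c \<in> carrier R" "y (Suc n) = j \<oplus> c \<otimes> y n"
    using mem_adjoin by blast
  have "c \<otimes> x \<in> \<mm>" using jc x ideal_mm ideal.I_l_closed by metis
  then obtain v where v: "v \<in> carrier R" "v \<otimes> (\<one> \<ominus> c \<otimes> x) = \<one>"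
    using unit_if_notin_mm one_minus_notin_mm jc xc by (metis minus_closed m_closed one_closed)
  have "(\<one> \<ominus> c \<otimes> x) \<otimes> y (Suc n) = j \<oplus> c \<otimes> (y n \<ominus> x \<otimes> y (Suc n))"
  proof -
    have "(\<one> \<ominus> c \<otimes> x) \<otimes> y (Suc n) = y (Suc n) \<ominus> c \<otimes> x \<otimes> y (Suc n)"
      using jc(2) xc yc[of "Suc n"] by algebra
    also have "\<dots> = (j \<oplus> c \<otimes> y n) \<ominus> c \<otimes> x \<otimes> y (Suc n)" using jc(3) by simp
    also have "\<dots> = j \<oplus> c \<otimes> (y n \<ominus> x \<otimes> y (Suc n))"
      using jc(1,2) J.Icarr[OF jc(1)] xc yc[of "Suc n"] yc[of n] by algebra
    finally show ?thesis .
  qed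
  also have "\<dots> \<in> J" using jc y_step J.I_l_closed J.a_closed by blast
  finally have "v \<otimes> ((\<one> \<ominus> c \<otimes> x) \<otimes> y (Suc n)) \<in> J" using v J.I_l_closed by blast
  moreover have "v \<otimes> ((\<one> \<ominus> c \<otimes> x) \<otimes> y (Suc n)) = y (Suc n)"
    using v yc[of "Suc n"] jc(2) xc by (simp add: m_assoc[symmetric])
  ultimately have base: "y (Suc n) \<in> J" by simp
  have descend: "y k \<in> J" if "y (Suc k) \<in> J" for k
  proof -
    have "y k = (y k \<ominus> x \<otimes> y (Suc k)) \<oplus> x \<otimes> y (Suc k)"
      using xc yc[of k] yc[of "Suc k"] by algebra
    thus ?thesis using y_step[of k] that xc J.I_l_closed J.a_closed by metis
  qed
  have "y (Suc n - k) \<in> J" for k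
  proof (induction k)
    case (Suc k)
    show ?case
    proof (cases "k < Suc n")
      case True
      hence "Suc n - k = Suc (Suc n - Suc k)" by simp
      thus ?thesis using Suc.IH descend by metis
    qed (use Suc.IH in simp)
  qed (use base in simp)
  from this[of "Suc n"] show "y0 \<in> J" by (simp add: y_def)
qed

end

text \<open>Associated primes of \<open>R/J\<close> are found as maximal annihilators.\<close>

lemma (in cring) maximal_colon_prime:
  assumes J: "ideal J R" and y: "y \<in> carrier R" "y \<notin> J"
    and max: "\<And>r. \<lbrakk>r \<in> carrier R; r \<otimes> y \<notin> J; colon_ideal R J y \<subseteq> colon_ideal R J (r \<otimes> y)\<rbrakk>
      \<Longrightarrow> colon_ideal R J (r \<otimes> y) = colon_ideal R J y"
  shows "primeideal (colon_ideal R J y) R"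
proof (rule primeidealI)
  interpret J: ideal J R by fact
  show "ideal (colon_ideal R J y) R" using ideal_colon J y by blast
  show "cring R" by (rule is_cring)
  show "carrier R \<noteq> colon_ideal R J y"
  proof
    assume "carrier R = colon_ideal R J y"
    hence "\<one> \<in> colon_ideal R J y" by blast
    thus False using y by (simp add: colon_ideal_def)
  qed
  fix a b assume ab: "a \<in> carrier R" "b \<in> carrier R" "a \<otimes> b \<in> colon_ideal R J y"
  show "a \<in> colon_ideal R J y \<or> b \<in> colon_ideal R J y"
  proof (cases "b \<otimes> y \<in> J")
    case False
    have "colon_ideal R J y \<subseteq> colon_ideal R J (b \<otimes> y)"
      using y ab J.I_l_closed by (auto simp: colon_ideal_def m_lcomm[of _ b y])
    hence "colon_ideal R J (b \<otimes> y) = colon_ideal R J y" using max ab False by blast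
    moreover have "a \<in> colon_ideal R J (b \<otimes> y)"
      using ab y by (simp add: colon_ideal_def m_assoc)
    ultimately show ?thesis by blast
  qed (use ab in \<open>simp add: colon_ideal_def\<close>)
qed

lemma (in noetherian_ring) exists_prime_colon:
  assumes "cring R" and J: "ideal J R" and y: "y \<in> carrier R" "y \<notin> J"
  obtains r where "r \<in> carrier R" "r \<otimes> y \<notin> J" "primeideal (colon_ideal R J (r \<otimes> y)) R"
proof -
  interpret cring R by fact
  obtain r where r: "r \<in> carrier R \<and> r \<otimes> y \<notin> J" and
    max: "\<And>s. \<lbrakk>s \<in> carrier R \<and> s \<otimes> y \<notin> J; colon_ideal R J (r \<otimes> y) \<subseteq> colon_ideal R J (s \<otimes> y)\<rbrakk>
      \<Longrightarrow> colon_ideal R J (s \<otimes> y) = colon_ideal R J (r \<otimes> y)"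
    by (rule obtain_maximal_ideal[of "\<lambda>r. r \<in> carrier R \<and> r \<otimes> y \<notin> J" \<one> "\<lambda>r. colon_ideal R J (r \<otimes> y)"])
      (use J y ideal_colon in auto)
  have "primeideal (colon_ideal R J (r \<otimes> y)) R"
    by (rule maximal_colon_prime[OF J]) (use r y max in \<open>auto simp: m_assoc[symmetric]\<close>)
  thus thesis using r that by blast
qed

lemma (in cring) exists_common_element_outside_prime:
  assumes "finite F" and "primeideal P R" and "\<And>Q. Q \<in> F \<Longrightarrow> ideal Q R \<and> \<not> Q \<subseteq> P"
  shows "\<exists>z\<in>carrier R. z \<notin> P \<and> (\<forall>Q\<in>F. z \<in> Q)"
  using assms(1,3)
proof (induction F)
  case empty
  interpret P: primeideal P R by fact
  have "\<one> \<notin> P" using P.one_imp_carrier P.I_notcarr by blast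
  thus ?case by auto
next
  case (insert Q F)
  interpret P: primeideal P R by fact
  interpret Q: ideal Q R using insert by blast
  obtain z where z: "z \<in> carrier R" "z \<notin> P" "\<And>Q. Q \<in> F \<Longrightarrow> z \<in> Q" using insert by auto
  obtain w where w: "w \<in> Q" "w \<notin> P" using insert.prems by blast
  have "z \<otimes> w \<notin> P" using z w P.I_prime Q.Icarr by blast
  moreover have "z \<otimes> w \<in> Q" using z w Q.I_l_closed by blast
  moreover have "z \<otimes> w \<in> Q'" if "Q' \<in> F" for Q'
    using z(3)[OF that] ideal.I_r_closed[of Q' R] insert.prems that w Q.Icarr by blast
  ultimately show ?case using z w Q.Icarr by (intro bexI[of _ "z \<otimes> w"]) auto
qed

text \<open>Prime avoidance. The primes to which it will be applied are maximal annihilators, hence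
  pairwise incomparable, and this removes a case distinction from the usual proof.\<close>
lemma (in cring) prime_avoidance:
  assumes "finite F" and I: "ideal I R" and "\<And>P. P \<in> F \<Longrightarrow> primeideal P R"
    and "\<And>P Q. \<lbrakk>P \<in> F; Q \<in> F; Q \<subseteq> P\<rbrakk> \<Longrightarrow> Q = P"
    and "F \<noteq> {}" and "I \<subseteq> \<Union>F"
  shows "\<exists>P\<in>F. I \<subseteq> P"
  using assms(1,3-)
proof (induction F)
  case (insert P F)
  interpret I: ideal I R by fact
  interpret P: primeideal P R using insert.prems(1) by simp
  have IH: "\<exists>P\<in>F. I \<subseteq> P" if "I \<subseteq> \<Union>F"
  proof (cases "F = {}")
    case True thus ?thesis using that I.zero_closed by auto
  next
    case False thus ?thesis using insert.IH insert.prems(1,2) that by (meson insertI2)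
  qed
  show ?case
  proof (rule ccontr)
    assume contra: "\<not> ?thesis"
    hence "\<not> I \<subseteq> \<Union>F" using IH by blast
    then obtain x where x: "x \<in> I" "\<And>Q. Q \<in> F \<Longrightarrow> x \<notin> Q" by auto
    have cover: "\<exists>Q\<in>insert P F. w \<in> Q" if "w \<in> I" for w
      using subsetD[OF insert.prems(4) that] by blast
    have xP: "x \<in> P" using cover[of x] x by blast
    have "\<exists>z\<in>carrier R. z \<notin> P \<and> (\<forall>Q\<in>insert I F. z \<in> Q)"
    proof (rule exists_common_element_outside_prime)
      show "finite (insert I F)" using insert.hyps by simp
      show "primeideal P R" using insert.prems(1) by simp
      fix Q assume Q: "Q \<in> insert I F"
      show "ideal Q R \<and> \<not> Q \<subseteq> P"
      proof (cases "Q = I")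
        case False
        hence QF: "Q \<in> F" using Q by simp
        hence "Q \<noteq> P" using insert.hyps by auto
        moreover have "ideal Q R" using primeideal.axioms(1)[OF insert.prems(1)] QF by simp
        ultimately show ?thesis using insert.prems(2)[of P Q] QF by auto
      qed (use I contra in simp)
    qed
    then obtain z where z: "z \<in> carrier R" "z \<notin> P" "z \<in> I" "\<And>Q. Q \<in> F \<Longrightarrow> z \<in> Q" by blast
    have xc: "x \<in> carrier R" using x I.Icarr by blast
    have "x \<oplus> z \<in> I" using x z I.a_closed by blast
    then obtain Q where Q: "Q \<in> insert P F" "x \<oplus> z \<in> Q" using cover by blast
    have Qi: "ideal Q R" using primeideal.axioms(1)[OF insert.prems(1)[OF Q(1)]] .
    show False
    proof (cases "Q = P")
      case True
      have "z \<oplus> x \<in> P" using Q(2) True a_comm[OF xc z(1)] by simp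
      thus False using ideal_cancel_right[OF P.is_ideal] xP z by blast
    next
      case False
      hence "x \<in> Q" using ideal_cancel_right[OF Qi Q(2) _ xc] z(4)[of Q] Q(1) by blast
      thus False using x(2)[of Q] Q(1) False by blast
    qed
  qed
qed simp

text \<open>The zero-divisors of \<open>R/J\<close> form the union of the maximal annihilators \<open>J : a\<close>, which are
  prime. If the ideal of all such \<open>a\<close> is generated by \<open>a 1, \<dots>, a n\<close>, each maximal annihilator
  contains the intersection of the \<open>J : a i\<close>, so equals one of them. Thus there are finitely
  many, and by prime avoidance \<open>\<mm>\<close> cannot consist of zero-divisors without being contained in one
  of them, that is, without annihilating some \<open>a \<notin> J\<close> modulo \<open>J\<close>.\<close>
lemma (in noetherian_local_ring) exists_nonzerodivisor_mod:
  assumes J: "ideal J R"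
    and no_socle: "\<And>a. \<lbrakk>a \<in> carrier R; \<And>x. x \<in> \<mm> \<Longrightarrow> x \<otimes> a \<in> J\<rbrakk> \<Longrightarrow> a \<in> J"
  obtains x where "x \<in> \<mm>" "\<And>y. y \<in> carrier R \<Longrightarrow> x \<otimes> y \<in> J \<Longrightarrow> y \<in> J"
proof -
  have "\<exists>x\<in>\<mm>. \<forall>y\<in>carrier R. x \<otimes> y \<in> J \<longrightarrow> y \<in> J"
  proof (rule ccontr)
    assume "\<not> ?thesis"
    hence zd: "\<exists>y\<in>carrier R. y \<notin> J \<and> x \<otimes> y \<in> J" if "x \<in> \<mm>" for x using that by blast
    interpret J: ideal J R by fact
    define T where "T = {a \<in> carrier R. a \<notin> J \<and>
      (\<forall>b\<in>carrier R. b \<notin> J \<longrightarrow> colon_ideal R J a \<subseteq> colon_ideal R J b \<longrightarrow> colon_ideal R J b = colon_ideal R J a)}"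
    have T_prime: "primeideal (colon_ideal R J a) R" if "a \<in> T" for a
      by (rule maximal_colon_prime[OF J]) (use that in \<open>auto simp: T_def\<close>)
    have above: "\<exists>a\<in>T. colon_ideal R J y \<subseteq> colon_ideal R J a" if y: "y \<in> carrier R" "y \<notin> J" for y
    proof -
      obtain a where a: "a \<in> carrier R \<and> a \<notin> J \<and> colon_ideal R J y \<subseteq> colon_ideal R J a" and
        max: "\<And>b. \<lbrakk>b \<in> carrier R \<and> b \<notin> J \<and> colon_ideal R J y \<subseteq> colon_ideal R J b;
          colon_ideal R J a \<subseteq> colon_ideal R J b\<rbrakk> \<Longrightarrow> colon_ideal R J b = colon_ideal R J a"
        by (rule obtain_maximal_ideal[of
              "\<lambda>b. b \<in> carrier R \<and> b \<notin> J \<and> colon_ideal R J y \<subseteq> colon_ideal R J b" y "colon_ideal R J"])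
          (use J y ideal_colon in auto)
      have "colon_ideal R J b = colon_ideal R J a"
        if "b \<in> carrier R" "b \<notin> J" "colon_ideal R J a \<subseteq> colon_ideal R J b" for b
        by (rule max) (use a that in \<open>simp_all add: subset_trans[of _ "colon_ideal R J a"]\<close>)
      hence "a \<in> T" using a by (simp add: T_def)
      thus ?thesis using a by blast
    qed
    have Tc: "T \<subseteq> carrier R" by (auto simp: T_def)
    obtain F where F: "finite F" "F \<subseteq> T" "Idl F = Idl T" using finite_generating_subset[OF Tc] .
    have every: "\<exists>b\<in>F. colon_ideal R J a = colon_ideal R J b" if a: "a \<in> T" for a
    proof (rule ccontr)
      assume neg: "\<not> ?thesis"
      have ex: "\<exists>z\<in>carrier R. z \<notin> colon_ideal R J a \<and> (\<forall>Q\<in>colon_ideal R J ` F. z \<in> Q)"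
      proof (rule exists_common_element_outside_prime[OF _ T_prime[OF a]])
        show "finite (colon_ideal R J ` F)" using F by simp
        fix Q assume "Q \<in> colon_ideal R J ` F"
        then obtain b where b: "b \<in> F" "Q = colon_ideal R J b" by blast
        have "ideal Q R" using b F Tc ideal_colon J by blast
        moreover have "\<not> Q \<subseteq> colon_ideal R J a"
          using neg b F(2) a unfolding T_def by blast
        ultimately show "ideal Q R \<and> \<not> Q \<subseteq> colon_ideal R J a" by blast
      qed
      then obtain z where z: "z \<in> carrier R" "z \<notin> colon_ideal R J a"
        and zF: "\<And>b. b \<in> F \<Longrightarrow> z \<otimes> b \<in> J" by (auto simp: colon_ideal_def)
      have "F \<subseteq> colon_ideal R J z"
      proof
        fix b assume b: "b \<in> F"
        hence "b \<in> carrier R" using F Tc by blast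
        thus "b \<in> colon_ideal R J z" using zF[OF b] z m_comm[of b z] by (simp add: colon_ideal_def)
      qed
      hence "Idl F \<subseteq> colon_ideal R J z" using genideal_minimal ideal_colon J z by blast
      moreover have "a \<in> Idl F" using F(3) genideal_self[OF Tc] a by blast
      ultimately have "a \<otimes> z \<in> J" by (auto simp: colon_ideal_def)
      thus False using z a Tc m_comm[of a z] by (auto simp: colon_ideal_def)
    qed
    have cover: "\<mm> \<subseteq> \<Union>(colon_ideal R J ` F)"
    proof
      fix x assume x: "x \<in> \<mm>"
      then obtain y where y: "y \<in> carrier R" "y \<notin> J" "x \<otimes> y \<in> J" using zd by blast
      then obtain a where a: "a \<in> T" "colon_ideal R J y \<subseteq> colon_ideal R J a" using above by blast
      then obtain b where "b \<in> F" "colon_ideal R J a = colon_ideal R J b" using every by blast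
      moreover have "x \<in> colon_ideal R J y" using y x mm_subset by (auto simp: colon_ideal_def)
      ultimately show "x \<in> \<Union>(colon_ideal R J ` F)" using a by blast
    qed
    have "\<exists>P\<in>colon_ideal R J ` F. \<mm> \<subseteq> P"
    proof (rule prime_avoidance[OF _ ideal_mm _ _ _ cover])
      show "colon_ideal R J ` F \<noteq> {}" using cover ideal_mm additive_subgroup.zero_closed ideal.axioms(1)
        by (metis Union_empty empty_iff subset_empty)
      show "Q = P" if "P \<in> colon_ideal R J ` F" "Q \<in> colon_ideal R J ` F" "Q \<subseteq> P" for P Q
        using that F(2) unfolding T_def by blast
    qed (use F T_prime in auto)
    then obtain a where a: "a \<in> F" "\<mm> \<subseteq> colon_ideal R J a" by blast
    hence "a \<in> J" using no_socle[of a] F Tc by (auto simp: colon_ideal_def)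
    thus False using a F by (auto simp: T_def)
  qed
  thus thesis using that by blast
qed

section \<open>Linear systems over injective modules\<close>

definition lin_comb :: "('a, 'c, 'd) module_scheme \<Rightarrow> (nat \<Rightarrow> 'a) \<Rightarrow> (nat \<Rightarrow> 'c) \<Rightarrow> nat \<Rightarrow> 'c" where
  "lin_comb M c v n = (\<Oplus>\<^bsub>M\<^esub>i\<in>{..<n}. c i \<odot>\<^bsub>M\<^esub> v i)"

lemma regular_module_simps [simp]:
  "carrier (regular_module R) = carrier R" "add (regular_module R) = add R"
  "zero (regular_module R) = zero R" "smult (regular_module R) = mult R"
  "mult (regular_module R) = mult R" "one (regular_module R) = one R"
  by (auto simp: regular_module_def)

lemma (in cring) module_regular: "module R (regular_module R)"
  by (rule moduleI)
    (auto simp: is_cring l_distr r_distr m_assoc intro!: abelian_groupI a_assoc a_comm l_neg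
      intro: exI[of _ "\<ominus> _"])

lemma a_minus_regular_module [simp]: "a_minus (regular_module R) = a_minus R"
  by (intro ext) (simp add: a_minus_def a_inv_def m_inv_def)

context module
begin

lemma lin_comb_0 [simp]: "lin_comb M c v 0 = \<zero>\<^bsub>M\<^esub>"
  by (simp add: lin_comb_def)

lemma lin_comb_Suc:
  assumes "c \<in> {..<Suc n} \<rightarrow> carrier R" "v \<in> {..<Suc n} \<rightarrow> carrier M"
  shows "lin_comb M c v (Suc n) = lin_comb M c v n \<oplus>\<^bsub>M\<^esub> c n \<odot>\<^bsub>M\<^esub> v n"
proof -
  have "(\<lambda>i. c i \<odot>\<^bsub>M\<^esub> v i) \<in> {..<n} \<rightarrow> carrier M" "c n \<odot>\<^bsub>M\<^esub> v n \<in> carrier M"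
    using assms by (auto simp: Pi_iff less_Suc_eq)
  thus ?thesis
    by (simp add: lin_comb_def lessThan_Suc M.finsum_insert M.a_comm M.finsum_closed)
qed

lemma lin_comb_closed [intro]:
  assumes "c \<in> {..<n} \<rightarrow> carrier R" "v \<in> {..<n} \<rightarrow> carrier M"
  shows "lin_comb M c v n \<in> carrier M"
  unfolding lin_comb_def by (rule M.finsum_closed) (use assms in auto)

lemma lin_comb_cong:
  assumes "\<And>i. i < n \<Longrightarrow> c i = c' i" "\<And>i. i < n \<Longrightarrow> v i = v' i"
    "c' \<in> {..<n} \<rightarrow> carrier R" "v' \<in> {..<n} \<rightarrow> carrier M"
  shows "lin_comb M c v n = lin_comb M c' v' n"
  unfolding lin_comb_def by (rule M.finsum_cong') (use assms in \<open>auto simp: Pi_iff\<close>)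

lemma lin_comb_mem:
  assumes "c \<in> {..<n} \<rightarrow> carrier R" "v \<in> {..<n} \<rightarrow> V" and "submodule V R M"
  shows "lin_comb M c v n \<in> V"
  using assms(1,2)
proof (induction n)
  case 0
  thus ?case using submoduleE[OF assms(3)] subgroup.one_closed[OF submodule.axioms(1)[OF assms(3)]]
    by simp
next
  case (Suc n)
  have "lin_comb M c v n \<in> V" using Suc by (simp add: Pi_iff)
  moreover have "c n \<odot>\<^bsub>M\<^esub> v n \<in> V" using Suc submoduleE(4)[OF assms(3)] by (simp add: Pi_iff)
  moreover have "v \<in> {..<Suc n} \<rightarrow> carrier M" using Suc submoduleE(1)[OF assms(3)] by blast
  ultimately show ?case using lin_comb_Suc Suc.prems submoduleE(5)[OF assms(3)] by simp
qed

lemma lin_comb_add: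
  assumes "c \<in> {..<n} \<rightarrow> carrier R" "u \<in> {..<n} \<rightarrow> carrier M" "v \<in> {..<n} \<rightarrow> carrier M"
  shows "lin_comb M c (\<lambda>i. u i \<oplus>\<^bsub>M\<^esub> v i) n = lin_comb M c u n \<oplus>\<^bsub>M\<^esub> lin_comb M c v n"
proof -
  have "lin_comb M c (\<lambda>i. u i \<oplus>\<^bsub>M\<^esub> v i) n =
      (\<Oplus>\<^bsub>M\<^esub>i\<in>{..<n}. c i \<odot>\<^bsub>M\<^esub> u i \<oplus>\<^bsub>M\<^esub> c i \<odot>\<^bsub>M\<^esub> v i)"
    unfolding lin_comb_def by (rule M.finsum_cong') (use assms in \<open>auto simp: Pi_iff smult_r_distr\<close>)
  thus ?thesis
    unfolding lin_comb_def by (subst M.finsum_addf[symmetric]) (use assms in \<open>auto simp: Pi_iff\<close>)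
qed

lemma lin_comb_smult:
  assumes "c \<in> {..<n} \<rightarrow> carrier R" "v \<in> {..<n} \<rightarrow> carrier M" "r \<in> carrier R"
  shows "lin_comb M c (\<lambda>i. r \<odot>\<^bsub>M\<^esub> v i) n = r \<odot>\<^bsub>M\<^esub> lin_comb M c v n"
  unfolding lin_comb_def
  by (subst finsum_smult_ldistr, use assms in \<open>auto simp: Pi_iff\<close>)
    (rule M.finsum_cong', use assms in \<open>auto simp: Pi_iff smult_assoc1[symmetric] R.m_comm\<close>)

lemma lin_comb_diff:
  assumes "c \<in> {..<n} \<rightarrow> carrier R" "u \<in> {..<n} \<rightarrow> carrier M" "v \<in> {..<n} \<rightarrow> carrier M"
  shows "lin_comb M c (\<lambda>i. u i \<ominus>\<^bsub>M\<^esub> v i) n = lin_comb M c u n \<ominus>\<^bsub>M\<^esub> lin_comb M c v n"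
proof -
  have neg: "\<ominus>\<^bsub>M\<^esub> x = (\<ominus> \<one>) \<odot>\<^bsub>M\<^esub> x" if "x \<in> carrier M" for x
    using that smult_l_minus[of \<one> x] by simp
  have "lin_comb M c (\<lambda>i. u i \<ominus>\<^bsub>M\<^esub> v i) n =
      lin_comb M c (\<lambda>i. u i \<oplus>\<^bsub>M\<^esub> (\<ominus> \<one>) \<odot>\<^bsub>M\<^esub> v i) n"
    by (rule lin_comb_cong) (use assms neg in \<open>auto simp: Pi_iff M.minus_eq\<close>)
  also have "\<dots> = lin_comb M c u n \<oplus>\<^bsub>M\<^esub> (\<ominus> \<one>) \<odot>\<^bsub>M\<^esub> lin_comb M c v n"
    by (subst lin_comb_add, use assms in \<open>auto simp: Pi_iff\<close>, subst lin_comb_smult)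
      (use assms in \<open>auto simp: Pi_iff\<close>)
  also have "\<dots> = lin_comb M c u n \<ominus>\<^bsub>M\<^esub> lin_comb M c v n"
    using neg[of "lin_comb M c v n"] assms by (simp add: M.minus_eq lin_comb_closed)
  finally show ?thesis .
qed

lemma lin_comb_coeff_add:
  assumes "c \<in> {..<n} \<rightarrow> carrier R" "c' \<in> {..<n} \<rightarrow> carrier R" "v \<in> {..<n} \<rightarrow> carrier M"
  shows "lin_comb M (\<lambda>i. c i \<oplus> c' i) v n = lin_comb M c v n \<oplus>\<^bsub>M\<^esub> lin_comb M c' v n"
proof -
  have "lin_comb M (\<lambda>i. c i \<oplus> c' i) v n =
      (\<Oplus>\<^bsub>M\<^esub>i\<in>{..<n}. c i \<odot>\<^bsub>M\<^esub> v i \<oplus>\<^bsub>M\<^esub> c' i \<odot>\<^bsub>M\<^esub> v i)"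
    unfolding lin_comb_def by (rule M.finsum_cong') (use assms in \<open>auto simp: Pi_iff smult_l_distr\<close>)
  thus ?thesis
    unfolding lin_comb_def by (subst M.finsum_addf[symmetric]) (use assms in \<open>auto simp: Pi_iff\<close>)
qed

lemma lin_comb_coeff_smult:
  assumes "c \<in> {..<n} \<rightarrow> carrier R" "v \<in> {..<n} \<rightarrow> carrier M" "r \<in> carrier R"
  shows "lin_comb M (\<lambda>i. r \<otimes> c i) v n = r \<odot>\<^bsub>M\<^esub> lin_comb M c v n"
  unfolding lin_comb_def
  by (subst finsum_smult_ldistr, use assms in \<open>auto simp: Pi_iff\<close>)
    (rule M.finsum_cong', use assms in \<open>auto simp: Pi_iff smult_assoc1\<close>)

lemma lin_comb_zero_vector:
  assumes "c \<in> {..<n} \<rightarrow> carrier R"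
  shows "lin_comb M c (\<lambda>i. \<zero>\<^bsub>M\<^esub>) n = \<zero>\<^bsub>M\<^esub>"
proof -
  have "lin_comb M c (\<lambda>i. \<zero>\<^bsub>M\<^esub>) n = (\<Oplus>\<^bsub>M\<^esub>i\<in>{..<n}. \<zero>\<^bsub>M\<^esub>)"
    unfolding lin_comb_def by (rule M.finsum_cong') (use assms in \<open>auto simp: Pi_iff\<close>)
  thus ?thesis by (simp add: M.finsum_zero)
qed

lemma lin_comb_zero_coeff:
  assumes "v \<in> {..<n} \<rightarrow> carrier M"
  shows "lin_comb M (\<lambda>i. \<zero>) v n = \<zero>\<^bsub>M\<^esub>"
proof -
  have "lin_comb M (\<lambda>i. \<zero>) v n = (\<Oplus>\<^bsub>M\<^esub>i\<in>{..<n}. \<zero>\<^bsub>M\<^esub>)"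
    unfolding lin_comb_def by (rule M.finsum_cong') (use assms in \<open>auto simp: Pi_iff\<close>)
  thus ?thesis by (simp add: M.finsum_zero)
qed

lemma lin_comb_unit_vector:
  assumes "v \<in> {..<n} \<rightarrow> carrier M" "k < n"
  shows "lin_comb M (\<lambda>i. if i = k then \<one> else \<zero>) v n = v k"
proof -
  have "lin_comb M (\<lambda>i. if i = k then \<one> else \<zero>) v n = (\<Oplus>\<^bsub>M\<^esub>i\<in>{..<n}. if k = i then v i else \<zero>\<^bsub>M\<^esub>)"
    unfolding lin_comb_def by (rule M.finsum_cong') (use assms in \<open>auto simp: Pi_iff\<close>)
  also have "\<dots> = v k" by (rule M.finsum_singleton) (use assms in auto)
  finally show ?thesis .
qed

text \<open>Associativity of the product of a row, a matrix and a column.\<close>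
lemma lin_comb_swap:
  assumes "w \<in> {..<n} \<rightarrow> carrier R" "\<And>k. k < n \<Longrightarrow> A k \<in> {..<p} \<rightarrow> carrier R"
    "v \<in> {..<p} \<rightarrow> carrier M"
  shows "lin_comb M w (\<lambda>k. lin_comb M (A k) v p) n =
    lin_comb M (\<lambda>i. lin_comb (regular_module R) w (\<lambda>k. A k i) n) v p"
  using assms(1,2)
proof (induction n)
  interpret reg: module R "regular_module R" by (rule R.module_regular)
  case 0
  thus ?case using lin_comb_zero_coeff[OF assms(3)] reg.lin_comb_0 by simp
next
  interpret reg: module R "regular_module R" by (rule R.module_regular)
  case (Suc n)
  have w: "w \<in> {..<n} \<rightarrow> carrier R" "w n \<in> carrier R" and A: "A n \<in> {..<p} \<rightarrow> carrier R"
    using Suc.prems by auto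
  have col: "lin_comb (regular_module R) w (\<lambda>k. A k i) (Suc n) =
      lin_comb (regular_module R) w (\<lambda>k. A k i) n \<oplus> w n \<otimes> A n i"
    and colc: "lin_comb (regular_module R) w (\<lambda>k. A k i) n \<in> carrier R" if "i < p" for i
  proof -
    show "lin_comb (regular_module R) w (\<lambda>k. A k i) (Suc n) =
      lin_comb (regular_module R) w (\<lambda>k. A k i) n \<oplus> w n \<otimes> A n i"
      by (subst reg.lin_comb_Suc) (use Suc.prems that in \<open>auto simp: Pi_iff\<close>)
    have "lin_comb (regular_module R) w (\<lambda>k. A k i) n \<in> carrier (regular_module R)"
      by (rule reg.lin_comb_closed) (use Suc.prems that in \<open>auto simp: Pi_iff\<close>)
    thus "lin_comb (regular_module R) w (\<lambda>k. A k i) n \<in> carrier R" by simp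
  qed
  have "lin_comb M w (\<lambda>k. lin_comb M (A k) v p) (Suc n) =
      lin_comb M w (\<lambda>k. lin_comb M (A k) v p) n \<oplus>\<^bsub>M\<^esub> w n \<odot>\<^bsub>M\<^esub> lin_comb M (A n) v p"
    by (rule lin_comb_Suc) (use Suc.prems assms(3) lin_comb_closed in auto)
  also have "\<dots> = lin_comb M (\<lambda>i. lin_comb (regular_module R) w (\<lambda>k. A k i) n) v p \<oplus>\<^bsub>M\<^esub>
      lin_comb M (\<lambda>i. w n \<otimes> A n i) v p"
    using Suc w A assms(3) by (subst lin_comb_coeff_smult) auto
  also have "\<dots> = lin_comb M (\<lambda>i. lin_comb (regular_module R) w (\<lambda>k. A k i) n \<oplus> w n \<otimes> A n i) v p"
    by (rule lin_comb_coeff_add[symmetric]) (use w A assms(3) colc in auto)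
  also have "\<dots> = lin_comb M (\<lambda>i. lin_comb (regular_module R) w (\<lambda>k. A k i) (Suc n)) v p"
    by (rule lin_comb_cong) (use w A assms(3) col colc in \<open>auto simp: Pi_iff\<close>)
  finally show ?case .
qed

end

lemma (in abelian_group) diff_eq_zero_iff [simp]:
  assumes "x \<in> carrier G" "y \<in> carrier G"
  shows "x \<ominus> y = \<zero> \<longleftrightarrow> x = y"
  using assms add.inv_solve_right[of \<zero> x y] by (auto simp: minus_eq r_neg a_inv_def)

lemma module_homs_zero:
  assumes "module R M" "module R N" "f \<in> module_homs R M N"
  shows "f \<zero>\<^bsub>M\<^esub> = \<zero>\<^bsub>N\<^esub>"
proof -
  interpret M: module R M by fact
  interpret N: module R N by fact
  have "f (\<zero>\<^bsub>R\<^esub> \<odot>\<^bsub>M\<^esub> \<zero>\<^bsub>M\<^esub>) = \<zero>\<^bsub>R\<^esub> \<odot>\<^bsub>N\<^esub> f \<zero>\<^bsub>M\<^esub>"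
    using assms(3) M.R.zero_closed M.M.zero_closed
    by (simp add: module_homs_def del: M.smult_l_null M.smult_r_null)
  moreover have "f \<zero>\<^bsub>M\<^esub> \<in> carrier N" using assms(3) by (auto simp: module_homs_def)
  ultimately show ?thesis by simp
qed

lemma module_homs_lin_comb:
  assumes "module R M" "module R N" "f \<in> module_homs R M N"
    "c \<in> {..<n} \<rightarrow> carrier R" "v \<in> {..<n} \<rightarrow> carrier M"
  shows "f (lin_comb M c v n) = lin_comb N c (\<lambda>i. f (v i)) n"
  using assms(4,5)
proof (induction n)
  interpret M: module R M by fact
  interpret N: module R N by fact
  case 0
  thus ?case using module_homs_zero[OF assms(1-3)] by simp
next
  interpret M: module R M by fact
  interpret N: module R N by fact
  case (Suc n)
  have f: "f x \<in> carrier N" if "x \<in> carrier M" for x using that assms(3) by (auto simp: module_homs_def)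
  have "f (lin_comb M c v (Suc n)) = f (lin_comb M c v n \<oplus>\<^bsub>M\<^esub> c n \<odot>\<^bsub>M\<^esub> v n)"
    using M.lin_comb_Suc Suc.prems by simp
  also have "\<dots> = f (lin_comb M c v n) \<oplus>\<^bsub>N\<^esub> c n \<odot>\<^bsub>N\<^esub> f (v n)"
    using assms(3) Suc.prems M.lin_comb_closed[of c n v] by (auto simp: module_homs_def Pi_iff)
  also have "\<dots> = lin_comb N c (\<lambda>i. f (v i)) (Suc n)"
    using Suc f by (subst N.lin_comb_Suc) (auto simp: Pi_iff)
  finally show ?case .
qed

lemma module_homs_diff:
  assumes "module R M" "module R N" "f \<in> module_homs R M N" "x \<in> carrier M" "y \<in> carrier M"
  shows "f (x \<ominus>\<^bsub>M\<^esub> y) = f x \<ominus>\<^bsub>N\<^esub> f y"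
proof -
  interpret M: module R M by fact
  interpret N: module R N by fact
  have f: "f x \<in> carrier N" if "x \<in> carrier M" for x using that assms(3) by (auto simp: module_homs_def)
  have "f (x \<ominus>\<^bsub>M\<^esub> y) = f (x \<oplus>\<^bsub>M\<^esub> (\<ominus>\<^bsub>R\<^esub> \<one>\<^bsub>R\<^esub>) \<odot>\<^bsub>M\<^esub> y)"
    using assms M.smult_l_minus[of "\<one>\<^bsub>R\<^esub>" y] by (simp add: M.M.minus_eq)
  also have "\<dots> = f x \<oplus>\<^bsub>N\<^esub> (\<ominus>\<^bsub>R\<^esub> \<one>\<^bsub>R\<^esub>) \<odot>\<^bsub>N\<^esub> f y"
    using assms by (auto simp: module_homs_def)
  also have "\<dots> = f x \<ominus>\<^bsub>N\<^esub> f y"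
    using N.smult_l_minus[of "\<one>\<^bsub>R\<^esub>" "f y"] f[OF assms(4)] f[OF assms(5)] by (simp add: N.M.minus_eq)
  finally show ?thesis .
qed

lemma (in module) submoduleI':
  assumes "H \<subseteq> carrier M" "\<zero>\<^bsub>M\<^esub> \<in> H" "\<And>a b. \<lbrakk>a \<in> H; b \<in> H\<rbrakk> \<Longrightarrow> a \<oplus>\<^bsub>M\<^esub> b \<in> H"
    "\<And>a x. \<lbrakk>a \<in> carrier R; x \<in> H\<rbrakk> \<Longrightarrow> a \<odot>\<^bsub>M\<^esub> x \<in> H"
  shows "submodule H R M"
proof (rule submoduleI)
  fix a assume a: "a \<in> H"
  have "\<ominus>\<^bsub>M\<^esub> a = (\<ominus> \<one>) \<odot>\<^bsub>M\<^esub> a" using a assms(1) smult_l_minus[of \<one> a] by auto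
  thus "\<ominus>\<^bsub>M\<^esub> a \<in> H" using assms(4)[of "\<ominus> \<one>" a] a by simp
qed (use assms in auto)

lemma (in cring) submodule_regular_if_ideal:
  assumes "ideal I R"
  shows "submodule I R (regular_module R)"
proof -
  interpret I: ideal I R by fact
  interpret reg: module R "regular_module R" by (rule module_regular)
  show ?thesis by (rule reg.submoduleI') (use I.Icarr I.I_l_closed in auto)
qed

text \<open>The test module for injectivity used here is the inclusion of an ideal into \<open>R\<close>. A homomorphism
  defined on \<open>R\<close> is given by the image of \<open>1\<close>.\<close>
lemma (in cring) ideal_extension:
  assumes E: "injective_module R E" and I: "ideal I R"
    and g: "g \<in> I \<rightarrow> carrier E"
    and g_add: "\<And>s t. \<lbrakk>s \<in> I; t \<in> I\<rbrakk> \<Longrightarrow> g (s \<oplus> t) = g s \<oplus>\<^bsub>E\<^esub> g t"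
    and g_smult: "\<And>r t. \<lbrakk>r \<in> carrier R; t \<in> I\<rbrakk> \<Longrightarrow> g (r \<otimes> t) = r \<odot>\<^bsub>E\<^esub> g t"
  shows "\<exists>e\<in>carrier E. \<forall>t\<in>I. g t = t \<odot>\<^bsub>E\<^esub> e"
proof -
  interpret I: ideal I R by fact
  let ?N = "regular_module R" and ?M = "(regular_module R)\<lparr>carrier := I\<rparr>"
  have "module R ?M" "module R ?N"
    using submodule.submodule_is_module[OF submodule_regular_if_ideal[OF I] module_regular]
      module_regular by auto
  moreover have "(\<lambda>x. x) \<in> module_homs R ?M ?N" using I.Icarr by (auto simp: module_homs_def)
  moreover have "inj_on (\<lambda>x. x) (carrier ?M)" by simp
  moreover have "g \<in> module_homs R ?M E" using g g_add g_smult by (auto simp: module_homs_def)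
  ultimately obtain h where h: "h \<in> module_homs R ?N E" "\<forall>x\<in>I. h x = g x"
    using E unfolding injective_module_def by fastforce
  have "g t = t \<odot>\<^bsub>E\<^esub> h \<one>" if "t \<in> I" for t
  proof -
    have "h (t \<otimes> \<one>) = t \<odot>\<^bsub>E\<^esub> h \<one>"
      using h(1) I.Icarr[OF that] by (simp add: module_homs_def del: r_one)
    thus ?thesis using h that I.Icarr by simp
  qed
  moreover have "h \<one> \<in> carrier E" using h(1) by (auto simp: module_homs_def)
  ultimately show ?thesis by blast
qed

text \<open>The unknowns are eliminated one by one. The relations between the coefficients of the other unknowns yield the
  possible coefficients \<open>t\<close> of the last one, which form an ideal; the right-hand sides define a
  homomorphism on this ideal, and the value of the unknown is obtained by extending it to \<open>R\<close>.\<close>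
lemma (in cring) injective_module_system_solvable:
  assumes E: "injective_module R E"
    and A: "\<And>k. k < n \<Longrightarrow> A k \<in> {..<p} \<rightarrow> carrier R"
    and e: "e \<in> {..<n} \<rightarrow> carrier E"
    and consistent: "\<And>w. \<lbrakk>w \<in> {..<n} \<rightarrow> carrier R;
        \<And>i. i < p \<Longrightarrow> lin_comb (regular_module R) w (\<lambda>k. A k i) n = \<zero>\<rbrakk> \<Longrightarrow> lin_comb E w e n = \<zero>\<^bsub>E\<^esub>"
  shows "\<exists>y\<in>{..<p} \<rightarrow> carrier E. \<forall>k<n. lin_comb E (A k) y p = e k"
  using A e consistent
proof (induction p arbitrary: e)
  case 0
  interpret E: module R E using E by (simp add: injective_module_def)
  have "e k = \<zero>\<^bsub>E\<^esub>" if "k < n" for k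
  proof -
    \<comment> \<open>Without unknowns, every vector is a relation, in particular each unit vector.\<close>
    have "lin_comb E (\<lambda>i. if i = k then \<one> else \<zero>) e n = \<zero>\<^bsub>E\<^esub>" by (rule 0(3)) auto
    thus ?thesis using E.lin_comb_unit_vector[OF 0(2) that] by simp
  qed
  thus ?case by auto
next
  case (Suc p)
  interpret E: module R E using E by (simp add: injective_module_def)
  interpret reg: module R "regular_module R" by (rule module_regular)
  let ?lc = "lin_comb (regular_module R)"
  define W where "W = {w \<in> {..<n} \<rightarrow> carrier R. \<forall>i<p. ?lc w (\<lambda>k. A k i) n = \<zero>}"
  define I where "I = (\<lambda>w. ?lc w (\<lambda>k. A k p) n) ` W"
  have col: "(\<lambda>k. A k i) \<in> {..<n} \<rightarrow> carrier R" if "i \<le> p" for i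
    using Suc.prems(1) that by (auto simp: Pi_iff)
  have lcc: "?lc w (\<lambda>k. A k i) n \<in> carrier R" if "w \<in> W" "i \<le> p" for w i
    using reg.lin_comb_closed[of w n "\<lambda>k. A k i"] that col by (simp add: W_def)
  have W_add: "(\<lambda>k. w k \<oplus> w' k) \<in> W" and W_add_lc:
      "?lc (\<lambda>k. w k \<oplus> w' k) (\<lambda>k. A k p) n = ?lc w (\<lambda>k. A k p) n \<oplus> ?lc w' (\<lambda>k. A k p) n"
    if "w \<in> W" "w' \<in> W" for w w'
  proof -
    have *: "?lc (\<lambda>k. w k \<oplus> w' k) (\<lambda>k. A k i) n = ?lc w (\<lambda>k. A k i) n \<oplus> ?lc w' (\<lambda>k. A k i) n"
      if "i \<le> p" for i
      using reg.lin_comb_coeff_add[of w n w' "\<lambda>k. A k i"] col[OF that] \<open>w \<in> W\<close> \<open>w' \<in> W\<close>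
      by (simp add: W_def)
    show "(\<lambda>k. w k \<oplus> w' k) \<in> W" using that * by (auto simp: W_def)
    show "?lc (\<lambda>k. w k \<oplus> w' k) (\<lambda>k. A k p) n = ?lc w (\<lambda>k. A k p) n \<oplus> ?lc w' (\<lambda>k. A k p) n"
      using * by simp
  qed
  have W_smult: "(\<lambda>k. r \<otimes> w k) \<in> W" and W_smult_lc:
      "?lc (\<lambda>k. r \<otimes> w k) (\<lambda>k. A k p) n = r \<otimes> ?lc w (\<lambda>k. A k p) n"
    if "w \<in> W" "r \<in> carrier R" for w r
  proof -
    have *: "?lc (\<lambda>k. r \<otimes> w k) (\<lambda>k. A k i) n = r \<otimes> ?lc w (\<lambda>k. A k i) n" if "i \<le> p" for i
      using reg.lin_comb_coeff_smult[of w n "\<lambda>k. A k i" r] col[OF that] \<open>w \<in> W\<close> \<open>r \<in> carrier R\<close>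
      by (simp add: W_def)
    show "(\<lambda>k. r \<otimes> w k) \<in> W" using that * by (auto simp: W_def)
    show "?lc (\<lambda>k. r \<otimes> w k) (\<lambda>k. A k p) n = r \<otimes> ?lc w (\<lambda>k. A k p) n" using * by simp
  qed
  have W_zero: "(\<lambda>k. \<zero>) \<in> W"
    using reg.lin_comb_zero_coeff col by (auto simp: W_def)
  have I_ideal: "ideal I R"
  proof (rule idealI')
    show "I \<subseteq> carrier R" using lcc by (auto simp: I_def)
    show "\<zero> \<in> I"
      using W_zero reg.lin_comb_zero_coeff[of "\<lambda>k. A k p" n] col[of p]
      by (auto simp: I_def intro!: image_eqI[of _ _ "\<lambda>k. \<zero>"])
    fix x y assume "x \<in> I" "y \<in> I"
    then obtain w w' where w: "w \<in> W" "w' \<in> W" "x = ?lc w (\<lambda>k. A k p) n" "y = ?lc w' (\<lambda>k. A k p) n"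
      unfolding I_def by blast
    hence "x \<oplus> y = ?lc (\<lambda>k. w k \<oplus> w' k) (\<lambda>k. A k p) n" using W_add_lc by simp
    thus "x \<oplus> y \<in> I" unfolding I_def using W_add[OF w(1,2)] by simp
  next
    fix r x assume r: "r \<in> carrier R" and "x \<in> I"
    then obtain w where w: "w \<in> W" "x = ?lc w (\<lambda>k. A k p) n" unfolding I_def by blast
    hence "r \<otimes> x = ?lc (\<lambda>k. r \<otimes> w k) (\<lambda>k. A k p) n" using W_smult_lc r by simp
    thus "r \<otimes> x \<in> I" unfolding I_def using W_smult[OF w(1) r] by simp
  qed
  have unique: "lin_comb E w e n = lin_comb E w' e n"
    if w: "w \<in> W" "w' \<in> W" "?lc w (\<lambda>k. A k p) n = ?lc w' (\<lambda>k. A k p) n" for w w'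
  proof -
    have wc: "w \<in> {..<n} \<rightarrow> carrier R" "w' \<in> {..<n} \<rightarrow> carrier R" using w by (auto simp: W_def)
    have m: "(\<lambda>k. \<ominus> \<one> \<otimes> w' k) \<in> W" using W_smult w by simp
    have mc: "(\<lambda>k. \<ominus> \<one> \<otimes> w' k) \<in> {..<n} \<rightarrow> carrier R" using m by (simp add: W_def)
    have d: "(\<lambda>k. w k \<oplus> \<ominus> \<one> \<otimes> w' k) \<in> W" using W_add[OF w(1) m] .
    have "?lc (\<lambda>k. w k \<oplus> \<ominus> \<one> \<otimes> w' k) (\<lambda>k. A k p) n = \<zero>"
      using W_add_lc[OF w(1) m] W_smult_lc[OF w(2), of "\<ominus> \<one>"] w lcc[OF w(2), of p]
      by (simp add: l_minus r_neg)
    hence "lin_comb E (\<lambda>k. w k \<oplus> \<ominus> \<one> \<otimes> w' k) e n = \<zero>\<^bsub>E\<^esub>"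
      using d by (intro Suc.prems(3)) (auto simp: W_def less_Suc_eq)
    moreover have "lin_comb E (\<lambda>k. w k \<oplus> \<ominus> \<one> \<otimes> w' k) e n =
        lin_comb E w e n \<oplus>\<^bsub>E\<^esub> (\<ominus> \<one>) \<odot>\<^bsub>E\<^esub> lin_comb E w' e n"
      using E.lin_comb_coeff_add[OF wc(1) mc Suc.prems(2)]
        E.lin_comb_coeff_smult[OF wc(2) Suc.prems(2), of "\<ominus> \<one>"] by simp
    moreover have "(\<ominus> \<one>) \<odot>\<^bsub>E\<^esub> lin_comb E w' e n = \<ominus>\<^bsub>E\<^esub> lin_comb E w' e n"
      using E.smult_l_minus[of \<one> "lin_comb E w' e n"] wc Suc.prems(2) by (simp add: E.lin_comb_closed)
    ultimately show ?thesis
      using E.lin_comb_closed[OF wc(1) Suc.prems(2)] E.lin_comb_closed[OF wc(2) Suc.prems(2)]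
      by (simp add: E.M.minus_eq[symmetric])
  qed
  define pick where "pick t = (SOME w. w \<in> W \<and> t = ?lc w (\<lambda>k. A k p) n)" for t
  have pick: "pick t \<in> W" "t = ?lc (pick t) (\<lambda>k. A k p) n" if "t \<in> I" for t
    using someI_ex[of "\<lambda>w. w \<in> W \<and> t = ?lc w (\<lambda>k. A k p) n"] that by (auto simp: I_def pick_def)
  define g where "g t = lin_comb E (pick t) e n" for t
  have g_eq: "g (?lc w (\<lambda>k. A k p) n) = lin_comb E w e n" if "w \<in> W" for w
  proof -
    have "?lc w (\<lambda>k. A k p) n \<in> I" using that by (auto simp: I_def)
    from pick[OF this] show ?thesis unfolding g_def using unique that by metis
  qed
  have "\<exists>y\<in>carrier E. \<forall>t\<in>I. g t = t \<odot>\<^bsub>E\<^esub> y"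
  proof (rule ideal_extension[OF E I_ideal])
    show "g \<in> I \<rightarrow> carrier E"
      using pick Suc.prems(2) E.lin_comb_closed by (auto simp: g_def W_def)
    fix s t assume st: "s \<in> I" "t \<in> I"
    show "g (s \<oplus> t) = g s \<oplus>\<^bsub>E\<^esub> g t"
    proof -
      obtain w w' where w: "w \<in> W" "w' \<in> W" "s = ?lc w (\<lambda>k. A k p) n" "t = ?lc w' (\<lambda>k. A k p) n"
        using st by (auto simp: I_def)
      have "g (s \<oplus> t) = lin_comb E (\<lambda>k. w k \<oplus> w' k) e n"
        using g_eq[OF W_add[OF w(1,2)]] W_add_lc[OF w(1,2)] w by simp
      also have "\<dots> = lin_comb E w e n \<oplus>\<^bsub>E\<^esub> lin_comb E w' e n"
        using E.lin_comb_coeff_add Suc.prems(2) w by (simp add: W_def)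
      finally show ?thesis using g_eq w by simp
    qed
  next
    fix r t assume rt: "r \<in> carrier R" "t \<in> I"
    then obtain w where w: "w \<in> W" "t = ?lc w (\<lambda>k. A k p) n" by (auto simp: I_def)
    have "g (r \<otimes> t) = lin_comb E (\<lambda>k. r \<otimes> w k) e n"
      using g_eq[OF W_smult[OF w(1) rt(1)]] W_smult_lc[OF w(1) rt(1)] w by simp
    also have "\<dots> = r \<odot>\<^bsub>E\<^esub> lin_comb E w e n"
      using E.lin_comb_coeff_smult Suc.prems(2) w rt by (simp add: W_def)
    finally show "g (r \<otimes> t) = r \<odot>\<^bsub>E\<^esub> g t" using g_eq w by simp
  qed
  then obtain y where y: "y \<in> carrier E" "\<And>t. t \<in> I \<Longrightarrow> g t = t \<odot>\<^bsub>E\<^esub> y" by blast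
  define e' where "e' k = e k \<ominus>\<^bsub>E\<^esub> A k p \<odot>\<^bsub>E\<^esub> y" for k
  have Ay: "(\<lambda>k. A k p \<odot>\<^bsub>E\<^esub> y) \<in> {..<n} \<rightarrow> carrier E" using col[of p] y by auto
  have e'c: "e' \<in> {..<n} \<rightarrow> carrier E" using Suc.prems(2) Ay by (auto simp: e'_def Pi_iff)
  have "\<exists>z\<in>{..<p} \<rightarrow> carrier E. \<forall>k<n. lin_comb E (A k) z p = e' k"
  proof (rule Suc.IH)
    show "A k \<in> {..<p} \<rightarrow> carrier R" if "k < n" for k using Suc.prems(1)[OF that] by auto
    show "e' \<in> {..<n} \<rightarrow> carrier E" by (rule e'c)
    fix w assume "w \<in> {..<n} \<rightarrow> carrier R"
      and "\<And>i. i < p \<Longrightarrow> ?lc w (\<lambda>k. A k i) n = \<zero>"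
    hence w: "w \<in> W" "w \<in> {..<n} \<rightarrow> carrier R" by (auto simp: W_def)
    have "lin_comb E w e' n = lin_comb E w e n \<ominus>\<^bsub>E\<^esub> lin_comb E w (\<lambda>k. A k p \<odot>\<^bsub>E\<^esub> y) n"
      unfolding e'_def by (rule E.lin_comb_diff[OF w(2) Suc.prems(2) Ay])
    also have "lin_comb E w (\<lambda>k. A k p \<odot>\<^bsub>E\<^esub> y) n = ?lc w (\<lambda>k. A k p) n \<odot>\<^bsub>E\<^esub> y"
    proof -
      have one: "lin_comb E c (\<lambda>_. y) (Suc 0) = c 0 \<odot>\<^bsub>E\<^esub> y" if "c 0 \<in> carrier R" for c
        using that y by (subst E.lin_comb_Suc) auto
      have "lin_comb E w (\<lambda>k. A k p \<odot>\<^bsub>E\<^esub> y) n =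
          lin_comb E w (\<lambda>k. lin_comb E (\<lambda>_. A k p) (\<lambda>_. y) (Suc 0)) n"
        by (rule E.lin_comb_cong) (use w col[of p] y one in \<open>auto simp: Pi_iff\<close>)
      also have "\<dots> = lin_comb E (\<lambda>_. ?lc w (\<lambda>k. A k p) n) (\<lambda>_. y) (Suc 0)"
        by (rule E.lin_comb_swap) (use w col[of p] y in \<open>auto simp: Pi_iff\<close>)
      also have "\<dots> = ?lc w (\<lambda>k. A k p) n \<odot>\<^bsub>E\<^esub> y" using one lcc[OF w(1), of p] by simp
      finally show ?thesis .
    qed
    also have "\<dots> = lin_comb E w e n" using y(2)[of "?lc w (\<lambda>k. A k p) n"] g_eq[OF w(1)] w(1)
      by (auto simp: I_def)
    also have "lin_comb E w e n \<ominus>\<^bsub>E\<^esub> lin_comb E w e n = \<zero>\<^bsub>E\<^esub>"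
      using E.lin_comb_closed[OF w(2) Suc.prems(2)] by (simp add: E.M.minus_eq E.M.r_neg)
    finally show "lin_comb E w e' n = \<zero>\<^bsub>E\<^esub>" .
  qed
  then obtain z where z: "z \<in> {..<p} \<rightarrow> carrier E" "\<And>k. k < n \<Longrightarrow> lin_comb E (A k) z p = e' k"
    by blast
  show ?case
  proof (rule bexI[of _ "z(p := y)"], intro allI impI)
    show zy: "z(p := y) \<in> {..<Suc p} \<rightarrow> carrier E" using z y by (auto simp: less_Suc_eq)
    fix k assume k: "k < n"
    have "lin_comb E (A k) (z(p := y)) (Suc p) = lin_comb E (A k) (z(p := y)) p \<oplus>\<^bsub>E\<^esub> A k p \<odot>\<^bsub>E\<^esub> y"
      using E.lin_comb_Suc[OF Suc.prems(1)[OF k] zy] by simp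
    also have "lin_comb E (A k) (z(p := y)) p = lin_comb E (A k) z p"
      by (rule E.lin_comb_cong) (use z Suc.prems(1)[OF k] in \<open>auto simp: Pi_iff\<close>)
    also have "\<dots> \<oplus>\<^bsub>E\<^esub> A k p \<odot>\<^bsub>E\<^esub> y = e k"
      using z(2)[OF k] Suc.prems(2) Ay k
      by (simp add: e'_def Pi_iff E.M.minus_eq E.M.a_assoc E.M.l_neg)
    finally show "lin_comb E (A k) (z(p := y)) (Suc p) = e k" .
  qed
qed

section \<open>Free resolutions\<close>

lemma (in module) lin_comb_append:
  assumes "c \<in> {..<s} \<rightarrow> carrier R" "v \<in> {..<s} \<rightarrow> carrier M"
    "c' \<in> {..<q} \<rightarrow> carrier R" "v' \<in> {..<q} \<rightarrow> carrier M"
  shows "lin_comb M (\<lambda>h. if h < s then c h else c' (h - s)) (\<lambda>h. if h < s then v h else v' (h - s)) (s + q) =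
    lin_comb M c v s \<oplus>\<^bsub>M\<^esub> lin_comb M c' v' q"
  using assms(3,4)
proof (induction q)
  case 0
  have "lin_comb M (\<lambda>h. if h < s then c h else c' (h - s)) (\<lambda>h. if h < s then v h else v' (h - s)) s =
    lin_comb M c v s"
    by (rule lin_comb_cong) (use assms in auto)
  thus ?case using lin_comb_closed[OF assms(1,2)] by simp
next
  case (Suc q)
  let ?c = "\<lambda>h. if h < s then c h else c' (h - s)" and ?v = "\<lambda>h. if h < s then v h else v' (h - s)"
  have c: "?c \<in> {..<Suc (s + q)} \<rightarrow> carrier R" and v: "?v \<in> {..<Suc (s + q)} \<rightarrow> carrier M"
    using assms Suc.prems by (auto simp: Pi_iff)
  have "lin_comb M ?c ?v (s + Suc q) = lin_comb M ?c ?v (s + q) \<oplus>\<^bsub>M\<^esub> c' q \<odot>\<^bsub>M\<^esub> v' q"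
    using lin_comb_Suc[OF c v] by simp
  also have "lin_comb M ?c ?v (s + q) = lin_comb M c v s \<oplus>\<^bsub>M\<^esub> lin_comb M c' v' q"
    by (rule Suc.IH) (use Suc.prems in auto)
  also have "\<dots> \<oplus>\<^bsub>M\<^esub> c' q \<odot>\<^bsub>M\<^esub> v' q = lin_comb M c v s \<oplus>\<^bsub>M\<^esub> lin_comb M c' v' (Suc q)"
  proof -
    have "lin_comb M c' v' q \<in> carrier M" "c' q \<odot>\<^bsub>M\<^esub> v' q \<in> carrier M"
      using Suc.prems by (auto simp: Pi_iff intro!: lin_comb_closed)
    thus ?thesis using lin_comb_Suc[OF Suc.prems] lin_comb_closed[OF assms(1,2)]
      by (simp add: M.a_assoc)
  qed
  finally show ?case .
qed

lemma (in cring) genideal_eq_lin_combs: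
  assumes f: "f \<in> {..<s} \<rightarrow> carrier R"
  shows "Idl (f ` {..<s}) = {lin_comb (regular_module R) c f s | c. c \<in> {..<s} \<rightarrow> carrier R}"
proof (rule equalityI)
  interpret reg: module R "regular_module R" by (rule module_regular)
  let ?L = "{lin_comb (regular_module R) c f s | c. c \<in> {..<s} \<rightarrow> carrier R}"
  have fs: "f ` {..<s} \<subseteq> carrier R" using f by auto
  have lc: "lin_comb (regular_module R) c f s \<in> carrier R" if "c \<in> {..<s} \<rightarrow> carrier R" for c
    using reg.lin_comb_closed[OF that] f by simp
  have add: "lin_comb (regular_module R) (\<lambda>i. c i \<oplus> c' i) f s =
      lin_comb (regular_module R) c f s \<oplus> lin_comb (regular_module R) c' f s"
    if "c \<in> {..<s} \<rightarrow> carrier R" "c' \<in> {..<s} \<rightarrow> carrier R" for c c'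
    using reg.lin_comb_coeff_add that f by simp
  have smult: "lin_comb (regular_module R) (\<lambda>i. r \<otimes> c i) f s = r \<otimes> lin_comb (regular_module R) c f s"
    if "c \<in> {..<s} \<rightarrow> carrier R" "r \<in> carrier R" for c r
    using reg.lin_comb_coeff_smult that f by simp
  have "ideal ?L R"
  proof (rule idealI')
    show "?L \<subseteq> carrier R" using lc by blast
    have "lin_comb (regular_module R) (\<lambda>i. \<zero>) f s = \<zero>" using reg.lin_comb_zero_coeff f by simp
    thus "\<zero> \<in> ?L" by force
    fix x y assume "x \<in> ?L" "y \<in> ?L"
    then obtain c c' where c: "c \<in> {..<s} \<rightarrow> carrier R" "x = lin_comb (regular_module R) c f s"
      "c' \<in> {..<s} \<rightarrow> carrier R" "y = lin_comb (regular_module R) c' f s" by blast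
    hence "x \<oplus> y = lin_comb (regular_module R) (\<lambda>i. c i \<oplus> c' i) f s" using add by simp
    moreover have "(\<lambda>i. c i \<oplus> c' i) \<in> {..<s} \<rightarrow> carrier R" using c by auto
    ultimately show "x \<oplus> y \<in> ?L" by auto
  next
    fix r x assume r: "r \<in> carrier R" and "x \<in> ?L"
    then obtain c where c: "c \<in> {..<s} \<rightarrow> carrier R" "x = lin_comb (regular_module R) c f s" by blast
    hence "r \<otimes> x = lin_comb (regular_module R) (\<lambda>i. r \<otimes> c i) f s" using smult r by simp
    moreover have "(\<lambda>i. r \<otimes> c i) \<in> {..<s} \<rightarrow> carrier R" using c r by auto
    ultimately show "r \<otimes> x \<in> ?L" by blast
  qed
  moreover have "f ` {..<s} \<subseteq> ?L"
  proof (rule image_subsetI)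
    fix h assume "h \<in> {..<s}"
    hence "f h = lin_comb (regular_module R) (\<lambda>i. if i = h then \<one> else \<zero>) f s"
      using reg.lin_comb_unit_vector[of f s h] f by simp
    thus "f h \<in> ?L" by force
  qed
  ultimately show "Idl (f ` {..<s}) \<subseteq> ?L" using genideal_minimal by blast
  show "?L \<subseteq> Idl (f ` {..<s})"
  proof clarify
    fix c assume c: "c \<in> {..<s} \<rightarrow> carrier R"
    show "lin_comb (regular_module R) c f s \<in> Idl (f ` {..<s})"
    proof (rule reg.lin_comb_mem[OF c])
      show "f \<in> {..<s} \<rightarrow> Idl (f ` {..<s})" using genideal_self[OF fs] by blast
      show "submodule (Idl (f ` {..<s})) R (regular_module R)"
        using submodule_regular_if_ideal genideal_ideal[OF fs] by blast
    qed
  qed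
qed

lemma (in noetherian_ring) obtain_ideal_generators:
  assumes "ideal I R"
  obtains s :: nat and f where "f \<in> {..<s} \<rightarrow> I" "I = Idl (f ` {..<s})"
proof -
  obtain F where F: "F \<subseteq> carrier R" "finite F" "I = Idl F" using finetely_gen[OF assms] by blast
  obtain s and f :: "nat \<Rightarrow> 'a" where f: "F = f ` {i. i < s}"
    using finite_imp_nat_seg_image_inj_on[OF F(2)] by blast
  have "F \<subseteq> I" using genideal_self F by blast
  hence "f \<in> {..<s} \<rightarrow> I" using f by auto
  thus thesis using that[of f s] f F by (simp add: lessThan_def)
qed

text \<open>Vectors of length \<open>n\<close> are functions of which only the values at \<open>0, \<dots>, n - 1\<close> matter; hence
  the last condition.\<close>
definition vector_submodule :: "('a, 'b) ring_scheme \<Rightarrow> nat \<Rightarrow> (nat \<Rightarrow> 'a) set \<Rightarrow> bool" where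
  "vector_submodule R n W \<longleftrightarrow> W \<subseteq> {..<n} \<rightarrow> carrier R \<and> (\<lambda>_. \<zero>\<^bsub>R\<^esub>) \<in> W \<and>
     (\<forall>u\<in>W. \<forall>v\<in>W. (\<lambda>i. u i \<oplus>\<^bsub>R\<^esub> v i) \<in> W) \<and>
     (\<forall>r\<in>carrier R. \<forall>v\<in>W. (\<lambda>i. r \<otimes>\<^bsub>R\<^esub> v i) \<in> W) \<and>
     (\<forall>v\<in>W. \<forall>v'. (\<forall>i<n. v' i = v i) \<longrightarrow> v' \<in> W)"

lemma vector_submoduleD:
  assumes "vector_submodule R n W"
  shows "\<And>v i. v \<in> W \<Longrightarrow> i < n \<Longrightarrow> v i \<in> carrier R"
    and "(\<lambda>_. \<zero>\<^bsub>R\<^esub>) \<in> W"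
    and "\<And>u v. u \<in> W \<Longrightarrow> v \<in> W \<Longrightarrow> (\<lambda>i. u i \<oplus>\<^bsub>R\<^esub> v i) \<in> W"
    and "\<And>r v. r \<in> carrier R \<Longrightarrow> v \<in> W \<Longrightarrow> (\<lambda>i. r \<otimes>\<^bsub>R\<^esub> v i) \<in> W"
    and "\<And>v v'. v \<in> W \<Longrightarrow> (\<And>i. i < n \<Longrightarrow> v' i = v i) \<Longrightarrow> v' \<in> W"
  using assms unfolding vector_submodule_def by (blast, blast, blast, blast, blast)

lemma (in cring) vector_submodule_lin_comb:
  assumes W: "vector_submodule R n W" and c: "c \<in> {..<s} \<rightarrow> carrier R" and B: "\<And>h. h < s \<Longrightarrow> B h \<in> W"
  shows "(\<lambda>k. lin_comb (regular_module R) c (\<lambda>h. B h k) s) \<in> W"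
  using c B
proof (induction s)
  interpret reg: module R "regular_module R" by (rule module_regular)
  case 0
  thus ?case using W by (simp add: vector_submodule_def)
next
  interpret reg: module R "regular_module R" by (rule module_regular)
  case (Suc s)
  let ?u = "\<lambda>k. lin_comb (regular_module R) c (\<lambda>h. B h k) s"
  have "?u \<in> W" by (rule Suc.IH) (use Suc.prems in auto)
  moreover have "(\<lambda>k. c s \<otimes> B s k) \<in> W"
  proof -
    have "c s \<in> carrier R" "B s \<in> W" using Suc.prems by auto
    thus ?thesis by (rule vector_submoduleD(4)[OF W])
  qed
  ultimately have "(\<lambda>k. ?u k \<oplus> c s \<otimes> B s k) \<in> W"
    by (rule vector_submoduleD(3)[OF W])
  moreover have "lin_comb (regular_module R) c (\<lambda>h. B h k) (Suc s) = ?u k \<oplus> c s \<otimes> B s k" if "k < n" for k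
  proof -
    have "(\<lambda>h. B h k) \<in> {..<Suc s} \<rightarrow> carrier R"
      using Suc.prems(2) vector_submoduleD(1)[OF W] that by auto
    thus ?thesis using reg.lin_comb_Suc[OF Suc.prems(1)] by simp
  qed
  ultimately show ?case by (rule vector_submoduleD(5)[OF W])
qed

text \<open>Submodules of \<open>R\<^sup>n\<close> are finitely generated: the last coordinates form an ideal, and the
  vectors with vanishing last coordinate form a submodule of \<open>R\<^sup>n\<^sup>-\<^sup>1\<close>.\<close>
lemma (in noetherian_ring) vector_submodule_finitely_generated:
  assumes "cring R" and "vector_submodule R n W"
  shows "\<exists>q B. (\<forall>h<q. B h \<in> W) \<and> (\<forall>w\<in>W. \<exists>y\<in>{..<q::nat} \<rightarrow> carrier R.
    \<forall>k<n. w k = lin_comb (regular_module R) y (\<lambda>h. B h k) q)"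
  using assms(2)
proof (induction n arbitrary: W)
  case 0
  show ?case by (rule exI[of _ 0]) auto
next
  interpret cring R by fact
  interpret reg: module R "regular_module R" by (rule module_regular)
  case (Suc n)
  note W = Suc.prems
  have Wc: "w k \<in> carrier R" if "w \<in> W" "k \<le> n" for w k
    using vector_submoduleD(1)[OF W] that by simp
  note W_zero = vector_submoduleD(2)[OF W]
  note W_add = vector_submoduleD(3)[OF W]
  note W_smult = vector_submoduleD(4)[OF W]
  have W_cong: "v' \<in> W" if "v \<in> W" "\<And>i. i \<le> n \<Longrightarrow> v' i = v i" for v v'
    using vector_submoduleD(5)[OF W that(1)] that(2) by simp
  let ?J = "(\<lambda>w. w n) ` W"
  have J: "ideal ?J R"
  proof (rule idealI')
    show "?J \<subseteq> carrier R" using Wc by auto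
    show "\<zero> \<in> ?J" using W_zero by force
    show "x \<oplus> y \<in> ?J" if "x \<in> ?J" "y \<in> ?J" for x y
      using that W_add by (auto intro!: image_eqI[of _ _ "\<lambda>i. _ i \<oplus> _ i"])
    show "r \<otimes> x \<in> ?J" if "r \<in> carrier R" "x \<in> ?J" for r x
      using that W_smult by (auto intro!: image_eqI[of _ _ "\<lambda>i. r \<otimes> _ i"])
  qed
  obtain s f where f: "f \<in> {..<s::nat} \<rightarrow> ?J" "?J = Idl (f ` {..<s})"
    using obtain_ideal_generators[OF J] .
  have fc: "f \<in> {..<s} \<rightarrow> carrier R" using f(1) Wc by (force simp: Pi_iff)
  have "\<forall>h\<in>{..<s}. \<exists>w. w \<in> W \<and> f h = w n" using f(1) by blast
  then obtain B1 where B1: "\<And>h. h < s \<Longrightarrow> B1 h \<in> W" "\<And>h. h < s \<Longrightarrow> f h = B1 h n"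
    using bchoice[of "{..<s}" "\<lambda>h w. w \<in> W \<and> f h = w n"] by auto
  let ?W = "{w \<in> {..<n} \<rightarrow> carrier R. w(n := \<zero>) \<in> W}"
  have "vector_submodule R n ?W"
    unfolding vector_submodule_def
  proof (intro conjI ballI allI impI)
    show "(\<lambda>_. \<zero>) \<in> ?W" using W_cong[OF W_zero, of "(\<lambda>_. \<zero>)(n := \<zero>)"] by auto
    show "(\<lambda>i. u i \<oplus> v i) \<in> ?W" if uv: "u \<in> ?W" "v \<in> ?W" for u v
      using uv W_cong[OF W_add[of "u(n := \<zero>)" "v(n := \<zero>)"], of "(\<lambda>i. u i \<oplus> v i)(n := \<zero>)"] by auto
    show "(\<lambda>i. r \<otimes> v i) \<in> ?W" if rv: "r \<in> carrier R" "v \<in> ?W" for r v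
      using rv W_cong[OF W_smult[of r "v(n := \<zero>)"], of "(\<lambda>i. r \<otimes> v i)(n := \<zero>)"] by auto
    show "v' \<in> ?W" if v: "v \<in> ?W" "\<forall>i<n. v' i = v i" for v v'
      using v W_cong[of "v(n := \<zero>)" "v'(n := \<zero>)"] by (auto simp: Pi_iff)
  qed auto
  from Suc.IH[OF this] obtain q B2 where B2: "\<And>h. h < (q::nat) \<Longrightarrow> B2 h \<in> ?W"
    and B2_gen: "\<And>w. w \<in> ?W \<Longrightarrow> \<exists>y\<in>{..<q} \<rightarrow> carrier R.
      \<forall>k<n. w k = lin_comb (regular_module R) y (\<lambda>h. B2 h k) q" by blast
  define B where "B h = (if h < s then B1 h else (B2 (h - s))(n := \<zero>))" for h
  show ?case
  proof (intro exI[of _ "s + q"] exI[of _ B] conjI allI impI ballI)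
    show "B h \<in> W" if "h < s + q" for h
      using that B1(1) B2[of "h - s"] by (auto simp: B_def)
    fix w assume w: "w \<in> W"
    hence "w n \<in> Idl (f ` {..<s})" using f(2) by blast
    then obtain c where c: "c \<in> {..<s} \<rightarrow> carrier R" "w n = lin_comb (regular_module R) c f s"
      using genideal_eq_lin_combs[OF fc] by blast
    define u where "u k = lin_comb (regular_module R) c (\<lambda>h. B1 h k) s" for k
    have uW: "u \<in> W" unfolding u_def[abs_def] by (rule vector_submodule_lin_comb[OF W c(1) B1(1)])
    have un: "u n = w n" unfolding u_def c(2)
      by (rule reg.lin_comb_cong) (use c(1) fc B1(2) in auto)
    have diff: "(\<lambda>i. w i \<oplus> \<ominus> \<one> \<otimes> u i) \<in> W" using W_add[OF w W_smult[OF _ uW]] by simp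
    have "(\<lambda>i. w i \<oplus> \<ominus> \<one> \<otimes> u i) \<in> ?W"
    proof
      have "((\<lambda>i. w i \<oplus> \<ominus> \<one> \<otimes> u i)(n := \<zero>)) \<in> W"
        using un Wc[OF w, of n] by (intro W_cong[OF diff]) (simp add: l_minus r_neg)
      thus "(\<lambda>i. w i \<oplus> \<ominus> \<one> \<otimes> u i) \<in> {..<n} \<rightarrow> carrier R \<and> ((\<lambda>i. w i \<oplus> \<ominus> \<one> \<otimes> u i)(n := \<zero>)) \<in> W"
        using Wc[OF diff] by auto
    qed
    from B2_gen[OF this] obtain y where y: "y \<in> {..<q} \<rightarrow> carrier R"
      "\<And>k. k < n \<Longrightarrow> w k \<oplus> \<ominus> \<one> \<otimes> u k = lin_comb (regular_module R) y (\<lambda>h. B2 h k) q" by blast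
    show "\<exists>y\<in>{..<s + q} \<rightarrow> carrier R. \<forall>k<Suc n. w k = lin_comb (regular_module R) y (\<lambda>h. B h k) (s + q)"
    proof (rule bexI[of _ "\<lambda>h. if h < s then c h else y (h - s)"], intro allI impI)
      show "(\<lambda>h. if h < s then c h else y (h - s)) \<in> {..<s + q} \<rightarrow> carrier R"
        using c(1) y(1) by (auto simp: Pi_iff)
      fix k assume k: "k < Suc n"
      have B2c: "(\<lambda>h. ((B2 h)(n := \<zero>)) k) \<in> {..<q} \<rightarrow> carrier R"
        using B2 Wc k by (auto simp: Pi_iff less_Suc_eq)
      have B1c: "(\<lambda>h. B1 h k) \<in> {..<s} \<rightarrow> carrier R" using B1 Wc k by auto
      have "(\<lambda>h. B h k) = (\<lambda>h. if h < s then B1 h k else ((B2 (h - s))(n := \<zero>)) k)"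
        by (auto simp: B_def)
      hence "lin_comb (regular_module R) (\<lambda>h. if h < s then c h else y (h - s)) (\<lambda>h. B h k) (s + q) =
          u k \<oplus> lin_comb (regular_module R) y (\<lambda>h. ((B2 h)(n := \<zero>)) k) q"
        using reg.lin_comb_append[OF c(1) _ y(1), of "\<lambda>h. B1 h k" "\<lambda>h. ((B2 h)(n := \<zero>)) k"] B1c B2c
        by (simp add: u_def)
      also have "\<dots> = w k"
      proof (cases "k = n")
        case True
        thus ?thesis using reg.lin_comb_zero_vector[OF y(1)] un Wc[OF w, of n] by simp
      next
        case False
        hence kn: "k < n" using k by simp
        have "lin_comb (regular_module R) y (\<lambda>h. ((B2 h)(n := \<zero>)) k) q = w k \<oplus> \<ominus> \<one> \<otimes> u k"
          using y(2)[OF kn] False by simp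
        moreover have "u k \<oplus> (w k \<oplus> \<ominus> \<one> \<otimes> u k) = w k"
          using Wc[OF w, of k] Wc[OF uW, of k] kn by (simp add: l_minus) algebra
        ultimately show ?thesis by simp
      qed
      finally show "w k = lin_comb (regular_module R) (\<lambda>h. if h < s then c h else y (h - s)) (\<lambda>h. B h k) (s + q)" ..
    qed
  qed
qed

definition syzygy_matrix ::
    "('a, 'b) ring_scheme \<Rightarrow> nat \<Rightarrow> nat \<Rightarrow> (nat \<Rightarrow> nat \<Rightarrow> 'a) \<Rightarrow> nat \<Rightarrow> (nat \<Rightarrow> nat \<Rightarrow> 'a) \<Rightarrow> bool" where
  "syzygy_matrix R n p A q B \<longleftrightarrow>
     (\<forall>h<q. B h \<in> {..<n} \<rightarrow> carrier R \<and>
        (\<forall>i<p. lin_comb (regular_module R) (B h) (\<lambda>k. A k i) n = \<zero>\<^bsub>R\<^esub>)) \<and>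
     (\<forall>w\<in>{..<n} \<rightarrow> carrier R. (\<forall>i<p. lin_comb (regular_module R) w (\<lambda>k. A k i) n = \<zero>\<^bsub>R\<^esub>) \<longrightarrow>
        (\<exists>y\<in>{..<q} \<rightarrow> carrier R. \<forall>k<n. w k = lin_comb (regular_module R) y (\<lambda>h. B h k) q))"

lemma (in noetherian_ring) exists_syzygy_matrix:
  assumes "cring R" and A: "\<And>k. k < n \<Longrightarrow> A k \<in> {..<p} \<rightarrow> carrier R"
  shows "\<exists>q B. syzygy_matrix R n p A q B"
proof -
  interpret cring R by fact
  interpret reg: module R "regular_module R" by (rule module_regular)
  let ?W = "{w \<in> {..<n} \<rightarrow> carrier R. \<forall>i<p. lin_comb (regular_module R) w (\<lambda>k. A k i) n = \<zero>}"
  have col: "(\<lambda>k. A k i) \<in> {..<n} \<rightarrow> carrier R" if "i < p" for i using A that by (auto simp: Pi_iff)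
  have "vector_submodule R n ?W"
    unfolding vector_submodule_def
  proof (intro conjI ballI allI impI)
    show "(\<lambda>_. \<zero>) \<in> ?W" using reg.lin_comb_zero_coeff col by auto
    show "(\<lambda>i. u i \<oplus> v i) \<in> ?W" if "u \<in> ?W" "v \<in> ?W" for u v
      using that reg.lin_comb_coeff_add[of u n v] col by auto
    show "(\<lambda>i. r \<otimes> v i) \<in> ?W" if "r \<in> carrier R" "v \<in> ?W" for r v
      using that reg.lin_comb_coeff_smult[of v n] col by auto
    show "v' \<in> ?W" if v: "v \<in> ?W" "\<forall>i<n. v' i = v i" for v v'
    proof -
      have "lin_comb (regular_module R) v' (\<lambda>k. A k i) n = lin_comb (regular_module R) v (\<lambda>k. A k i) n"
        if "i < p" for i
        by (rule reg.lin_comb_cong) (use v col[OF that] in auto)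
      thus ?thesis using v by (auto simp: Pi_iff)
    qed
  qed auto
  from vector_submodule_finitely_generated[OF is_cring this] obtain q B where
    "\<forall>h<q. B h \<in> ?W" "\<forall>w\<in>?W. \<exists>y\<in>{..<q::nat} \<rightarrow> carrier R.
      \<forall>k<n. w k = lin_comb (regular_module R) y (\<lambda>h. B h k) q" by blast
  hence "syzygy_matrix R n p A q B" unfolding syzygy_matrix_def by auto
  thus ?thesis by blast
qed

text \<open>The matrices \<open>A j\<close> with \<open>b (j + 1)\<close> rows and \<open>b j\<close> columns describe a free resolution
  \<open>\<dots> \<rightarrow> R\<^bsup>b 3\<^esup> \<rightarrow> R\<^bsup>b 2\<^esup> \<rightarrow> R\<^bsup>b 1\<^esup>\<close> of \<open>R/I\<close> with \<open>b 1 = 1\<close>; the extra degree with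
  \<open>b 0 = 0\<close> lets the lowest cohomology be treated like the others.\<close>
definition cyclic_resolution ::
    "('a, 'b) ring_scheme \<Rightarrow> 'a set \<Rightarrow> (nat \<Rightarrow> nat) \<Rightarrow> (nat \<Rightarrow> nat \<Rightarrow> nat \<Rightarrow> 'a) \<Rightarrow> bool" where
  "cyclic_resolution R I b A \<longleftrightarrow> b 0 = 0 \<and> b 1 = 1 \<and>
     (\<forall>j. \<forall>k<b (Suc j). A j k \<in> {..<b j} \<rightarrow> carrier R) \<and>
     I = Idl\<^bsub>R\<^esub> ((\<lambda>k. A 1 k 0) ` {..<b 2}) \<and>
     (\<forall>j\<ge>1. syzygy_matrix R (b (Suc j)) (b j) (A j) (b (Suc (Suc j))) (A (Suc j)))"

lemma (in noetherian_ring) exists_cyclic_resolution: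
  assumes "cring R" "ideal I R"
  shows "\<exists>b A. cyclic_resolution R I b A"
proof -
  interpret cring R by fact
  obtain s f where f: "f \<in> {..<s::nat} \<rightarrow> I" "I = Idl (f ` {..<s})"
    using obtain_ideal_generators[OF assms(2)] .
  have fc: "f \<in> {..<s} \<rightarrow> carrier R" using f(1) ideal.Icarr[OF assms(2)] by auto
  define P where "P j x = (case x of (n, p, A) \<Rightarrow> (\<forall>k<n. A k \<in> {..<p} \<rightarrow> carrier R) \<and>
      (j = 0 \<longrightarrow> x = (s, 1::nat, \<lambda>k i. f k)))" for j :: nat and x :: "nat \<times> nat \<times> (nat \<Rightarrow> nat \<Rightarrow> 'a)"
  define Q where "Q j x y = (case x of (n, p, A) \<Rightarrow> case y of (q, n', B) \<Rightarrow>
      n' = n \<and> syzygy_matrix R n p A q B)" for j :: nat and x y :: "nat \<times> nat \<times> (nat \<Rightarrow> nat \<Rightarrow> 'a)"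
  have "\<exists>F. \<forall>j. P j (F j) \<and> Q j (F j) (F (Suc j))"
  proof (rule dependent_nat_choice)
    show "\<exists>x. P 0 x" using fc by (auto simp: P_def)
    fix x j assume "P j x"
    then obtain n p A where x: "x = (n, p, A)" "\<And>k. k < n \<Longrightarrow> A k \<in> {..<p} \<rightarrow> carrier R"
      by (cases x) (auto simp: P_def)
    obtain q B where B: "syzygy_matrix R n p A q B"
      using exists_syzygy_matrix[of n A p, OF is_cring x(2)] by blast
    hence "P (Suc j) (q, n, B) \<and> Q j x (q, n, B)" by (auto simp: P_def Q_def x syzygy_matrix_def)
    thus "\<exists>y. P (Suc j) y \<and> Q j x y" by blast
  qed
  then obtain F where FP: "\<And>j. P j (F j)" and FQ: "\<And>j. Q j (F j) (F (Suc j))" by blast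
  define b where "b j = (case j of 0 \<Rightarrow> 0 | Suc i \<Rightarrow> fst (snd (F i)))" for j
  define A where "A j = (case j of 0 \<Rightarrow> (\<lambda>_ _. \<zero>) | Suc i \<Rightarrow> snd (snd (F i)))" for j
  have F0: "F 0 = (s, 1, \<lambda>k i. f k)" using FP[of 0] by (auto simp: P_def split: prod.splits)
  have rows: "fst (F i) = b (Suc (Suc i))" for i
    using FQ[of i] by (auto simp: Q_def b_def split: prod.splits)
  have wf: "\<forall>k<fst (F i). snd (snd (F i)) k \<in> {..<fst (snd (F i))} \<rightarrow> carrier R" for i
    using FP[of i] by (auto simp: P_def split: prod.splits)
  have syz: "syzygy_matrix R (fst (F i)) (fst (snd (F i))) (snd (snd (F i))) (fst (F (Suc i))) (snd (snd (F (Suc i))))" for i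
    using FQ[of i] by (auto simp: Q_def split: prod.splits)
  have b2: "b 2 = s" using rows[of 0] F0 by (simp add: numeral_2_eq_2)
  have "cyclic_resolution R I b A"
    unfolding cyclic_resolution_def
  proof (intro conjI allI impI)
    show "b 0 = 0" "b 1 = 1" using F0 by (auto simp: b_def)
    show "A j k \<in> {..<b j} \<rightarrow> carrier R" if "k < b (Suc j)" for j k
    proof (cases j)
      case (Suc i)
      thus ?thesis using that wf[of i] rows[of i] by (simp add: A_def b_def)
    qed (simp add: b_def)
    show "I = Idl ((\<lambda>k. A 1 k 0) ` {..<b 2})" using f(2) F0 b2 by (simp add: A_def)
    show "syzygy_matrix R (b (Suc j)) (b j) (A j) (b (Suc (Suc j))) (A (Suc j))" if "1 \<le> j" for j
    proof -
      obtain i where i: "j = Suc i" using \<open>1 \<le> j\<close> by (cases j) auto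
      show ?thesis using syz[of i] rows[of i] rows[of "Suc i"] by (simp add: i A_def b_def)
    qed
  qed
  thus ?thesis by blast
qed

text \<open>The complex \<open>Hom(F, M)\<close> of a free resolution \<open>F\<close> consists of the powers \<open>M\<^bsup>b j\<^esup>\<close>.\<close>
definition cobd ::
    "(nat \<Rightarrow> nat) \<Rightarrow> (nat \<Rightarrow> nat \<Rightarrow> nat \<Rightarrow> 'a) \<Rightarrow> ('a, 'c, 'd) module_scheme \<Rightarrow> nat \<Rightarrow> (nat \<Rightarrow> 'c) \<Rightarrow> nat \<Rightarrow> 'c"
  where "cobd b A M j v = (\<lambda>k. lin_comb M (A j k) v (b j))"

locale resolved_ideal = cring R for R (structure) +
  fixes I b A
  assumes resolution: "cyclic_resolution R I b A"
begin

abbreviation d where "d \<equiv> cobd b A"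

lemma b_0: "b 0 = 0" and b_1: "b (Suc 0) = 1"
  using resolution by (auto simp: cyclic_resolution_def)

lemma A_row: "k < b (Suc j) \<Longrightarrow> A j k \<in> {..<b j} \<rightarrow> carrier R"
  using resolution by (auto simp: cyclic_resolution_def)

lemma I_generated: "I = Idl ((\<lambda>k. A 1 k 0) ` {..<b 2})"
  and syzygies: "j \<ge> 1 \<Longrightarrow> syzygy_matrix R (b (Suc j)) (b j) (A j) (b (Suc (Suc j))) (A (Suc j))"
  using resolution by (auto simp: cyclic_resolution_def)

lemma cobd_closed:
  assumes "module R M" "v \<in> {..<b j} \<rightarrow> carrier M"
  shows "d M j v \<in> {..<b (Suc j)} \<rightarrow> carrier M"
  using module.lin_comb_closed[OF assms(1) A_row assms(2)] by (auto simp: cobd_def)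

lemma cobd_mem:
  assumes "module R M" "submodule V R M" "v \<in> {..<b j} \<rightarrow> V" "k < b (Suc j)"
  shows "d M j v k \<in> V"
  using module.lin_comb_mem[OF assms(1) A_row assms(3,2)] assms(4) by (auto simp: cobd_def)

lemma cobd_diff:
  assumes "module R M" "u \<in> {..<b j} \<rightarrow> carrier M" "v \<in> {..<b j} \<rightarrow> carrier M" "k < b (Suc j)"
  shows "d M j (\<lambda>i. u i \<ominus>\<^bsub>M\<^esub> v i) k = d M j u k \<ominus>\<^bsub>M\<^esub> d M j v k"
  using module.lin_comb_diff[OF assms(1) A_row assms(2,3)] assms(4) by (simp add: cobd_def)

lemma cobd_smult:
  assumes "module R M" "v \<in> {..<b j} \<rightarrow> carrier M" "r \<in> carrier R" "k < b (Suc j)"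
  shows "d M j (\<lambda>i. r \<odot>\<^bsub>M\<^esub> v i) k = r \<odot>\<^bsub>M\<^esub> d M j v k"
  using module.lin_comb_smult[OF assms(1) A_row assms(2,3)] assms(4) by (simp add: cobd_def)

lemma cobd_cong:
  assumes "module R M" "\<And>i. i < b j \<Longrightarrow> u i = v i" "v \<in> {..<b j} \<rightarrow> carrier M" "k < b (Suc j)"
  shows "d M j u k = d M j v k"
  unfolding cobd_def by (rule module.lin_comb_cong[OF assms(1)]) (use assms A_row in auto)

lemma cobd_hom:
  assumes "module R M" "module R N" "f \<in> module_homs R M N" "v \<in> {..<b j} \<rightarrow> carrier M" "k < b (Suc j)"
  shows "f (d M j v k) = d N j (\<lambda>i. f (v i)) k"
  using module_homs_lin_comb[OF assms(1-3) A_row assms(4)] assms(5) by (simp add: cobd_def)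

lemma cobd_zero:
  assumes "module R M" "\<And>i. i < b j \<Longrightarrow> v i = \<zero>\<^bsub>M\<^esub>" "k < b (Suc j)"
  shows "d M j v k = \<zero>\<^bsub>M\<^esub>"
proof -
  interpret M: module R M by fact
  have "d M j v k = d M j (\<lambda>_. \<zero>\<^bsub>M\<^esub>) k" by (rule cobd_cong) (use assms in auto)
  thus ?thesis using M.lin_comb_zero_vector[OF A_row[OF assms(3)]] by (simp add: cobd_def)
qed

lemma cobd_cobd:
  assumes M: "module R M" and v: "v \<in> {..<b j} \<rightarrow> carrier M" and h: "h < b (Suc (Suc j))"
  shows "d M (Suc j) (d M j v) h = \<zero>\<^bsub>M\<^esub>"
proof -
  interpret M: module R M by fact
  show ?thesis
  proof (cases "j = 0")
    case True
    show ?thesis by (rule cobd_zero[OF M _ h]) (simp add: True cobd_def b_0)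
  next
    case False
    have "d M (Suc j) (d M j v) h =
        lin_comb M (\<lambda>i. lin_comb (regular_module R) (A (Suc j) h) (\<lambda>k. A j k i) (b (Suc j))) v (b j)"
      unfolding cobd_def by (rule M.lin_comb_swap) (use A_row h v in auto)
    also have "\<dots> = lin_comb M (\<lambda>i. \<zero>) v (b j)"
      by (rule M.lin_comb_cong) (use syzygies[of j] False h v in \<open>auto simp: syzygy_matrix_def\<close>)
    also have "\<dots> = \<zero>\<^bsub>M\<^esub>" by (rule M.lin_comb_zero_coeff[OF v])
    finally show ?thesis .
  qed
qed

text \<open>\<open>Hom(F, E)\<close> is exact in positive degrees: a relation between the rows of \<open>A j\<close> is a
  combination of the rows of \<open>A (j + 1)\<close>, so a cocycle is a consistent right-hand side.\<close>
lemma cobd_exact: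
  assumes E: "injective_module R E" and j: "j \<ge> 1" and e: "e \<in> {..<b (Suc j)} \<rightarrow> carrier E"
    and cocycle: "\<And>h. h < b (Suc (Suc j)) \<Longrightarrow> d E (Suc j) e h = \<zero>\<^bsub>E\<^esub>"
  obtains u where "u \<in> {..<b j} \<rightarrow> carrier E" "\<And>k. k < b (Suc j) \<Longrightarrow> d E j u k = e k"
proof -
  interpret E: module R E using E by (simp add: injective_module_def)
  have "\<exists>u\<in>{..<b j} \<rightarrow> carrier E. \<forall>k<b (Suc j). lin_comb E (A j k) u (b j) = e k"
  proof (rule injective_module_system_solvable[OF E A_row e])
    fix w assume w: "w \<in> {..<b (Suc j)} \<rightarrow> carrier R"
      "\<And>i. i < b j \<Longrightarrow> lin_comb (regular_module R) w (\<lambda>k. A j k i) (b (Suc j)) = \<zero>"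
    then obtain y where y: "y \<in> {..<b (Suc (Suc j))} \<rightarrow> carrier R"
      "\<And>k. k < b (Suc j) \<Longrightarrow> w k = lin_comb (regular_module R) y (\<lambda>h. A (Suc j) h k) (b (Suc (Suc j)))"
      using syzygies[OF j] unfolding syzygy_matrix_def by blast
    have "lin_comb E w e (b (Suc j)) =
        lin_comb E (\<lambda>k. lin_comb (regular_module R) y (\<lambda>h. A (Suc j) h k) (b (Suc (Suc j)))) e (b (Suc j))"
    proof (rule E.lin_comb_cong)
      show "(\<lambda>k. lin_comb (regular_module R) y (\<lambda>h. A (Suc j) h k) (b (Suc (Suc j)))) \<in> {..<b (Suc j)} \<rightarrow> carrier R"
        using w(1) y(2) by (auto simp: Pi_iff)
    qed (use y(2) e in auto)
    also have "\<dots> = lin_comb E y (d E (Suc j) e) (b (Suc (Suc j)))"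
      unfolding cobd_def by (rule E.lin_comb_swap[symmetric]) (use y A_row e in auto)
    also have "\<dots> = lin_comb E y (\<lambda>_. \<zero>\<^bsub>E\<^esub>) (b (Suc (Suc j)))"
      by (rule E.lin_comb_cong) (use y cocycle in auto)
    also have "\<dots> = \<zero>\<^bsub>E\<^esub>" by (rule E.lin_comb_zero_vector[OF y(1)])
    finally show "lin_comb E w e (b (Suc j)) = \<zero>\<^bsub>E\<^esub>" .
  qed
  thus thesis using that by (auto simp: cobd_def)
qed

lemma A_1_mem: "k < b 2 \<Longrightarrow> A 1 k 0 \<in> I"
proof -
  assume k: "k < b 2"
  have "(\<lambda>k. A 1 k 0) ` {..<b 2} \<subseteq> carrier R"
    using A_row[of _ 1] b_1 by (auto simp: numeral_2_eq_2)
  thus ?thesis using genideal_self k I_generated by blast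
qed

lemma cobd_1:
  assumes "module R M" "v \<in> {..<b 1} \<rightarrow> carrier M" "k < b 2"
  shows "d M 1 v k = A 1 k 0 \<odot>\<^bsub>M\<^esub> v 0"
proof -
  interpret M: module R M by fact
  have "A 1 k \<in> {..<Suc 0} \<rightarrow> carrier R" "v \<in> {..<Suc 0} \<rightarrow> carrier M"
    using A_row[of k 1] assms b_1 by (simp_all add: numeral_2_eq_2)
  thus ?thesis unfolding cobd_def using M.lin_comb_Suc[of "A 1 k" 0 v] b_1 by (simp add: Pi_iff)
qed

lemma annihilated_by_ideal_if_cobd_1_zero:
  fixes M :: "('a, 'c) module"
  assumes M: "module R M" and v: "v \<in> {..<b 1} \<rightarrow> carrier M"
    and cocycle: "\<And>k. k < b 2 \<Longrightarrow> d M 1 v k = \<zero>\<^bsub>M\<^esub>" and r: "r \<in> I"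
  shows "r \<odot>\<^bsub>M\<^esub> v 0 = \<zero>\<^bsub>M\<^esub>"
proof -
  interpret M: module R M by fact
  let ?f = "\<lambda>k. A 1 k 0"
  have v0: "v 0 \<in> carrier M" using v b_1 by (auto simp: Pi_iff)
  have f: "?f \<in> {..<b 2} \<rightarrow> carrier R"
    using A_row[of _ 1] b_1 by (auto simp: numeral_2_eq_2)
  then obtain c where c: "c \<in> {..<b 2} \<rightarrow> carrier R" "r = lin_comb (regular_module R) c ?f (b 2)"
    using r I_generated genideal_eq_lin_combs[OF f] by blast
  have hom: "(\<lambda>r. r \<odot>\<^bsub>M\<^esub> v 0) \<in> module_homs R (regular_module R) M"
    using v0 by (auto simp: module_homs_def M.smult_l_distr M.smult_assoc1)
  have "r \<odot>\<^bsub>M\<^esub> v 0 = lin_comb M c (\<lambda>k. ?f k \<odot>\<^bsub>M\<^esub> v 0) (b 2)"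
    using module_homs_lin_comb[OF module_regular M hom c(1), of ?f] f c(2) by simp
  also have "\<dots> = lin_comb M c (\<lambda>_. \<zero>\<^bsub>M\<^esub>) (b 2)"
    by (rule M.lin_comb_cong) (use c cobd_1[OF M v] cocycle in auto)
  also have "\<dots> = \<zero>\<^bsub>M\<^esub>" by (rule M.lin_comb_zero_vector[OF c(1)])
  finally show ?thesis .
qed

end

section \<open>Local cohomology of finite length\<close>

lemma (in cring) ideal_pow_simps:
  "ideal_pow R I 0 = carrier R" "ideal_pow R I (Suc n) = ideal_pow R I n \<cdot> I"
  by (simp_all add: ideals_set_def)

lemma (in cring) ideal_ideal_pow:
  assumes "ideal I R"
  shows "ideal (ideal_pow R I n) R"
proof (induction n)
  case (Suc n)
  thus ?case unfolding ideal_pow_simps using assms ideal_prod_is_ideal by blast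
qed (simp add: ideals_set_def oneideal)

lemma (in cring) ideal_pow_add:
  assumes "ideal I R"
  shows "ideal_pow R I (n + k) = ideal_pow R I n \<cdot> ideal_pow R I k"
proof -
  interpret ideals: comm_monoid "ideals_set R" by (rule ideals_set_is_comm_monoid)
  have "I \<in> carrier (ideals_set R)" using assms by (simp add: ideals_set_def)
  from ideals.nat_pow_mult[OF this, of n k] show ?thesis by (simp add: ideals_set_def)
qed

lemma (in cring) ideal_pow_antimono:
  assumes "ideal I R" "n \<le> k"
  shows "ideal_pow R I k \<subseteq> ideal_pow R I n"
proof -
  obtain l where l: "k = n + l" using assms(2) le_Suc_ex by blast
  show ?thesis
    unfolding l ideal_pow_add[OF assms(1)]
    using ideal_prod_inter ideal_ideal_pow[OF assms(1)] by blast
qed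

lemma (in cring) pow_mem_ideal_pow:
  assumes "ideal I R" "x \<in> I"
  shows "x [^] n \<in> ideal_pow R I n"
proof (induction n)
  case (Suc n)
  thus ?case unfolding ideal_pow_simps using assms by (simp add: ideal_prod.prod)
qed (simp add: ideals_set_def)

lemma (in cring) ideal_prod_subset:
  assumes "ideal K R" "\<And>i j. \<lbrakk>i \<in> I; j \<in> J\<rbrakk> \<Longrightarrow> i \<otimes> j \<in> K"
  shows "I \<cdot> J \<subseteq> K"
proof
  fix z assume "z \<in> I \<cdot> J"
  thus "z \<in> K"
    by induction (use assms additive_subgroup.a_closed[OF ideal.axioms(1)] in auto)
qed

lemma torsion_submodule:
  fixes R (structure) and M :: "('a, 'c) module"
  assumes M: "module R M" and I: "ideal I R"
  shows "submodule (torsion_part R I M) R M"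
proof -
  interpret module R M by (rule M)
  show ?thesis
  proof (rule submoduleI')
    note pow = R.ideal_ideal_pow[OF I]
    show "torsion_part R I M \<subseteq> carrier M" by (auto simp: torsion_part_def)
    show "\<zero>\<^bsub>M\<^esub> \<in> torsion_part R I M"
      using ideal.Icarr[OF pow] by (auto simp: torsion_part_def)
    show "x \<oplus>\<^bsub>M\<^esub> y \<in> torsion_part R I M" if xy: "x \<in> torsion_part R I M" "y \<in> torsion_part R I M" for x y
    proof -
      obtain n k where nk: "x \<in> carrier M" "y \<in> carrier M"
        "\<And>r. r \<in> ideal_pow R I n \<Longrightarrow> r \<odot>\<^bsub>M\<^esub> x = \<zero>\<^bsub>M\<^esub>"
        "\<And>r. r \<in> ideal_pow R I k \<Longrightarrow> r \<odot>\<^bsub>M\<^esub> y = \<zero>\<^bsub>M\<^esub>"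
        using xy unfolding torsion_part_def by blast
      have "r \<odot>\<^bsub>M\<^esub> (x \<oplus>\<^bsub>M\<^esub> y) = \<zero>\<^bsub>M\<^esub>" if r: "r \<in> ideal_pow R I (n + k)" for r
      proof -
        have "r \<in> ideal_pow R I n" "r \<in> ideal_pow R I k"
          using r R.ideal_pow_antimono[OF I, of n "n + k"] R.ideal_pow_antimono[OF I, of k "n + k"]
          by auto
        thus ?thesis using nk ideal.Icarr[OF pow] by (simp add: smult_r_distr)
      qed
      thus ?thesis using nk(1,2) unfolding torsion_part_def by blast
    qed
    show "a \<odot>\<^bsub>M\<^esub> x \<in> torsion_part R I M" if ax: "a \<in> carrier R" "x \<in> torsion_part R I M" for a x
    proof -
      obtain n where n: "x \<in> carrier M" "\<And>r. r \<in> ideal_pow R I n \<Longrightarrow> r \<odot>\<^bsub>M\<^esub> x = \<zero>\<^bsub>M\<^esub>"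
        using ax unfolding torsion_part_def by blast
      have "r \<odot>\<^bsub>M\<^esub> (a \<odot>\<^bsub>M\<^esub> x) = \<zero>\<^bsub>M\<^esub>" if r: "r \<in> ideal_pow R I n" for r
        using n(2)[OF ideal.I_r_closed[OF pow r ax(1)]] smult_assoc1[OF ideal.Icarr[OF pow r] ax(1) n(1)]
        by simp
      thus ?thesis using n(1) ax(1) unfolding torsion_part_def by blast
    qed
  qed
qed

lemma torsion_hom:
  assumes "module R M" "module R N" "f \<in> module_homs R M N" "ideal I R" "x \<in> torsion_part R I M"
  shows "f x \<in> torsion_part R I N"
proof -
  interpret M: module R M by fact
  obtain n where n: "x \<in> carrier M" "\<And>r. r \<in> ideal_pow R I n \<Longrightarrow> r \<odot>\<^bsub>M\<^esub> x = \<zero>\<^bsub>M\<^esub>"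
    using assms(5) unfolding torsion_part_def by blast
  have "r \<odot>\<^bsub>N\<^esub> f x = \<zero>\<^bsub>N\<^esub>" if r: "r \<in> ideal_pow R I n" for r
  proof -
    have "r \<in> carrier R" using ideal.Icarr[OF M.R.ideal_ideal_pow[OF assms(4)] r] .
    hence "r \<odot>\<^bsub>N\<^esub> f x = f (r \<odot>\<^bsub>M\<^esub> x)" using assms(3) n(1) by (simp add: module_homs_def)
    thus ?thesis using n(2)[OF r] module_homs_zero[OF assms(1-3)] by simp
  qed
  moreover have "f x \<in> carrier N" using assms(3) n(1) by (auto simp: module_homs_def)
  ultimately show ?thesis unfolding torsion_part_def by blast
qed

lemma quotient_module_simps:
  "carrier (quotient_module M N) = a_rcosets\<^bsub>M\<^esub> N" "zero (quotient_module M N) = N"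
  "add (quotient_module M N) = set_add M"
  "smult (quotient_module M N) = (\<lambda>r X. \<Union>x \<in> X. N +>\<^bsub>M\<^esub> (r \<odot>\<^bsub>M\<^esub> x))"
  by (simp_all add: quotient_module_def)

lemma (in module) abelian_subgroup_submodule:
  assumes "submodule N R M"
  shows "abelian_subgroup N M"
  by (rule abelian_subgroupI3[OF additive_subgroup.intro[OF submodule.axioms(1)[OF assms]]
        M.abelian_group_axioms])

lemma (in module) coset_eq_iff:
  assumes "submodule N R M" "x \<in> carrier M" "y \<in> carrier M"
  shows "N +>\<^bsub>M\<^esub> x = N +>\<^bsub>M\<^esub> y \<longleftrightarrow> x \<ominus>\<^bsub>M\<^esub> y \<in> N"
proof -
  interpret N: abelian_subgroup N M by (rule abelian_subgroup_submodule[OF assms(1)])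
  show ?thesis
    using N.a_rcos_module[OF assms(3,2)] N.a_repr_independence'[of x y] N.a_rcos_self[OF assms(2)] assms
    by (auto simp: M.minus_eq)
qed

lemma quotient_smult:
  fixes R (structure) and M :: "('a, 'c) module"
  assumes M: "module R M" and N: "submodule N R M" and r: "r \<in> carrier R" and x: "x \<in> carrier M"
  shows "r \<odot>\<^bsub>quotient_module M N\<^esub> (N +>\<^bsub>M\<^esub> x) = N +>\<^bsub>M\<^esub> (r \<odot>\<^bsub>M\<^esub> x)"
proof -
  interpret module R M by (rule M)
  interpret N: abelian_subgroup N M by (rule abelian_subgroup_submodule[OF N])
  have "N +>\<^bsub>M\<^esub> (r \<odot>\<^bsub>M\<^esub> y) = N +>\<^bsub>M\<^esub> (r \<odot>\<^bsub>M\<^esub> x)" if y: "y \<in> N +>\<^bsub>M\<^esub> x" for y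
  proof -
    have yc: "y \<in> carrier M" using N.a_elemrcos_carrier[OF x y] .
    have "y \<ominus>\<^bsub>M\<^esub> x \<in> N" using N.a_rcos_module[OF x yc] y by (simp add: M.minus_eq)
    hence "r \<odot>\<^bsub>M\<^esub> (y \<ominus>\<^bsub>M\<^esub> x) \<in> N" using submoduleE(4)[OF N r] by blast
    hence "r \<odot>\<^bsub>M\<^esub> y \<ominus>\<^bsub>M\<^esub> r \<odot>\<^bsub>M\<^esub> x \<in> N"
      using r x yc by (simp add: M.minus_eq smult_r_distr smult_r_minus)
    thus ?thesis using coset_eq_iff[OF N] r x yc by simp
  qed
  thus ?thesis unfolding quotient_module_simps by (intro UN_constant_eq[OF N.a_rcos_self[OF x]]) blast
qed

lemma submodule_quotient:
  fixes R (structure) and M :: "('a, 'c) module"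
  assumes M: "module R M" and N: "submodule N R M" and P: "submodule P R M"
  shows "submodule ((\<lambda>x. N +>\<^bsub>M\<^esub> x) ` P) R (quotient_module M N)"
proof -
  interpret module R M by (rule M)
  interpret N: abelian_subgroup N M by (rule abelian_subgroup_submodule[OF N])
  let ?Q = "quotient_module M N"
  have Pc: "x \<in> carrier M" if "x \<in> P" for x using submoduleE(1)[OF P] that by blast
  have zero_P: "\<zero>\<^bsub>M\<^esub> \<in> P" using subgroup.one_closed[OF submodule.axioms(1)[OF P]] by simp
  have inv_eq: "inv\<^bsub>add_monoid ?Q\<^esub> X = inv\<^bsub>M A_Mod N\<^esub> X" for X
    by (simp add: m_inv_def quotient_module_simps A_FactGroup_def FactGroup_def set_add_def A_RCOSETS_def)
  show ?thesis
  proof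
    show "(\<lambda>x. N +>\<^bsub>M\<^esub> x) ` P \<subseteq> carrier (add_monoid ?Q)"
      using Pc M.a_rcosetsI[OF N.a_subset] by (auto simp: quotient_module_simps)
    have "N = N +>\<^bsub>M\<^esub> \<zero>\<^bsub>M\<^esub>" using M.a_coset_add_zero[OF N.a_subset] by simp
    thus "\<one>\<^bsub>add_monoid ?Q\<^esub> \<in> (\<lambda>x. N +>\<^bsub>M\<^esub> x) ` P"
      using zero_P by (auto simp: quotient_module_simps)
    show "X \<otimes>\<^bsub>add_monoid ?Q\<^esub> Y \<in> (\<lambda>x. N +>\<^bsub>M\<^esub> x) ` P"
      if XY: "X \<in> (\<lambda>x. N +>\<^bsub>M\<^esub> x) ` P" "Y \<in> (\<lambda>x. N +>\<^bsub>M\<^esub> x) ` P" for X Y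
    proof -
      obtain x y where xy: "x \<in> P" "X = N +>\<^bsub>M\<^esub> x" "y \<in> P" "Y = N +>\<^bsub>M\<^esub> y" using XY by blast
      have "X \<otimes>\<^bsub>add_monoid ?Q\<^esub> Y = N +>\<^bsub>M\<^esub> (x \<oplus>\<^bsub>M\<^esub> y)"
        using N.a_rcos_sum Pc xy by (simp add: quotient_module_simps)
      thus ?thesis using submoduleE(5)[OF P] xy by blast
    qed
    show "inv\<^bsub>add_monoid ?Q\<^esub> X \<in> (\<lambda>x. N +>\<^bsub>M\<^esub> x) ` P" if X: "X \<in> (\<lambda>x. N +>\<^bsub>M\<^esub> x) ` P" for X
    proof -
      obtain x where x: "x \<in> P" "X = N +>\<^bsub>M\<^esub> x" using X by blast
      have "X \<in> carrier (M A_Mod N)"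
        using M.a_rcosetsI[OF N.a_subset Pc[OF x(1)]] x(2)
        by (simp add: A_FactGroup_def FactGroup_def A_RCOSETS_def)
      hence "inv\<^bsub>add_monoid ?Q\<^esub> X = N +>\<^bsub>M\<^esub> (\<ominus>\<^bsub>M\<^esub> x)"
        unfolding inv_eq using N.a_inv_FactGroup N.a_rcos_inv[OF Pc[OF x(1)]] x(2) by simp
      thus ?thesis using submoduleE(3)[OF P] x by blast
    qed
    show "r \<odot>\<^bsub>?Q\<^esub> X \<in> (\<lambda>x. N +>\<^bsub>M\<^esub> x) ` P" if rX: "r \<in> carrier R" "X \<in> (\<lambda>x. N +>\<^bsub>M\<^esub> x) ` P" for r X
      using rX quotient_smult[OF M N rX(1)] Pc submoduleE(4)[OF P rX(1)] by auto
  qed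
qed

text \<open>If \<open>M/N\<close> has finite length, the ascending chain of submodules annihilated by \<open>x, x\<^sup>2, \<dots>\<close>
  becomes stationary; if it exhausts \<open>M/N\<close>, a single power of \<open>x\<close> annihilates \<open>M/N\<close>.\<close>
lemma finite_length_quotient_killed:
  fixes R (structure) and M :: "('a, 'c) module"
  assumes M: "module R M" and N: "submodule N R M" and fin: "finite_length R (quotient_module M N)" and x: "x \<in> carrier R"
    and killed: "\<And>z. z \<in> carrier M \<Longrightarrow> \<exists>n::nat. x [^] n \<odot>\<^bsub>M\<^esub> z \<in> N"
  shows "\<exists>t::nat. \<forall>z\<in>carrier M. x [^] t \<odot>\<^bsub>M\<^esub> z \<in> N"
proof -
  interpret module R M by (rule M)
  interpret N: abelian_subgroup N M by (rule abelian_subgroup_submodule[OF N])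
  define P where "P i = {z \<in> carrier M. x [^] i \<odot>\<^bsub>M\<^esub> z \<in> N}" for i :: nat
  let ?C = "\<lambda>i. (\<lambda>z. N +>\<^bsub>M\<^esub> z) ` P i"
  have NP: "N \<subseteq> P i" for i using submoduleE(4)[OF N] x submoduleE(1)[OF N] by (auto simp: P_def)
  have P_sub: "submodule (P i) R M" for i
  proof (rule submoduleI')
    show "\<zero>\<^bsub>M\<^esub> \<in> P i" using x N.zero_closed by (simp add: P_def)
    show "a \<oplus>\<^bsub>M\<^esub> b \<in> P i" if "a \<in> P i" "b \<in> P i" for a b
      using that x submoduleE(5)[OF N] by (simp add: P_def smult_r_distr)
    show "r \<odot>\<^bsub>M\<^esub> a \<in> P i" if ra: "r \<in> carrier R" "a \<in> P i" for r a
    proof -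
      have "x [^] i \<odot>\<^bsub>M\<^esub> (r \<odot>\<^bsub>M\<^esub> a) = r \<odot>\<^bsub>M\<^esub> (x [^] i \<odot>\<^bsub>M\<^esub> a)"
        using ra x by (simp add: P_def smult_assoc1[symmetric] R.m_comm)
      thus ?thesis using ra submoduleE(4)[OF N] by (simp add: P_def)
    qed
  qed (auto simp: P_def)
  have P_mono: "P i \<subseteq> P (Suc i)" for i
  proof
    fix z assume z: "z \<in> P i"
    have "x [^] Suc i \<odot>\<^bsub>M\<^esub> z = x \<odot>\<^bsub>M\<^esub> (x [^] i \<odot>\<^bsub>M\<^esub> z)"
      using z x by (simp add: P_def smult_assoc1[symmetric] R.m_comm)
    thus "z \<in> P (Suc i)" using z submoduleE(4)[OF N x] by (simp add: P_def)
  qed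
  obtain k where k: "module_length R (quotient_module M N) = enat k"
    using fin unfolding finite_length_def by blast
  have "\<exists>i. P (Suc i) = P i"
  proof (rule ccontr)
    assume "\<not> ?thesis"
    hence strict: "P i \<subset> P (Suc i)" for i using P_mono[of i] by blast
    have C_strict: "?C i \<subset> ?C (Suc i)" for i
    proof -
      obtain z where z: "z \<in> P (Suc i)" "z \<notin> P i" using strict[of i] by blast
      have "N +>\<^bsub>M\<^esub> z \<notin> ?C i"
      proof
        assume "N +>\<^bsub>M\<^esub> z \<in> ?C i"
        then obtain z' where z': "z' \<in> P i" "N +>\<^bsub>M\<^esub> z = N +>\<^bsub>M\<^esub> z'" by blast
        have c: "z \<in> carrier M" "z' \<in> carrier M" using z z' by (auto simp: P_def)
        hence "z \<ominus>\<^bsub>M\<^esub> z' \<in> P i" using coset_eq_iff[OF N c] z'(2) NP[of i] by auto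
        hence "(z \<ominus>\<^bsub>M\<^esub> z') \<oplus>\<^bsub>M\<^esub> z' \<in> P i" using submoduleE(5)[OF P_sub] z'(1) by blast
        moreover have "(z \<ominus>\<^bsub>M\<^esub> z') \<oplus>\<^bsub>M\<^esub> z' = z"
          using c by (simp add: M.minus_eq M.a_assoc M.l_neg)
        ultimately show False using z by simp
      qed
      thus ?thesis using z(1) P_mono[of i] by blast
    qed
    have "enat (Suc k) \<le> module_length R (quotient_module M N)"
      unfolding module_length_def
    proof (rule Sup_upper, clarify)
      show "\<exists>n. enat (Suc k) = enat n \<and> (\<exists>C. (\<forall>i\<le>n. submodule (C i) R (quotient_module M N)) \<and>
          (\<forall>i<n. C i \<subset> C (Suc i)))"
        using submodule_quotient[OF M N P_sub] C_strict by (intro exI[of _ "Suc k"] conjI exI[of _ ?C]) auto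
    qed
    thus False using k by simp
  qed
  then obtain i where i: "P (Suc i) = P i" by blast
  have P_stable: "P (i + j) \<subseteq> P i" for j
  proof (induction j)
    case (Suc j)
    show ?case
    proof
      fix z assume z: "z \<in> P (i + Suc j)"
      have split: "x [^] (a + l) \<odot>\<^bsub>M\<^esub> z = x [^] a \<odot>\<^bsub>M\<^esub> (x [^] l \<odot>\<^bsub>M\<^esub> z)" for a l :: nat
        using z x by (simp add: P_def smult_assoc1[symmetric] R.nat_pow_mult)
      have "x [^] Suc i \<odot>\<^bsub>M\<^esub> (x [^] j \<odot>\<^bsub>M\<^esub> z) \<in> N"
        using split[of "Suc i" j] z by (simp add: P_def)
      hence "x [^] j \<odot>\<^bsub>M\<^esub> z \<in> P (Suc i)" using z x by (simp add: P_def)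
      hence "x [^] i \<odot>\<^bsub>M\<^esub> (x [^] j \<odot>\<^bsub>M\<^esub> z) \<in> N" using i by (auto simp: P_def)
      hence "z \<in> P (i + j)" using split[of i j] z by (simp add: P_def)
      thus "z \<in> P i" using Suc by blast
    qed
  qed simp
  have P_le: "P n \<subseteq> P i" for n
  proof (cases "i \<le> n")
    case True
    thus ?thesis using P_stable[of "n - i"] by simp
  next
    case False
    thus ?thesis using lift_Suc_mono_le[of P n i] P_mono by simp
  qed
  have "x [^] i \<odot>\<^bsub>M\<^esub> z \<in> N" if "z \<in> carrier M" for z
  proof -
    obtain n :: nat where "x [^] n \<odot>\<^bsub>M\<^esub> z \<in> N" using killed[OF \<open>z \<in> carrier M\<close>] by blast
    hence "z \<in> P n" using that by (simp add: P_def)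
    thus ?thesis using P_le[of n] by (auto simp: P_def)
  qed
  thus ?thesis by blast
qed

text \<open>The rows and columns of \<open>Hom(F, E)\<close> involve, for each degree \<open>c\<close> of the injective resolution, the
  cocycles \<open>Z c\<close>, the torsion elements \<open>\<Gamma> c\<close>, and the coboundaries \<open>B c\<close> of the torsion
  complex. The \<open>c\<close>-th local cohomology is \<open>(\<Gamma> c \<inter> Z c)/B c\<close>.\<close>
locale resolved_local_ring = noetherian_local_ring R \<mm> for R (structure) and \<mm> +
  fixes E :: "nat \<Rightarrow> ('a, 'e) module" and \<epsilon> and \<delta>
  assumes injective_resolution: "injective_resolution R (regular_module R) E \<epsilon> \<delta>"
begin

lemma E_injective: "injective_module R (E c)"
  using injective_resolution by (simp add: injective_resolution_def)

lemma E_module: "module R (E c)"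
  using E_injective by (simp add: injective_module_def)

lemma \<delta>_hom: "\<delta> c \<in> module_homs R (E c) (E (Suc c))"
  and \<epsilon>_hom: "\<epsilon> \<in> module_homs R (regular_module R) (E 0)"
  and \<epsilon>_inj: "inj_on \<epsilon> (carrier R)"
  using injective_resolution by (auto simp: injective_resolution_def)

definition Z where "Z c = module_kernel (E c) (E (Suc c)) (\<delta> c)"

definition \<Gamma> where "\<Gamma> c = torsion_part R \<mm> (E c)"

lemma Z_0: "Z 0 = \<epsilon> ` carrier R" and Z_Suc: "Z (Suc c) = \<delta> c ` carrier (E c)"
  using injective_resolution by (auto simp: injective_resolution_def Z_def)

lemma Z_iff: "z \<in> Z c \<longleftrightarrow> z \<in> carrier (E c) \<and> \<delta> c z = \<zero>\<^bsub>E (Suc c)\<^esub>"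
  by (simp add: Z_def module_kernel_def)

lemma \<delta>_closed: "z \<in> carrier (E c) \<Longrightarrow> \<delta> c z \<in> carrier (E (Suc c))"
  using \<delta>_hom[of c] by (auto simp: module_homs_def)

lemma \<delta>_smult: "\<lbrakk>r \<in> carrier R; z \<in> carrier (E c)\<rbrakk> \<Longrightarrow> \<delta> c (r \<odot>\<^bsub>E c\<^esub> z) = r \<odot>\<^bsub>E (Suc c)\<^esub> \<delta> c z"
  using \<delta>_hom[of c] by (auto simp: module_homs_def)

lemma \<delta>_diff:
  "\<lbrakk>y \<in> carrier (E c); z \<in> carrier (E c)\<rbrakk> \<Longrightarrow> \<delta> c (y \<ominus>\<^bsub>E c\<^esub> z) = \<delta> c y \<ominus>\<^bsub>E (Suc c)\<^esub> \<delta> c z"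
  using module_homs_diff[OF E_module E_module \<delta>_hom] .

lemma \<delta>_\<delta>: "z \<in> carrier (E c) \<Longrightarrow> \<delta> (Suc c) (\<delta> c z) = \<zero>\<^bsub>E (Suc (Suc c))\<^esub>"
  using Z_Suc Z_iff by blast

lemma Z_submodule: "submodule (Z c) R (E c)"
proof -
  interpret E: module R "E c" by (rule E_module)
  interpret E': module R "E (Suc c)" by (rule E_module)
  show ?thesis
  proof (rule E.submoduleI')
    show "\<zero>\<^bsub>E c\<^esub> \<in> Z c" using module_homs_zero[OF E_module E_module \<delta>_hom] by (simp add: Z_iff)
    show "x \<oplus>\<^bsub>E c\<^esub> y \<in> Z c" if "x \<in> Z c" "y \<in> Z c" for x y
      using that \<delta>_hom[of c] by (auto simp: Z_iff module_homs_def)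
  qed (auto simp: Z_iff \<delta>_smult)
qed

lemma \<Gamma>_submodule: "submodule (\<Gamma> c) R (E c)"
  unfolding \<Gamma>_def by (rule torsion_submodule[OF E_module ideal_mm])

lemma \<Gamma>_carrier: "z \<in> \<Gamma> c \<Longrightarrow> z \<in> carrier (E c)"
  by (simp add: \<Gamma>_def torsion_part_def)

definition B where "B c = (case c of 0 \<Rightarrow> {\<zero>\<^bsub>E 0\<^esub>} | Suc j \<Rightarrow> \<delta> j ` \<Gamma> j)"

lemma cohomology_killed:
  assumes fin: "finite_length R (local_cohomology R \<mm> E \<delta> c)" and x: "x \<in> \<mm>"
  obtains t :: nat where "\<And>z. z \<in> \<Gamma> c \<inter> Z c \<Longrightarrow> x [^] t \<odot>\<^bsub>E c\<^esub> z \<in> B c"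
proof -
  interpret E: module R "E c" by (rule E_module)
  let ?M = "(E c)\<lparr>carrier := \<Gamma> c \<inter> Z c\<rparr>"
  have sub: "submodule (\<Gamma> c \<inter> Z c) R (E c)"
  proof (rule E.submoduleI')
    show "\<Gamma> c \<inter> Z c \<subseteq> carrier (E c)" by (auto simp: Z_iff)
    show "\<zero>\<^bsub>E c\<^esub> \<in> \<Gamma> c \<inter> Z c"
      using subgroup.one_closed[OF submodule.axioms(1)[OF Z_submodule[of c]]]
        subgroup.one_closed[OF submodule.axioms(1)[OF \<Gamma>_submodule[of c]]] by simp
    show "x \<oplus>\<^bsub>E c\<^esub> y \<in> \<Gamma> c \<inter> Z c" if "x \<in> \<Gamma> c \<inter> Z c" "y \<in> \<Gamma> c \<inter> Z c" for x y
      using that E.submoduleE(5)[OF Z_submodule[of c]] E.submoduleE(5)[OF \<Gamma>_submodule[of c]] by blast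
    show "r \<odot>\<^bsub>E c\<^esub> y \<in> \<Gamma> c \<inter> Z c" if "r \<in> carrier R" "y \<in> \<Gamma> c \<inter> Z c" for r y
      using that E.submoduleE(4)[OF Z_submodule[of c]] E.submoduleE(4)[OF \<Gamma>_submodule[of c]] by blast
  qed
  interpret M: module R ?M by (rule submodule.submodule_is_module[OF sub E_module])
  have B: "submodule (B c) R ?M"
  proof (cases c)
    case 0
    show ?thesis
    proof (rule M.submoduleI')
      show "B c \<subseteq> carrier ?M" using M.M.zero_closed by (simp add: B_def 0)
    qed (use E.smult_r_null E.M.zero_closed E.M.l_zero in \<open>auto simp: B_def 0\<close>)
  next
    case (Suc j)
    interpret E': module R "E j" by (rule E_module)
    show ?thesis
    proof (rule M.submoduleI')
      show "B c \<subseteq> carrier ?M"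
        using torsion_hom[OF E_module E_module \<delta>_hom ideal_mm, of _ j] \<Gamma>_carrier
        by (auto simp: B_def Suc \<Gamma>_def Z_Suc)
      show "\<zero>\<^bsub>?M\<^esub> \<in> B c"
        using module_homs_zero[OF E_module E_module \<delta>_hom, of j]
          subgroup.one_closed[OF submodule.axioms(1)[OF \<Gamma>_submodule[of j]]]
        by (auto simp: B_def Suc intro!: image_eqI[of _ _ "\<zero>\<^bsub>E j\<^esub>"])
      show "x \<oplus>\<^bsub>?M\<^esub> y \<in> B c" if xy: "x \<in> B c" "y \<in> B c" for x y
      proof -
        obtain x' y' where xy': "x' \<in> \<Gamma> j" "x = \<delta> j x'" "y' \<in> \<Gamma> j" "y = \<delta> j y'"
          using xy by (auto simp: B_def Suc)
        hence "x \<oplus>\<^bsub>?M\<^esub> y = \<delta> j (x' \<oplus>\<^bsub>E j\<^esub> y')"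
          using \<delta>_hom[of j] \<Gamma>_carrier by (simp add: module_homs_def Suc)
        thus ?thesis using E'.submoduleE(5)[OF \<Gamma>_submodule] xy' by (auto simp: B_def Suc)
      qed
      show "r \<odot>\<^bsub>?M\<^esub> y \<in> B c" if ry: "r \<in> carrier R" "y \<in> B c" for r y
      proof -
        obtain y' where y': "y' \<in> \<Gamma> j" "y = \<delta> j y'" using ry by (auto simp: B_def Suc)
        hence "r \<odot>\<^bsub>?M\<^esub> y = \<delta> j (r \<odot>\<^bsub>E j\<^esub> y')" using \<delta>_smult ry \<Gamma>_carrier by (simp add: Suc)
        thus ?thesis using E'.submoduleE(4)[OF \<Gamma>_submodule ry(1)] y' by (auto simp: B_def Suc)
      qed
    qed
  qed
  have "local_cohomology R \<mm> E \<delta> c = quotient_module ?M (B c)"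
    by (simp add: local_cohomology_def B_def \<Gamma>_def Z_def cong: nat.case_cong)
  hence fin': "finite_length R (quotient_module ?M (B c))" using fin by simp
  have xc: "x \<in> carrier R" using x mm_subset by blast
  have "\<exists>n::nat. x [^] n \<odot>\<^bsub>?M\<^esub> z \<in> B c" if z: "z \<in> carrier ?M" for z
  proof -
    obtain n where n: "\<And>r. r \<in> ideal_pow R \<mm> n \<Longrightarrow> r \<odot>\<^bsub>E c\<^esub> z = \<zero>\<^bsub>E c\<^esub>"
      using z by (auto simp: \<Gamma>_def torsion_part_def)
    have "x [^] n \<odot>\<^bsub>?M\<^esub> z = \<zero>\<^bsub>?M\<^esub>" using n[OF pow_mem_ideal_pow[OF ideal_mm x]] by simp
    moreover have "\<zero>\<^bsub>?M\<^esub> \<in> B c" using subgroup.one_closed[OF submodule.axioms(1)[OF B]] by simp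
    ultimately show ?thesis by metis
  qed
  from finite_length_quotient_killed[OF M.module_axioms B fin' xc this] show thesis using that by auto
qed

end

text \<open>The element \<open>r\<close> annihilates \<open>Ext\<^sup>j(R/\<mm>\<^sup>l, R/J)\<close> for all \<open>j \<le> c\<close>, uniformly in \<open>l\<close>. The
  \<open>Ext\<close> modules are represented by cochains with values in \<open>R\<close>, to be read modulo \<open>J\<close>. Because of
  the shift in the numbering of the resolution, \<open>Ext\<^sup>j\<close> sits in degree \<open>j + 1\<close>.\<close>
definition ext_killed :: "('a, 'b) ring_scheme \<Rightarrow> 'a set \<Rightarrow> nat \<Rightarrow> 'a set \<Rightarrow> 'a \<Rightarrow> bool" where
  "ext_killed R \<mm> c J r \<longleftrightarrow>
     (\<forall>l b A. cyclic_resolution R (ideal_pow R \<mm> l) b A \<longrightarrow>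
       (\<forall>j\<le>c. \<forall>v\<in>{..<b (Suc j)} \<rightarrow> carrier R.
         (\<forall>k<b (Suc (Suc j)). cobd b A (regular_module R) (Suc j) v k \<in> J) \<longrightarrow>
         (\<exists>u\<in>{..<b j} \<rightarrow> carrier R. \<forall>k<b (Suc j).
            cobd b A (regular_module R) j u k \<ominus>\<^bsub>R\<^esub> r \<otimes>\<^bsub>R\<^esub> v k \<in> J)))"

context resolved_local_ring
begin

context
  fixes \<rho> :: 'a and n :: nat
  assumes \<rho>: "\<rho> \<in> carrier R"
    and killed: "\<And>c z. \<lbrakk>c < n; z \<in> \<Gamma> c \<inter> Z c\<rbrakk> \<Longrightarrow> \<rho> \<odot>\<^bsub>E c\<^esub> z \<in> B c"
begin

text \<open>The first half of the chase, for cochains with values in the torsion. As \<open>\<rho>\<close> annihilates the local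
  cohomology, \<open>\<rho> v = \<delta> e\<close> with torsion elements \<open>e\<close>; the error \<open>d e\<close> is a torsion cocycle one
  degree lower, so by induction a multiple of it is \<open>\<delta>\<close> of a cocycle, which is a coboundary since
  \<open>Hom(F, E)\<close> is exact. Correcting \<open>e\<close> by the image under \<open>\<delta>\<close> of a preimage removes the error.\<close>
lemma torsion_cocycle_bounds:
  assumes res: "cyclic_resolution R I b A"
    and "Suc c < n" "1 \<le> i" "v \<in> {..<b i} \<rightarrow> \<Gamma> (Suc c) \<inter> Z (Suc c)"
    and "\<And>k. k < b (Suc i) \<Longrightarrow> cobd b A (E (Suc c)) i v k = \<zero>\<^bsub>E (Suc c)\<^esub>"
  shows "\<exists>u\<in>{..<b i} \<rightarrow> carrier (E c).
    (\<forall>k<b (Suc i). cobd b A (E c) i u k = \<zero>\<^bsub>E c\<^esub>) \<and>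
    (\<forall>k<b i. \<delta> c (u k) = \<rho> [^] Suc (Suc c) \<odot>\<^bsub>E (Suc c)\<^esub> v k)"
  using assms(2-)
proof (induction c arbitrary: i v)
  interpret resolved_ideal R I b A by unfold_locales (rule res)
  let ?P = "\<lambda>c i v w e. e \<in> {..<b i} \<rightarrow> carrier (E c) \<and> w \<in> {..<b (Suc i)} \<rightarrow> \<Gamma> c \<inter> Z c \<and>
    (\<forall>k<b i. \<delta> c (e k) = \<rho> \<odot>\<^bsub>E (Suc c)\<^esub> v k) \<and> (\<forall>k<b (Suc i). w k = d (E c) i e k) \<and>
    (\<forall>k<b (Suc (Suc i)). d (E c) (Suc i) w k = \<zero>\<^bsub>E c\<^esub>)"
  have lift: "\<exists>e w. ?P c i v w e"
    if c: "Suc c < n" and v: "v \<in> {..<b i} \<rightarrow> \<Gamma> (Suc c) \<inter> Z (Suc c)"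
      and dv: "\<And>k. k < b (Suc i) \<Longrightarrow> d (E (Suc c)) i v k = \<zero>\<^bsub>E (Suc c)\<^esub>" for c i v
  proof -
    interpret E': module R "E (Suc c)" by (rule E_module)
    have vc: "v \<in> {..<b i} \<rightarrow> carrier (E (Suc c))" using v Z_iff by fast
    have "\<forall>k\<in>{..<b i}. \<exists>e. e \<in> \<Gamma> c \<and> \<delta> c e = \<rho> \<odot>\<^bsub>E (Suc c)\<^esub> v k"
      using killed[OF c] v by (force simp: B_def)
    from bchoice[OF this] obtain e where "\<forall>k\<in>{..<b i}. e k \<in> \<Gamma> c \<and> \<delta> c (e k) = \<rho> \<odot>\<^bsub>E (Suc c)\<^esub> v k" by (rule exE)
    hence e: "\<And>k. k < b i \<Longrightarrow> e k \<in> \<Gamma> c" "\<And>k. k < b i \<Longrightarrow> \<delta> c (e k) = \<rho> \<odot>\<^bsub>E (Suc c)\<^esub> v k" by simp_all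
    have ec: "e \<in> {..<b i} \<rightarrow> carrier (E c)" using e(1) \<Gamma>_carrier by auto
    have "d (E c) i e k \<in> \<Gamma> c \<inter> Z c" if k: "k < b (Suc i)" for k
    proof
      show "d (E c) i e k \<in> \<Gamma> c" by (rule cobd_mem[OF E_module \<Gamma>_submodule]) (use e(1) k in auto)
      have "\<delta> c (d (E c) i e k) = d (E (Suc c)) i (\<lambda>k. \<delta> c (e k)) k"
        by (rule cobd_hom[OF E_module E_module \<delta>_hom ec k])
      also have "\<dots> = d (E (Suc c)) i (\<lambda>k. \<rho> \<odot>\<^bsub>E (Suc c)\<^esub> v k) k"
        by (rule cobd_cong[OF E_module _ _ k]) (use e(2) vc \<rho> in auto)
      also have "\<dots> = \<rho> \<odot>\<^bsub>E (Suc c)\<^esub> d (E (Suc c)) i v k"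
        by (rule cobd_smult[OF E_module vc \<rho> k])
      also have "\<dots> = \<zero>\<^bsub>E (Suc c)\<^esub>" using dv[OF k] \<rho> E'.smult_r_null by simp
      finally show "d (E c) i e k \<in> Z c" using cobd_closed[OF E_module ec] k by (auto simp: Z_iff)
    qed
    moreover have "d (E c) (Suc i) (d (E c) i e) k = \<zero>\<^bsub>E c\<^esub>" if "k < b (Suc (Suc i))" for k
      by (rule cobd_cobd[OF E_module ec that])
    ultimately show ?thesis using e(2) ec by blast
  qed
  {
    case 0
    interpret E: module R "E 0" by (rule E_module)
    interpret E': module R "E (Suc 0)" by (rule E_module)
    obtain e w where e: "?P 0 i v w e" using lift[OF 0(1,3,4)] by blast
    have ec: "e \<in> {..<b i} \<rightarrow> carrier (E 0)" using e by blast
    have vc: "v \<in> {..<b i} \<rightarrow> carrier (E (Suc 0))" using 0(3) Z_iff by fast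
    show ?case
    proof (rule bexI[of _ "\<lambda>k. \<rho> \<odot>\<^bsub>E 0\<^esub> e k"], intro conjI allI impI)
      show "(\<lambda>k. \<rho> \<odot>\<^bsub>E 0\<^esub> e k) \<in> {..<b i} \<rightarrow> carrier (E 0)" using ec \<rho> by auto
      fix k
      show "d (E 0) i (\<lambda>k. \<rho> \<odot>\<^bsub>E 0\<^esub> e k) k = \<zero>\<^bsub>E 0\<^esub>" if k: "k < b (Suc i)"
      proof -
        have "w k \<in> \<Gamma> 0 \<inter> Z 0" using e k by blast
        hence "\<rho> \<odot>\<^bsub>E 0\<^esub> w k = \<zero>\<^bsub>E 0\<^esub>" using killed[of 0 "w k"] 0(1) by (simp add: B_def)
        thus ?thesis using cobd_smult[OF E_module ec \<rho> k] e k by simp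
      qed
      show "\<delta> 0 (\<rho> \<odot>\<^bsub>E 0\<^esub> e k) = \<rho> [^] Suc (Suc 0) \<odot>\<^bsub>E (Suc 0)\<^esub> v k" if k: "k < b i"
      proof -
        have c: "e k \<in> carrier (E 0)" "v k \<in> carrier (E (Suc 0))" using ec vc k by auto
        have "\<delta> 0 (e k) = \<rho> \<odot>\<^bsub>E (Suc 0)\<^esub> v k" using e k by blast
        thus ?thesis using \<delta>_smult[OF \<rho> c(1)] c \<rho> by (simp add: E'.smult_assoc1)
      qed
    qed
  next
    case (Suc c)
    interpret E: module R "E (Suc c)" by (rule E_module)
    interpret E': module R "E (Suc (Suc c))" by (rule E_module)
    obtain e w where e: "?P (Suc c) i v w e" using lift[OF Suc.prems(1,3,4)] by blast
    have ec: "e \<in> {..<b i} \<rightarrow> carrier (E (Suc c))" using e by blast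
    have vc: "v \<in> {..<b i} \<rightarrow> carrier (E (Suc (Suc c)))" using Suc.prems(3) Z_iff by fast
    let ?\<sigma> = "\<rho> [^] Suc (Suc c)"
    have \<sigma>: "?\<sigma> \<in> carrier R" using \<rho> by (rule nat_pow_closed)
    have "\<exists>u\<in>{..<b (Suc i)} \<rightarrow> carrier (E c).
        (\<forall>k<b (Suc (Suc i)). d (E c) (Suc i) u k = \<zero>\<^bsub>E c\<^esub>) \<and>
        (\<forall>k<b (Suc i). \<delta> c (u k) = ?\<sigma> \<odot>\<^bsub>E (Suc c)\<^esub> w k)"
      by (rule Suc.IH) (use Suc.prems(1) e in auto)
    then obtain u where u: "u \<in> {..<b (Suc i)} \<rightarrow> carrier (E c)"
      "\<And>k. k < b (Suc (Suc i)) \<Longrightarrow> d (E c) (Suc i) u k = \<zero>\<^bsub>E c\<^esub>"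
      "\<And>k. k < b (Suc i) \<Longrightarrow> \<delta> c (u k) = ?\<sigma> \<odot>\<^bsub>E (Suc c)\<^esub> w k" by blast
    obtain g where g: "g \<in> {..<b i} \<rightarrow> carrier (E c)" "\<And>k. k < b (Suc i) \<Longrightarrow> d (E c) i g k = u k"
      using cobd_exact[OF E_injective Suc.prems(2) u(1,2)] by blast
    have \<delta>g: "(\<lambda>k. \<delta> c (g k)) \<in> {..<b i} \<rightarrow> carrier (E (Suc c))" using g(1) \<delta>_closed by auto
    have \<sigma>e: "(\<lambda>k. ?\<sigma> \<odot>\<^bsub>E (Suc c)\<^esub> e k) \<in> {..<b i} \<rightarrow> carrier (E (Suc c))"
      using ec \<sigma> E.smult_closed by blast
    show ?case
    proof (rule bexI[of _ "\<lambda>k. ?\<sigma> \<odot>\<^bsub>E (Suc c)\<^esub> e k \<ominus>\<^bsub>E (Suc c)\<^esub> \<delta> c (g k)"], intro conjI allI impI)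
      show "(\<lambda>k. ?\<sigma> \<odot>\<^bsub>E (Suc c)\<^esub> e k \<ominus>\<^bsub>E (Suc c)\<^esub> \<delta> c (g k)) \<in> {..<b i} \<rightarrow> carrier (E (Suc c))"
        using \<sigma>e \<delta>g by (auto simp: Pi_iff)
      fix k
      show "d (E (Suc c)) i (\<lambda>k. ?\<sigma> \<odot>\<^bsub>E (Suc c)\<^esub> e k \<ominus>\<^bsub>E (Suc c)\<^esub> \<delta> c (g k)) k = \<zero>\<^bsub>E (Suc c)\<^esub>"
        if k: "k < b (Suc i)"
      proof -
        have "d (E (Suc c)) i (\<lambda>k. ?\<sigma> \<odot>\<^bsub>E (Suc c)\<^esub> e k) k = ?\<sigma> \<odot>\<^bsub>E (Suc c)\<^esub> w k"
          using cobd_smult[OF E_module ec \<sigma> k] e k by simp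
        moreover have "d (E (Suc c)) i (\<lambda>k. \<delta> c (g k)) k = ?\<sigma> \<odot>\<^bsub>E (Suc c)\<^esub> w k"
          using cobd_hom[OF E_module E_module \<delta>_hom g(1) k] g(2)[OF k] u(3)[OF k] by simp
        moreover have "?\<sigma> \<odot>\<^bsub>E (Suc c)\<^esub> w k \<in> carrier (E (Suc c))"
          using e k \<sigma> \<Gamma>_carrier E.smult_closed by blast
        ultimately show ?thesis using cobd_diff[OF E_module \<sigma>e \<delta>g k] by simp
      qed
      show "\<delta> (Suc c) (?\<sigma> \<odot>\<^bsub>E (Suc c)\<^esub> e k \<ominus>\<^bsub>E (Suc c)\<^esub> \<delta> c (g k)) =
          \<rho> [^] Suc (Suc (Suc c)) \<odot>\<^bsub>E (Suc (Suc c))\<^esub> v k" if k: "k < b i"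
      proof -
        have c: "e k \<in> carrier (E (Suc c))" "v k \<in> carrier (E (Suc (Suc c)))" "g k \<in> carrier (E c)"
          using ec vc g(1) k by auto
        have "\<delta> (Suc c) (e k) = \<rho> \<odot>\<^bsub>E (Suc (Suc c))\<^esub> v k" using e k by blast
        hence "\<delta> (Suc c) (?\<sigma> \<odot>\<^bsub>E (Suc c)\<^esub> e k) = \<rho> [^] Suc (Suc (Suc c)) \<odot>\<^bsub>E (Suc (Suc c))\<^esub> v k"
          using \<delta>_smult[OF \<sigma> c(1)] E'.smult_assoc1[OF \<sigma> \<rho> c(2)] by simp
        thus ?thesis
          using \<delta>_diff[OF E.smult_closed[OF \<sigma> c(1)] \<delta>_closed[OF c(3)]] \<delta>_\<delta>[OF c(3)]
            E'.smult_closed[OF _ c(2), of "\<rho> [^] Suc (Suc (Suc c))"] \<rho>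
          by (simp add: E'.M.minus_eq)
      qed
    qed
  }
qed

text \<open>The second half of the chase: writing a cocycle \<open>v\<close> with values in \<open>Z c\<close> as \<open>d u\<close> over the
  injective module \<open>E c\<close> turns it into the cocycle \<open>\<delta> u\<close> with values in \<open>Z (c + 1)\<close>, one degree lower
  in \<open>F\<close>. In the lowest degree \<open>\<delta> u\<close> is annihilated by \<open>\<mm>\<^sup>l\<close>, hence torsion. Each time, a cochain
  \<open>y\<close> with \<open>d y = 0\<close> and \<open>\<delta> y = r \<delta> u\<close> is found, and \<open>r u - y\<close> has values in \<open>Z c\<close> and the
  coboundary \<open>r v\<close>.\<close>
lemma cocycle_bounds:
  assumes res: "cyclic_resolution R (ideal_pow R \<mm> l) b A"
    and "1 \<le> i" "c + i < n" "v \<in> {..<b (Suc i)} \<rightarrow> Z c"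
    and "\<And>k. k < b (Suc (Suc i)) \<Longrightarrow> cobd b A (E c) (Suc i) v k = \<zero>\<^bsub>E c\<^esub>"
  shows "\<exists>w\<in>{..<b i} \<rightarrow> Z c. \<forall>k<b (Suc i). cobd b A (E c) i w k = \<rho> [^] Suc (c + i) \<odot>\<^bsub>E c\<^esub> v k"
  using assms(2-)
proof (induction i arbitrary: c v rule: dec_induct)
  interpret resolved_ideal R "ideal_pow R \<mm> l" b A by unfold_locales (rule res)
  let ?Q = "\<lambda>c i v u. u \<in> {..<b i} \<rightarrow> carrier (E c) \<and> (\<forall>k<b (Suc i). d (E c) i u k = v k) \<and>
    (\<forall>k<b (Suc i). d (E (Suc c)) i (\<lambda>k. \<delta> c (u k)) k = \<zero>\<^bsub>E (Suc c)\<^esub>)"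
  have lift: "\<exists>u. ?Q c i v u"
    if i: "1 \<le> i" and v: "v \<in> {..<b (Suc i)} \<rightarrow> Z c"
      and dv: "\<And>k. k < b (Suc (Suc i)) \<Longrightarrow> d (E c) (Suc i) v k = \<zero>\<^bsub>E c\<^esub>" for i c v
  proof -
    have vc: "v \<in> {..<b (Suc i)} \<rightarrow> carrier (E c)" using v Z_iff by fast
    obtain u where u: "u \<in> {..<b i} \<rightarrow> carrier (E c)" "\<And>k. k < b (Suc i) \<Longrightarrow> d (E c) i u k = v k"
      using cobd_exact[OF E_injective i vc dv] by blast
    have "d (E (Suc c)) i (\<lambda>k. \<delta> c (u k)) k = \<zero>\<^bsub>E (Suc c)\<^esub>" if k: "k < b (Suc i)" for k
    proof -
      have "v k \<in> Z c" using v k by blast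
      thus ?thesis using cobd_hom[OF E_module E_module \<delta>_hom u(1) k] u(2)[OF k] by (simp add: Z_iff)
    qed
    thus ?thesis using u by blast
  qed
  have finish: "\<exists>w\<in>{..<b i} \<rightarrow> Z c. \<forall>k<b (Suc i). d (E c) i w k = r \<odot>\<^bsub>E c\<^esub> v k"
    if u: "?Q c i v u" and y: "y \<in> {..<b i} \<rightarrow> carrier (E c)" and r: "r \<in> carrier R"
      and dy: "\<And>k. k < b (Suc i) \<Longrightarrow> d (E c) i y k = \<zero>\<^bsub>E c\<^esub>"
      and \<delta>y: "\<And>k. k < b i \<Longrightarrow> \<delta> c (y k) = r \<odot>\<^bsub>E (Suc c)\<^esub> \<delta> c (u k)"
    for i c v u y r
  proof (rule bexI[of _ "\<lambda>k. r \<odot>\<^bsub>E c\<^esub> u k \<ominus>\<^bsub>E c\<^esub> y k"], intro allI impI)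
    interpret E: module R "E c" by (rule E_module)
    interpret E': module R "E (Suc c)" by (rule E_module)
    have uc: "u \<in> {..<b i} \<rightarrow> carrier (E c)" using u by blast
    have ru: "(\<lambda>k. r \<odot>\<^bsub>E c\<^esub> u k) \<in> {..<b i} \<rightarrow> carrier (E c)" using uc r by auto
    show "(\<lambda>k. r \<odot>\<^bsub>E c\<^esub> u k \<ominus>\<^bsub>E c\<^esub> y k) \<in> {..<b i} \<rightarrow> Z c"
    proof
      fix k assume "k \<in> {..<b i}"
      hence k: "k < b i" and c: "u k \<in> carrier (E c)" "y k \<in> carrier (E c)" using uc y by auto
      have "r \<odot>\<^bsub>E (Suc c)\<^esub> \<delta> c (u k) \<in> carrier (E (Suc c))" using \<delta>_closed[OF c(1)] r by simp
      thus "r \<odot>\<^bsub>E c\<^esub> u k \<ominus>\<^bsub>E c\<^esub> y k \<in> Z c"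
        using c r \<delta>y[OF k] by (simp add: Z_iff \<delta>_diff \<delta>_smult)
    qed
    fix k assume k: "k < b (Suc i)"
    have "d (E c) i (\<lambda>k. r \<odot>\<^bsub>E c\<^esub> u k \<ominus>\<^bsub>E c\<^esub> y k) k = r \<odot>\<^bsub>E c\<^esub> d (E c) i u k \<ominus>\<^bsub>E c\<^esub> \<zero>\<^bsub>E c\<^esub>"
      using cobd_diff[OF E_module ru y k] cobd_smult[OF E_module uc r k] dy[OF k] by simp
    moreover have "d (E c) i u k \<in> carrier (E c)" using cobd_closed[OF E_module uc] k by auto
    ultimately show "d (E c) i (\<lambda>k. r \<odot>\<^bsub>E c\<^esub> u k \<ominus>\<^bsub>E c\<^esub> y k) k = r \<odot>\<^bsub>E c\<^esub> v k"
      using u k r by (simp add: E.M.minus_eq)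
  qed
  {
    case base
    obtain u where u: "?Q c 1 v u" using lift[OF _ base(2)] base(3) by auto
    have uc: "u \<in> {..<b 1} \<rightarrow> carrier (E c)" using u by blast
    have \<delta>u: "(\<lambda>k. \<delta> c (u k)) \<in> {..<b 1} \<rightarrow> carrier (E (Suc c))" using uc \<delta>_closed by auto
    have "\<exists>y\<in>{..<b 1} \<rightarrow> carrier (E c). (\<forall>k<b (Suc 1). d (E c) 1 y k = \<zero>\<^bsub>E c\<^esub>) \<and>
      (\<forall>k<b 1. \<delta> c (y k) = \<rho> [^] Suc (Suc c) \<odot>\<^bsub>E (Suc c)\<^esub> \<delta> c (u k))"
    proof (rule torsion_cocycle_bounds[OF res])
      show "Suc c < n" using base by simp
      show "(\<lambda>k. \<delta> c (u k)) \<in> {..<b 1} \<rightarrow> \<Gamma> (Suc c) \<inter> Z (Suc c)"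
      proof
        fix k assume k: "k \<in> {..<b 1}"
        hence [simp]: "k = 0" using b_1 by simp
        have u0: "u 0 \<in> carrier (E c)" using uc k by auto
        have "r \<odot>\<^bsub>E (Suc c)\<^esub> \<delta> c (u 0) = \<zero>\<^bsub>E (Suc c)\<^esub>" if "r \<in> ideal_pow R \<mm> l" for r
          using annihilated_by_ideal_if_cobd_1_zero[OF E_module \<delta>u _ that] u
          by (simp add: numeral_2_eq_2)
        thus "\<delta> c (u k) \<in> \<Gamma> (Suc c) \<inter> Z (Suc c)"
          using u0 \<delta>_closed[OF u0] Z_Suc by (auto simp: \<Gamma>_def torsion_part_def)
      qed
    qed (use u in auto)
    then obtain y where y: "y \<in> {..<b 1} \<rightarrow> carrier (E c)"
      "\<And>k. k < b (Suc 1) \<Longrightarrow> d (E c) 1 y k = \<zero>\<^bsub>E c\<^esub>"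
      "\<And>k. k < b 1 \<Longrightarrow> \<delta> c (y k) = \<rho> [^] Suc (Suc c) \<odot>\<^bsub>E (Suc c)\<^esub> \<delta> c (u k)" by blast
    show ?case using finish[OF u y(1) _ y(2,3)] \<rho> by simp
  next
    case (step i)
    interpret E': module R "E (Suc c)" by (rule E_module)
    obtain u where u: "?Q c (Suc i) v u" using lift[of "Suc i" v c] step.prems(2,3) by auto
    have uc: "u \<in> {..<b (Suc i)} \<rightarrow> carrier (E c)" using u by blast
    let ?r = "\<rho> [^] Suc (Suc c + i)"
    have r: "?r \<in> carrier R" using \<rho> by (rule nat_pow_closed)
    have "\<exists>w\<in>{..<b i} \<rightarrow> Z (Suc c). \<forall>k<b (Suc i). d (E (Suc c)) i w k = ?r \<odot>\<^bsub>E (Suc c)\<^esub> \<delta> c (u k)"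
      by (rule step.IH) (use step.prems(1) u uc Z_Suc in auto)
    then obtain w where w: "w \<in> {..<b i} \<rightarrow> Z (Suc c)"
      "\<And>k. k < b (Suc i) \<Longrightarrow> d (E (Suc c)) i w k = ?r \<odot>\<^bsub>E (Suc c)\<^esub> \<delta> c (u k)" by blast
    have "\<forall>k\<in>{..<b i}. \<exists>g. g \<in> carrier (E c) \<and> \<delta> c g = w k"
    proof
      fix k assume "k \<in> {..<b i}"
      hence "w k \<in> \<delta> c ` carrier (E c)" using w(1) unfolding Z_Suc by blast
      then obtain a where "w k = \<delta> c a" "a \<in> carrier (E c)" by (rule imageE)
      thus "\<exists>g. g \<in> carrier (E c) \<and> \<delta> c g = w k" by (intro exI[of _ a]) simp
    qed
    from bchoice[OF this] obtain g where "\<forall>k\<in>{..<b i}. g k \<in> carrier (E c) \<and> \<delta> c (g k) = w k" by (rule exE)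
    hence g: "\<And>k. k < b i \<Longrightarrow> g k \<in> carrier (E c)" "\<And>k. k < b i \<Longrightarrow> \<delta> c (g k) = w k" by simp_all
    have gc: "g \<in> {..<b i} \<rightarrow> carrier (E c)" using g(1) by auto
    have wc: "w \<in> {..<b i} \<rightarrow> carrier (E (Suc c))" using w(1) Z_iff by fast
    have dg: "d (E c) i g \<in> {..<b (Suc i)} \<rightarrow> carrier (E c)" by (rule cobd_closed[OF E_module gc])
    have \<delta>dg: "\<delta> c (d (E c) i g k) = ?r \<odot>\<^bsub>E (Suc c)\<^esub> \<delta> c (u k)" if k: "k < b (Suc i)" for k
    proof -
      have "\<delta> c (d (E c) i g k) = d (E (Suc c)) i (\<lambda>k. \<delta> c (g k)) k"
        by (rule cobd_hom[OF E_module E_module \<delta>_hom gc k])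
      also have "\<dots> = d (E (Suc c)) i w k" by (rule cobd_cong[OF E_module _ wc k]) (rule g(2))
      finally show ?thesis using w(2)[OF k] by simp
    qed
    have ddg: "d (E c) (Suc i) (d (E c) i g) k = \<zero>\<^bsub>E c\<^esub>" if "k < b (Suc (Suc i))" for k
      by (rule cobd_cobd[OF E_module gc that])
    show ?case using finish[OF u dg r ddg \<delta>dg] by simp
  }
qed

text \<open>Since \<open>\<epsilon>\<close> identifies \<open>R\<close> with \<open>Z 0\<close>, this is the case \<open>c = 0\<close> of the chase. The power
  of \<open>\<rho>\<close> depends only on the number of steps, not on the resolution \<open>F\<close>.\<close>
lemma ext_killed_ring: "j < n \<Longrightarrow> ext_killed R \<mm> j {\<zero>} (\<rho> [^] n)"
  unfolding ext_killed_def
proof (intro allI impI ballI)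
  fix l b A i v
  assume jn: "j < n" and res: "cyclic_resolution R (ideal_pow R \<mm> l) b A" and ij: "i \<le> j"
    and v: "v \<in> {..<b (Suc i)} \<rightarrow> carrier R"
    and dv: "\<forall>k<b (Suc (Suc i)). cobd b A (regular_module R) (Suc i) v k \<in> {\<zero>}"
  interpret resolved_ideal R "ideal_pow R \<mm> l" b A by unfold_locales (rule res)
  interpret E: module R "E 0" by (rule E_module)
  interpret reg: module R "regular_module R" by (rule module_regular)
  let ?v = "\<lambda>k. \<epsilon> (v k)"
  have \<epsilon>_zero: "\<epsilon> \<zero> = \<zero>\<^bsub>E 0\<^esub>" using module_homs_zero[OF module_regular E_module \<epsilon>_hom] by simp
  have vZ: "?v \<in> {..<b (Suc i)} \<rightarrow> Z 0" using v Z_0 by auto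
  have dv': "d (E 0) (Suc i) ?v k = \<zero>\<^bsub>E 0\<^esub>" if k: "k < b (Suc (Suc i))" for k
    using cobd_hom[OF module_regular E_module \<epsilon>_hom, of v "Suc i" k] v k dv \<epsilon>_zero by simp
  have \<epsilon>_smult: "\<epsilon> (r \<otimes> x) = r \<odot>\<^bsub>E 0\<^esub> \<epsilon> x" if "r \<in> carrier R" "x \<in> carrier R" for r x
    using \<epsilon>_hom that by (auto simp: module_homs_def)
  \<comment> \<open>The chase yields the exponent \<open>i + 1\<close>; this factor raises it to \<open>n\<close>.\<close>
  define s where "s = \<rho> [^] (n - Suc i)"
  have s: "s \<in> carrier R" "s \<otimes> \<rho> [^] Suc i = \<rho> [^] n"
    using \<rho> ij jn nat_pow_mult[OF \<rho>, of "n - Suc i" "Suc i"] by (auto simp: s_def)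
  have "\<exists>u\<in>{..<b i} \<rightarrow> carrier R. \<forall>k<b (Suc i). d (regular_module R) i u k = \<rho> [^] Suc i \<otimes> v k"
  proof (cases "i = 0")
    case True
    show ?thesis
    proof (rule bexI[of _ "\<lambda>_. \<zero>"], intro allI impI)
      fix k assume k: "k < b (Suc i)"
      hence [simp]: "k = 0" using True b_1 by simp
      have vc: "v 0 \<in> carrier R" using v k by auto
      have "r \<odot>\<^bsub>E 0\<^esub> ?v 0 = \<zero>\<^bsub>E 0\<^esub>" if "r \<in> ideal_pow R \<mm> l" for r
        by (rule annihilated_by_ideal_if_cobd_1_zero[OF E_module _ _ that])
          (use vZ dv' True Z_iff in \<open>auto simp: numeral_2_eq_2 Pi_iff\<close>)
      hence "?v 0 \<in> \<Gamma> 0 \<inter> Z 0" using vZ k by (auto simp: \<Gamma>_def torsion_part_def Z_iff Pi_iff)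
      hence "\<rho> \<odot>\<^bsub>E 0\<^esub> ?v 0 = \<zero>\<^bsub>E 0\<^esub>" using killed[of 0 "?v 0"] jn by (simp add: B_def)
      hence "\<epsilon> (\<rho> \<otimes> v 0) = \<epsilon> \<zero>" using \<epsilon>_smult[OF \<rho> vc] \<epsilon>_zero by simp
      hence "\<rho> \<otimes> v 0 = \<zero>" using inj_onD[OF \<epsilon>_inj] \<rho> vc by simp
      moreover have "d (regular_module R) i (\<lambda>_. \<zero>) k = \<zero>"
        using cobd_zero[OF module_regular, of i "\<lambda>_. \<zero>" k] k by simp
      ultimately show "d (regular_module R) i (\<lambda>_. \<zero>) k = \<rho> [^] Suc i \<otimes> v k"
        using True \<rho> by simp
    qed simp
  next
    case False
    have "\<exists>w\<in>{..<b i} \<rightarrow> Z 0. \<forall>k<b (Suc i). d (E 0) i w k = \<rho> [^] Suc (0 + i) \<odot>\<^bsub>E 0\<^esub> ?v k"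
      by (rule cocycle_bounds[OF res _ _ vZ dv']) (use False ij jn in auto)
    then obtain w where w: "w \<in> {..<b i} \<rightarrow> Z 0"
      "\<And>k. k < b (Suc i) \<Longrightarrow> d (E 0) i w k = \<rho> [^] Suc i \<odot>\<^bsub>E 0\<^esub> ?v k"
      unfolding add_0 by blast
    have "\<forall>k\<in>{..<b i}. \<exists>u. u \<in> carrier R \<and> \<epsilon> u = w k"
    proof
      fix k assume "k \<in> {..<b i}"
      hence "w k \<in> Z 0" using w(1) by blast
      hence "w k \<in> \<epsilon> ` carrier R" unfolding Z_0 .
      then obtain a where "w k = \<epsilon> a" "a \<in> carrier R" by (rule imageE)
      thus "\<exists>u. u \<in> carrier R \<and> \<epsilon> u = w k" by (intro exI[of _ a]) simp
    qed
    from bchoice[OF this] obtain u where "\<forall>k\<in>{..<b i}. u k \<in> carrier R \<and> \<epsilon> (u k) = w k" by (rule exE)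
    hence u: "\<And>k. k < b i \<Longrightarrow> u k \<in> carrier R" "\<And>k. k < b i \<Longrightarrow> \<epsilon> (u k) = w k" by simp_all
    have uc: "u \<in> {..<b i} \<rightarrow> carrier (regular_module R)" using u(1) by auto
    have wc: "w \<in> {..<b i} \<rightarrow> carrier (E 0)" using w(1) Z_iff by fast
    show ?thesis
    proof (rule bexI[of _ u], intro allI impI)
      fix k assume k: "k < b (Suc i)"
      have vc: "v k \<in> carrier R" using v k by auto
      have "\<epsilon> (d (regular_module R) i u k) = d (E 0) i (\<lambda>k. \<epsilon> (u k)) k"
        by (rule cobd_hom[OF module_regular E_module \<epsilon>_hom uc k])
      also have "\<dots> = d (E 0) i w k" by (rule cobd_cong[OF E_module _ wc k]) (rule u(2))
      also have "\<dots> = \<epsilon> (\<rho> [^] Suc i \<otimes> v k)"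
        using w(2)[OF k] \<epsilon>_smult[OF _ vc, of "\<rho> [^] Suc i"] \<rho> by simp
      finally show "d (regular_module R) i u k = \<rho> [^] Suc i \<otimes> v k"
        by (rule inj_onD[OF \<epsilon>_inj])
          (use cobd_closed[OF module_regular uc] k vc \<rho> in auto)
    qed (use uc in simp)
  qed
  then obtain u where u: "u \<in> {..<b i} \<rightarrow> carrier R"
    "\<And>k. k < b (Suc i) \<Longrightarrow> d (regular_module R) i u k = \<rho> [^] Suc i \<otimes> v k" by blast
  show "\<exists>u\<in>{..<b i} \<rightarrow> carrier R. \<forall>k<b (Suc i).
      d (regular_module R) i u k \<ominus> \<rho> [^] n \<otimes> v k \<in> {\<zero>}"
  proof (rule bexI[of _ "\<lambda>k. s \<otimes> u k"], intro allI impI)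
    fix k assume k: "k < b (Suc i)"
    have vc: "v k \<in> carrier R" using v k by auto
    have "d (regular_module R) i (\<lambda>k. s \<otimes> u k) k = s \<otimes> d (regular_module R) i u k"
      using cobd_smult[OF module_regular _ s(1) k, of u] u(1) by simp
    also have "\<dots> = \<rho> [^] n \<otimes> v k"
      using u(2)[OF k] m_assoc[OF s(1) _ vc, of "\<rho> [^] Suc i"] s(2) \<rho> by simp
    finally show "d (regular_module R) i (\<lambda>k. s \<otimes> u k) k \<ominus> \<rho> [^] n \<otimes> v k \<in> {\<zero>}"
      using vc \<rho> by (simp add: minus_eq r_neg)
  qed (use u(1) s(1) in auto)
qed

end

end

section \<open>Dimensions of associated primes\<close>

lemma (in cring) pow_nonzerodivisor_mod:
  assumes "x \<in> carrier R" "\<And>y. \<lbrakk>y \<in> carrier R; x \<otimes> y \<in> J\<rbrakk> \<Longrightarrow> y \<in> J" "y \<in> carrier R"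
    "x [^] (n::nat) \<otimes> y \<in> J"
  shows "y \<in> J"
  using assms(3,4)
proof (induction n arbitrary: y)
  case (Suc n)
  have "x [^] n \<otimes> (x \<otimes> y) \<in> J" using Suc.prems assms(1) by (simp add: m_assoc)
  hence "x \<otimes> y \<in> J" using Suc assms(1) by blast
  thus ?case using assms(2) Suc.prems by blast
qed simp

text \<open>The long exact sequence of \<open>0 \<rightarrow> R/J \<rightarrow> R/J \<rightarrow> R/(J + yR) \<rightarrow> 0\<close> in terms of cochains: \<open>Ext\<^sup>j\<close> of the
  quotient lies between \<open>Ext\<^sup>j\<close> and \<open>Ext\<^sup>j\<^sup>+\<^sup>1\<close> of \<open>R/J\<close>, whence the square of \<open>r\<close> and the loss of
  one degree. The resulting multiplier \<open>r\<^sup>2\<close> is the same for all \<open>y\<close>, in particular for all powers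
  of one element.\<close>
lemma (in cring) ext_killed_mod_nonzerodivisor:
  assumes J: "ideal J R" and r: "r \<in> carrier R" and y: "y \<in> carrier R"
    and nzd: "\<And>z. \<lbrakk>z \<in> carrier R; y \<otimes> z \<in> J\<rbrakk> \<Longrightarrow> z \<in> J"
    and killed: "ext_killed R \<mm> (Suc c) J r"
  shows "ext_killed R \<mm> c (adjoin R J y) (r \<otimes> r)"
  unfolding ext_killed_def
proof (intro allI impI ballI)
  fix l b A j v
  assume res: "cyclic_resolution R (ideal_pow R \<mm> l) b A" and j: "j \<le> c"
    and v: "v \<in> {..<b (Suc j)} \<rightarrow> carrier R"
    and dv: "\<forall>k<b (Suc (Suc j)). cobd b A (regular_module R) (Suc j) v k \<in> adjoin R J y"
  interpret J: ideal J R by (rule J)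
  interpret resolved_ideal R "ideal_pow R \<mm> l" b A by unfold_locales (rule res)
  let ?d = "d (regular_module R)"
  note dc = cobd_closed[OF module_regular, simplified]
  note dd = cobd_diff[OF module_regular, simplified]
  note ds = cobd_smult[OF module_regular, simplified]
  note dm = cobd_mem[OF module_regular submodule_regular_if_ideal[OF J]]
  have killed': "\<exists>u\<in>{..<b i} \<rightarrow> carrier R. \<forall>k<b (Suc i). ?d i u k \<ominus> r \<otimes> w k \<in> J"
    if "i \<le> Suc c" "w \<in> {..<b (Suc i)} \<rightarrow> carrier R" "\<And>k. k < b (Suc (Suc i)) \<Longrightarrow> ?d (Suc i) w k \<in> J" for i w
    using killed res that unfolding ext_killed_def by blast
  have dvc: "?d (Suc j) v \<in> {..<b (Suc (Suc j))} \<rightarrow> carrier R" by (rule dc[OF v])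
  have "\<forall>k\<in>{..<b (Suc (Suc j))}. \<exists>f. f \<in> carrier R \<and> ?d (Suc j) v k \<ominus> y \<otimes> f \<in> J"
  proof
    fix k assume k: "k \<in> {..<b (Suc (Suc j))}"
    then obtain i f where f: "i \<in> J" "f \<in> carrier R" "?d (Suc j) v k = i \<oplus> f \<otimes> y"
      using dv mem_adjoin by blast
    have "i \<in> carrier R" using f J.Icarr by blast
    hence "(i \<oplus> f \<otimes> y) \<ominus> y \<otimes> f = i" using f(2) y by algebra
    thus "\<exists>f. f \<in> carrier R \<and> ?d (Suc j) v k \<ominus> y \<otimes> f \<in> J" using f by auto
  qed
  from bchoice[OF this] obtain f where
    "\<forall>k\<in>{..<b (Suc (Suc j))}. f k \<in> carrier R \<and> ?d (Suc j) v k \<ominus> y \<otimes> f k \<in> J" by (rule exE)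
  hence fc: "f \<in> {..<b (Suc (Suc j))} \<rightarrow> carrier R"
    and f: "\<And>k. k < b (Suc (Suc j)) \<Longrightarrow> ?d (Suc j) v k \<ominus> y \<otimes> f k \<in> J" by auto
  have yf: "(\<lambda>k. y \<otimes> f k) \<in> {..<b (Suc (Suc j))} \<rightarrow> carrier R" using fc y by auto
  have df: "?d (Suc (Suc j)) f h \<in> J" if h: "h < b (Suc (Suc (Suc j)))" for h
  proof -
    have dfc: "?d (Suc (Suc j)) f h \<in> carrier R" using dc[OF fc] h by auto
    have "?d (Suc (Suc j)) (\<lambda>k. ?d (Suc j) v k \<ominus> y \<otimes> f k) h \<in> J"
      by (rule dm) (use f h in auto)
    moreover have "?d (Suc (Suc j)) (\<lambda>k. ?d (Suc j) v k \<ominus> y \<otimes> f k) h = \<zero> \<ominus> y \<otimes> ?d (Suc (Suc j)) f h"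
      using dd[OF dvc yf h] ds[OF fc y h] cobd_cobd[OF module_regular, of v "Suc j" h] v h by simp
    ultimately have "\<ominus> (\<zero> \<ominus> y \<otimes> ?d (Suc (Suc j)) f h) \<in> J" using J.a_inv_closed by metis
    moreover have "\<ominus> (\<zero> \<ominus> y \<otimes> ?d (Suc (Suc j)) f h) = y \<otimes> ?d (Suc (Suc j)) f h"
      using y dfc by algebra
    ultimately show ?thesis using nzd dfc by simp
  qed
  obtain g where g: "g \<in> {..<b (Suc j)} \<rightarrow> carrier R"
    "\<And>k. k < b (Suc (Suc j)) \<Longrightarrow> ?d (Suc j) g k \<ominus> r \<otimes> f k \<in> J"
    using killed'[of "Suc j" f] j fc df by auto
  let ?w = "\<lambda>i. r \<otimes> v i \<ominus> y \<otimes> g i"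
  have rv: "(\<lambda>i. r \<otimes> v i) \<in> {..<b (Suc j)} \<rightarrow> carrier R"
    and yg: "(\<lambda>i. y \<otimes> g i) \<in> {..<b (Suc j)} \<rightarrow> carrier R" using v g(1) r y by auto
  have wc: "?w \<in> {..<b (Suc j)} \<rightarrow> carrier R" using rv yg by (auto simp: Pi_iff)
  have dw: "?d (Suc j) ?w k \<in> J" if k: "k < b (Suc (Suc j))" for k
  proof -
    have c: "?d (Suc j) v k \<in> carrier R" "?d (Suc j) g k \<in> carrier R" "f k \<in> carrier R"
      using dc[OF v] dc[OF g(1)] fc k by auto
    have "?d (Suc j) ?w k = r \<otimes> ?d (Suc j) v k \<ominus> y \<otimes> ?d (Suc j) g k"
      using dd[OF rv yg k] ds[OF v r k] ds[OF g(1) y k] by simp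
    also have "\<dots> = r \<otimes> (?d (Suc j) v k \<ominus> y \<otimes> f k) \<ominus> y \<otimes> (?d (Suc j) g k \<ominus> r \<otimes> f k)"
      using c r y by algebra
    also have "\<dots> \<in> J"
      by (intro ideal_diff_closed[OF J] J.I_l_closed[OF f[OF k] r] J.I_l_closed[OF g(2)[OF k] y])
    finally show ?thesis .
  qed
  obtain u where u: "u \<in> {..<b j} \<rightarrow> carrier R"
    "\<And>k. k < b (Suc j) \<Longrightarrow> ?d j u k \<ominus> r \<otimes> ?w k \<in> J"
    using killed'[of j ?w] j wc dw by auto
  show "\<exists>u\<in>{..<b j} \<rightarrow> carrier R. \<forall>k<b (Suc j). ?d j u k \<ominus> r \<otimes> r \<otimes> v k \<in> adjoin R J y"
  proof (rule bexI[OF _ u(1)], intro allI impI)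
    fix k assume k: "k < b (Suc j)"
    have c: "?d j u k \<in> carrier R" "v k \<in> carrier R" "g k \<in> carrier R"
      using dc[OF u(1)] v g(1) k by auto
    have "?d j u k \<ominus> r \<otimes> r \<otimes> v k = (?d j u k \<ominus> r \<otimes> ?w k) \<oplus> (\<ominus> (r \<otimes> g k)) \<otimes> y"
      using c r y by algebra
    moreover have "\<ominus> (r \<otimes> g k) \<in> carrier R" using r c by simp
    ultimately show "?d j u k \<ominus> r \<otimes> r \<otimes> v k \<in> adjoin R J y" using u(2)[OF k] mem_adjoin by blast
  qed
qed

text \<open>Multiplication by \<open>t\<close> turns a cocycle modulo \<open>J'\<close> into a cocycle modulo \<open>J\<close>.\<close>
lemma (in cring) ext_killed_extend_ideal:
  assumes J: "ideal J R" and "J \<subseteq> J'" and t: "t \<in> carrier R" "\<And>z. z \<in> J' \<Longrightarrow> t \<otimes> z \<in> J"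
    and r: "r \<in> carrier R" and killed: "ext_killed R \<mm> c J r"
  shows "ext_killed R \<mm> c J' (r \<otimes> t)"
  unfolding ext_killed_def
proof (intro allI impI ballI)
  fix l b A j v
  assume res: "cyclic_resolution R (ideal_pow R \<mm> l) b A" and j: "j \<le> c"
    and v: "v \<in> {..<b (Suc j)} \<rightarrow> carrier R"
    and dv: "\<forall>k<b (Suc (Suc j)). cobd b A (regular_module R) (Suc j) v k \<in> J'"
  interpret resolved_ideal R "ideal_pow R \<mm> l" b A by unfold_locales (rule res)
  have tv: "(\<lambda>i. t \<otimes> v i) \<in> {..<b (Suc j)} \<rightarrow> carrier R" using v t(1) by auto
  have "\<forall>k<b (Suc (Suc j)). d (regular_module R) (Suc j) (\<lambda>i. t \<otimes> v i) k \<in> J"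
    using cobd_smult[OF module_regular, of v "Suc j" t] v t dv by auto
  then obtain u where u: "u \<in> {..<b j} \<rightarrow> carrier R"
    "\<And>k. k < b (Suc j) \<Longrightarrow> d (regular_module R) j u k \<ominus> r \<otimes> (t \<otimes> v k) \<in> J"
    using killed res j tv unfolding ext_killed_def by blast
  show "\<exists>u\<in>{..<b j} \<rightarrow> carrier R. \<forall>k<b (Suc j). d (regular_module R) j u k \<ominus> r \<otimes> t \<otimes> v k \<in> J'"
  proof (rule bexI[OF _ u(1)], intro allI impI)
    fix k assume k: "k < b (Suc j)"
    hence "r \<otimes> (t \<otimes> v k) = r \<otimes> t \<otimes> v k" using v r t(1) by (intro m_assoc[symmetric]) auto
    thus "d (regular_module R) j u k \<ominus> r \<otimes> t \<otimes> v k \<in> J'" using u(2)[OF k] assms(2) by auto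
  qed
qed

definition socle_free :: "('a, 'b) ring_scheme \<Rightarrow> 'a set \<Rightarrow> 'a set \<Rightarrow> bool" where
  "socle_free R \<mm> J \<longleftrightarrow> (\<forall>a\<in>carrier R. (\<forall>x\<in>\<mm>. x \<otimes>\<^bsub>R\<^esub> a \<in> J) \<longrightarrow> a \<in> J)"

context noetherian_local_ring
begin

text \<open>The quotient \<open>J'/J\<close> is the \<open>\<mm>\<close>-torsion of \<open>R/J\<close>. The ideals \<open>(J : \<mm>\<^sup>n)\<close> form an ascending chain, so
  a single power of \<open>\<mm>\<close> annihilates all torsion.\<close>
lemma obtain_saturation:
  assumes J: "ideal J R"
  obtains J' l where "ideal J' R" "J \<subseteq> J'" "socle_free R \<mm> J'"
    "\<And>a r. \<lbrakk>a \<in> J'; r \<in> ideal_pow R \<mm> l\<rbrakk> \<Longrightarrow> r \<otimes> a \<in> J"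
proof -
  interpret J: ideal J R by (rule J)
  note pow = ideal_ideal_pow[OF ideal_mm]
  define K where "K n = {a \<in> carrier R. \<forall>r\<in>ideal_pow R \<mm> n. r \<otimes> a \<in> J}" for n
  have K_ideal: "ideal (K n) R" for n
  proof (rule idealI')
    show "x \<oplus> y \<in> K n" if "x \<in> K n" "y \<in> K n" for x y
      using that ideal.Icarr[OF pow] by (auto simp: K_def r_distr)
    fix x a assume a: "a \<in> K n" and x: "x \<in> carrier R"
    have "r \<otimes> (x \<otimes> a) \<in> J" if r: "r \<in> ideal_pow R \<mm> n" for r
    proof -
      have "r \<otimes> (x \<otimes> a) = x \<otimes> (r \<otimes> a)"
        using ideal.Icarr[OF pow r] x a by (auto simp: K_def m_lcomm)
      thus ?thesis using a r x J.I_l_closed by (auto simp: K_def)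
    qed
    thus "x \<otimes> a \<in> K n" using a x by (simp add: K_def)
  qed (use ideal.Icarr[OF pow] in \<open>auto simp: K_def\<close>)
  have "K n \<subseteq> K (Suc n)" for n
    using ideal_pow_antimono[OF ideal_mm, of n "Suc n"] by (auto simp: K_def)
  from ascending_ideals_stationary[of K, OF K_ideal this]
  obtain l where l: "\<And>k. k \<ge> l \<Longrightarrow> K k = K l" by blast
  have socle: "socle_free R \<mm> (K l)"
    unfolding socle_free_def
  proof (intro ballI impI)
    fix a assume a: "a \<in> carrier R" and xa: "\<forall>x\<in>\<mm>. x \<otimes> a \<in> K l"
    have "ideal_pow R \<mm> (Suc l) \<subseteq> colon_ideal R J a"
      unfolding ideal_pow_simps
    proof (rule ideal_prod_subset[OF ideal_colon[OF J a]])
      fix i x assume ix: "i \<in> ideal_pow R \<mm> l" "x \<in> \<mm>"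
      have "i \<otimes> (x \<otimes> a) \<in> J" using xa ix by (auto simp: K_def)
      thus "i \<otimes> x \<in> colon_ideal R J a"
        using a ideal.Icarr[OF pow ix(1)] mm_subset ix(2) by (auto simp: colon_ideal_def m_assoc)
    qed
    hence "a \<in> K (Suc l)" using a by (auto simp: K_def colon_ideal_def)
    thus "a \<in> K l" using l[of "Suc l"] by simp
  qed
  have sub: "J \<subseteq> K l"
    using J.Icarr J.I_l_closed ideal.Icarr[OF pow] by (auto simp: K_def)
  show thesis by (rule that[OF K_ideal sub socle, of l]) (simp add: K_def)
qed

lemma prime_chain_to_mm:
  assumes "primeideal p R" "p \<noteq> \<mm>"
  shows "prime_chain R (\<lambda>i. if i = 0 then p else \<mm>) (Suc 0)"
  using assms primeideal_mm primeideal_subset_mm by (auto simp: prime_chain_def)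

lemma colon_ne_mm:
  assumes "socle_free R \<mm> J" "a \<in> carrier R" "primeideal (colon_ideal R J a) R"
  shows "colon_ideal R J a \<noteq> \<mm>" "a \<notin> J"
proof -
  show "a \<notin> J"
  proof
    assume "a \<in> J"
    hence "\<one> \<in> colon_ideal R J a" using assms(2) by (simp add: colon_ideal_def)
    thus False using primeideal_subset_mm[OF assms(3)] one_notin_mm by blast
  qed
  thus "colon_ideal R J a \<noteq> \<mm>" using assms(1,2) by (auto simp: socle_free_def colon_ideal_def)
qed

text \<open>In other words, \<open>dim R/p > c\<close> for every associated prime \<open>p\<close> of \<open>R/J\<close>. Let
  \<open>L = {z. p z \<subseteq> J}\<close> and let \<open>x \<in> \<mm>\<close> be a non-zerodivisor modulo \<open>J\<close>. Then \<open>L/(J + xL)\<close> embeds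
  into \<open>R/(J + xR)\<close>. If this module is not torsion, dividing the torsion out of \<open>R/(J + xR)\<close>
  leaves an associated prime that contains \<open>p\<close> and \<open>x\<close>, and induction applies. Otherwise
  \<open>L/(J + x\<^sup>nL)\<close> is torsion for all \<open>n\<close>, hence annihilated by a power of \<open>x\<close> not depending on \<open>n\<close>.
  This forces \<open>L \<subseteq> J + xL\<close>, so \<open>L \<subseteq> J\<close> by Nakayama's lemma.\<close>
lemma exists_prime_chain_above_associated_prime:
  assumes "ideal J R" "socle_free R \<mm> J" "\<And>x. x \<in> \<mm> \<Longrightarrow> \<exists>t::nat. ext_killed R \<mm> c J (x [^] t)"
    "a \<in> carrier R" "primeideal (colon_ideal R J a) R"
  shows "\<exists>P. prime_chain R P (Suc c) \<and> P 0 = colon_ideal R J a"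
  using assms
proof (induction c arbitrary: J a)
  case 0
  have "colon_ideal R J a \<noteq> \<mm>" using colon_ne_mm(1)[OF 0(2,4,5)] .
  from prime_chain_to_mm[OF 0(5) this] show ?case
    by (intro exI[of _ "\<lambda>i. if i = 0 then colon_ideal R J a else \<mm>"]) simp
next
  case (Suc c)
  note J = Suc.prems(1) and prime = Suc.prems(5) and a = Suc.prems(4)
  interpret J: ideal J R by (rule J)
  let ?p = "colon_ideal R J a"
  have a_notin: "a \<notin> J" using colon_ne_mm(2)[OF Suc.prems(2,4,5)] .
  obtain x where x: "x \<in> \<mm>" and nzd: "\<And>y. \<lbrakk>y \<in> carrier R; x \<otimes> y \<in> J\<rbrakk> \<Longrightarrow> y \<in> J"
    using exists_nonzerodivisor_mod[OF J] Suc.prems(2) unfolding socle_free_def by blast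
  have xc: "x \<in> carrier R" using x mm_subset by blast
  have nzd_pow: "y \<in> J" if "y \<in> carrier R" "x [^] n \<otimes> y \<in> J" for y and n :: nat
    by (rule pow_nonzerodivisor_mod[OF xc _ that]) (rule nzd)
  let ?J1 = "adjoin R J x"
  note J1 = ideal_adjoin[OF J xc]
  obtain J2 l where J2: "ideal J2 R" "?J1 \<subseteq> J2" "socle_free R \<mm> J2"
    and l: "\<And>a r. \<lbrakk>a \<in> J2; r \<in> ideal_pow R \<mm> l\<rbrakk> \<Longrightarrow> r \<otimes> a \<in> ?J1"
    using obtain_saturation[OF J1(1)] by blast
  define L where "L = {z \<in> carrier R. \<forall>q\<in>?p. q \<otimes> z \<in> J}"
  have L_mult: "q \<otimes> z \<in> J" if "z \<in> L" "q \<in> ?p" for q z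
    using that unfolding L_def by blast
  have pc: "q \<in> carrier R" if "q \<in> ?p" for q using that by (simp add: colon_ideal_def)
  have aL: "a \<in> L" using a by (auto simp: L_def colon_ideal_def)
  have L_quot: "f \<in> L" if f: "f \<in> carrier R" "\<And>q. q \<in> ?p \<Longrightarrow> q \<otimes> (f \<otimes> x) \<in> J" for f
  proof -
    have "q \<otimes> f \<in> J" if q: "q \<in> ?p" for q
    proof -
      have "x \<otimes> (q \<otimes> f) = q \<otimes> (f \<otimes> x)" using f(1) xc pc[OF q] by algebra
      thus ?thesis using nzd[of "q \<otimes> f"] f q pc by auto
    qed
    thus ?thesis using f(1) by (simp add: L_def)
  qed
  show ?case
  proof (cases "L \<subseteq> J2")
    case False
    then obtain y where y: "y \<in> L" "y \<notin> J2" by blast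
    have yc: "y \<in> carrier R" using y by (simp add: L_def)
    obtain r where r: "r \<in> carrier R" "r \<otimes> y \<notin> J2" "primeideal (colon_ideal R J2 (r \<otimes> y)) R"
      using exists_prime_colon[OF is_cring J2(1) yc y(2)] by blast
    let ?q = "colon_ideal R J2 (r \<otimes> y)"
    have "?p \<subseteq> ?q"
    proof
      fix s assume s: "s \<in> ?p"
      have "s \<otimes> (r \<otimes> y) = r \<otimes> (s \<otimes> y)" using pc[OF s] r(1) yc by algebra
      moreover have "r \<otimes> (s \<otimes> y) \<in> J" by (rule J.I_l_closed[OF L_mult[OF y(1) s] r(1)])
      ultimately have "s \<otimes> (r \<otimes> y) \<in> J2" using J1(2) J2(2) by auto
      thus "s \<in> ?q" using pc[OF s] by (simp add: colon_ideal_def)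
    qed
    moreover have "x \<in> ?q"
    proof -
      have "x \<otimes> (r \<otimes> y) \<in> J2" using J1(3) J2 ideal.I_r_closed[OF J2(1)] r yc by blast
      thus ?thesis using xc by (simp add: colon_ideal_def)
    qed
    moreover have "x \<notin> ?p" using nzd[OF a] a_notin by (auto simp: colon_ideal_def)
    ultimately have pq: "?p \<subset> ?q" by blast
    have "\<exists>P. prime_chain R P (Suc c) \<and> P 0 = ?q"
    proof (rule Suc.IH[OF J2(1,3) _ _ r(3)])
      fix z assume z: "z \<in> \<mm>"
      have zc: "z \<in> carrier R" using z mm_subset by blast
      obtain t :: nat where "ext_killed R \<mm> (Suc c) J (z [^] t)" using Suc.prems(3)[OF z] by blast
      hence "ext_killed R \<mm> c ?J1 (z [^] t \<otimes> z [^] t)"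
        using ext_killed_mod_nonzerodivisor[OF J _ xc nzd] zc by blast
      hence "ext_killed R \<mm> c J2 (z [^] t \<otimes> z [^] t \<otimes> z [^] l)"
        by (intro ext_killed_extend_ideal[OF J1(1) J2(2)])
          (use zc l pow_mem_ideal_pow[OF ideal_mm z] in auto)
      hence "ext_killed R \<mm> c J2 (z [^] (t + t + l))" using zc by (simp add: nat_pow_mult)
      thus "\<exists>t::nat. ext_killed R \<mm> c J2 (z [^] t)" by blast
    qed (use r yc in simp)
    then obtain P where P: "prime_chain R P (Suc c)" "P 0 = ?q" by blast
    have "prime_chain R (case_nat ?p P) (Suc (Suc c))"
      using P pq prime unfolding prime_chain_def by (auto split: nat.splits)
    thus ?thesis by (intro exI[of _ "case_nat ?p P"]) simp
  next
    case True
    define D where "D n = {j \<oplus> w \<otimes> x [^] n | j w. j \<in> J \<and> w \<in> L}" for n :: nat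
    have L_ideal: "ideal L R"
    proof (rule idealI')
      show "s \<oplus> t \<in> L" if "s \<in> L" "t \<in> L" for s t using that pc by (auto simp: L_def r_distr)
      fix t s assume st: "t \<in> carrier R" "s \<in> L"
      have "q \<otimes> (t \<otimes> s) \<in> J" if q: "q \<in> ?p" for q
      proof -
        have "q \<otimes> (t \<otimes> s) = t \<otimes> (q \<otimes> s)" using pc[OF q] st by (auto simp: L_def m_lcomm)
        thus ?thesis using J.I_l_closed[OF L_mult[OF st(2) q] st(1)] by simp
      qed
      thus "t \<otimes> s \<in> L" using st by (simp add: L_def)
    qed (use pc in \<open>auto simp: L_def\<close>)
    interpret L: ideal L R by (rule L_ideal)
    have D_add: "s \<oplus> t \<in> D n" if st: "s \<in> D n" "t \<in> D n" for s t n
    proof -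
      obtain i w i' w' where iw: "i \<in> J" "w \<in> L" "s = i \<oplus> w \<otimes> x [^] n"
        "i' \<in> J" "w' \<in> L" "t = i' \<oplus> w' \<otimes> x [^] n" using st unfolding D_def by blast
      have "s \<oplus> t = (i \<oplus> i') \<oplus> (w \<oplus> w') \<otimes> x [^] n"
        using iw J.Icarr[OF iw(1)] J.Icarr[OF iw(4)] L.Icarr[OF iw(2)] L.Icarr[OF iw(5)]
          nat_pow_closed[OF xc, of n] by algebra
      thus ?thesis unfolding D_def using J.a_closed[OF iw(1,4)] L.a_closed[OF iw(2,5)] by blast
    qed
    have D_carrier: "D n \<subseteq> carrier R" for n using J.Icarr L.Icarr xc by (auto simp: D_def)
    have powers: "\<exists>k. \<forall>r\<in>ideal_pow R \<mm> k. \<forall>z\<in>L. r \<otimes> z \<in> D n" for n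
    proof (induction n)
      case 0
      have "r \<otimes> z \<in> D 0" if "r \<in> carrier R" "z \<in> L" for r z
      proof -
        have "r \<otimes> z = \<zero> \<oplus> (r \<otimes> z) \<otimes> x [^] (0::nat)" using that L.Icarr by simp
        thus ?thesis unfolding D_def using J.zero_closed L.I_l_closed[OF that(2,1)] by blast
      qed
      thus ?case using ideal_pow_simps(1) by (metis)
    next
      case (Suc n)
      then obtain k where k: "\<And>r z. \<lbrakk>r \<in> ideal_pow R \<mm> k; z \<in> L\<rbrakk> \<Longrightarrow> r \<otimes> z \<in> D n" by blast
      note pow = ideal_ideal_pow[OF ideal_mm]
      have prod_in_D: "r2 \<otimes> r1 \<otimes> z \<in> D (Suc n)"
        if r: "r2 \<in> ideal_pow R \<mm> l" "r1 \<in> ideal_pow R \<mm> k" and z: "z \<in> L" for r1 r2 z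
      proof -
        have rc: "r1 \<in> carrier R" "r2 \<in> carrier R" using r ideal.Icarr[OF pow] by blast+
        obtain i w where iw: "i \<in> J" "w \<in> L" "r1 \<otimes> z = i \<oplus> w \<otimes> x [^] n"
          using k[OF r(2) z] unfolding D_def by blast
        have "r2 \<otimes> w \<in> ?J1" using l r(1) iw(2) True by blast
        then obtain i' f where f: "i' \<in> J" "f \<in> carrier R" "r2 \<otimes> w = i' \<oplus> f \<otimes> x"
          using mem_adjoin by blast
        have c: "i \<in> carrier R" "i' \<in> carrier R" "w \<in> carrier R" "z \<in> carrier R" "x [^] n \<in> carrier R"
          using J.Icarr iw f L.Icarr z xc by auto
        have fL: "f \<in> L"
        proof (rule L_quot[OF f(2)])
          fix q assume q: "q \<in> ?p"
          have "q \<otimes> (f \<otimes> x) = q \<otimes> ((i' \<oplus> f \<otimes> x) \<ominus> i')"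
            using c(2) f(2) xc pc[OF q] by algebra
          also have "\<dots> = r2 \<otimes> (q \<otimes> w) \<ominus> q \<otimes> i'"
            unfolding f(3)[symmetric] using c(2,3) rc(2) pc[OF q] by algebra
          also have "\<dots> \<in> J"
          proof (intro ideal_diff_closed[OF J])
            have "q \<otimes> w \<in> J" by (rule L_mult[OF iw(2) q])
            thus "r2 \<otimes> (q \<otimes> w) \<in> J" using rc(2) by (rule J.I_l_closed)
            show "q \<otimes> i' \<in> J" using f(1) pc[OF q] by (rule J.I_l_closed)
          qed
          finally show "q \<otimes> (f \<otimes> x) \<in> J" .
        qed
        have "r2 \<otimes> r1 \<otimes> z = r2 \<otimes> (i \<oplus> w \<otimes> x [^] n)" using iw(3) rc c m_assoc by simp
        also have "\<dots> = r2 \<otimes> i \<oplus> (r2 \<otimes> w) \<otimes> x [^] n" using rc c by algebra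
        also have "\<dots> = (r2 \<otimes> i \<oplus> x [^] n \<otimes> i') \<oplus> f \<otimes> x [^] Suc n"
          unfolding f(3) nat_pow_Suc using rc c f(2) xc by algebra
        finally show ?thesis
          unfolding D_def using J.a_closed J.I_l_closed[OF iw(1) rc(2)] J.I_l_closed[OF f(1) c(5)] fL by blast
      qed
      have "r \<otimes> z \<in> D (Suc n)" if r: "r \<in> ideal_pow R \<mm> (l + k)" and z: "z \<in> L" for r z
      proof -
        have zc: "z \<in> carrier R" using z L.Icarr by blast
        have "r \<in> ideal_pow R \<mm> l \<cdot> ideal_pow R \<mm> k" using r ideal_pow_add[OF ideal_mm] by simp
        hence "r \<in> carrier R \<and> r \<otimes> z \<in> D (Suc n)"
        proof induction
          case (prod i j)
          thus ?case using prod_in_D[OF prod z] ideal.Icarr[OF pow prod(1)] ideal.Icarr[OF pow prod(2)]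
            by simp
        next
          case (sum s1 s2)
          thus ?case using D_add zc by (simp add: l_distr)
        qed
        thus ?thesis by blast
      qed
      thus ?case by blast
    qed
    obtain t :: nat where t: "ext_killed R \<mm> (Suc c) J (x [^] t)" using Suc.prems(3)[OF x] by blast
    \<comment> \<open>The multiplier \<open>x\<^sup>t x\<^sup>t\<close> works modulo \<open>x\<^sup>n\<close> for every \<open>n\<close>; for \<open>n = 2 t + 1\<close>, cancelling it
      leaves one factor \<open>x\<close>.\<close>
    let ?n = "Suc (t + t)"
    let ?J3 = "adjoin R J (x [^] ?n)"
    have xt: "x [^] k \<in> carrier R" for k :: nat using xc by simp
    have killed: "ext_killed R \<mm> c ?J3 (x [^] t \<otimes> x [^] t)"
      by (rule ext_killed_mod_nonzerodivisor[OF J xt xt _ t]) (rule nzd_pow)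
    obtain k where k: "\<And>r z. \<lbrakk>r \<in> ideal_pow R \<mm> k; z \<in> L\<rbrakk> \<Longrightarrow> r \<otimes> z \<in> D ?n"
      using powers[of ?n] by blast
    \<comment> \<open>Since \<open>\<mm>\<^sup>k L \<subseteq> J + x\<^sup>nL\<close>, each \<open>z \<in> L\<close> defines a homomorphism from \<open>R/\<mm>\<^sup>k\<close> to \<open>R/(J + x\<^sup>nR)\<close>, that
      is, a cocycle in the lowest degree.\<close>
    have D_J3: "D ?n \<subseteq> ?J3" unfolding D_def using mem_adjoin L.Icarr by blast
    obtain b A where res: "cyclic_resolution R (ideal_pow R \<mm> k) b A"
      using exists_cyclic_resolution[OF is_cring ideal_ideal_pow[OF ideal_mm]] by blast
    interpret resolved_ideal R "ideal_pow R \<mm> k" b A by unfold_locales (rule res)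
    have "L \<subseteq> J"
    proof (rule divisible_subset_ideal[OF J _ x])
      show "L \<subseteq> carrier R" using L.Icarr by blast
      fix z assume z: "z \<in> L"
      have zc: "z \<in> carrier R" using z L.Icarr by blast
      have cocycle: "\<forall>h<b (Suc (Suc 0)). d (regular_module R) (Suc 0) (\<lambda>_. z) h \<in> ?J3"
      proof (intro allI impI)
        fix h assume h: "h < b (Suc (Suc 0))"
        have "d (regular_module R) (Suc 0) (\<lambda>_. z) h = A 1 h 0 \<otimes> z"
          using cobd_1[OF module_regular, of "\<lambda>_. z" h] zc h by (simp add: numeral_2_eq_2)
        moreover have "A 1 h 0 \<in> ideal_pow R \<mm> k" using A_1_mem h by (simp add: numeral_2_eq_2)
        ultimately show "d (regular_module R) (Suc 0) (\<lambda>_. z) h \<in> ?J3" using k[OF _ z] D_J3 by auto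
      qed
      have "\<exists>u\<in>{..<b 0} \<rightarrow> carrier R. \<forall>h<b (Suc 0).
          d (regular_module R) 0 u h \<ominus> x [^] t \<otimes> x [^] t \<otimes> z \<in> ?J3"
        using killed[unfolded ext_killed_def, rule_format, OF res, of 0 "\<lambda>_. z"] cocycle zc by blast
      then obtain u where u: "d (regular_module R) 0 u 0 \<ominus> x [^] t \<otimes> x [^] t \<otimes> z \<in> ?J3"
        using b_1 by auto
      have "d (regular_module R) 0 u 0 = \<zero>" using cobd_zero[OF module_regular, of 0 u 0] b_0 b_1 by simp
      then obtain i f where f: "i \<in> J" "f \<in> carrier R"
        "\<zero> \<ominus> x [^] t \<otimes> x [^] t \<otimes> z = i \<oplus> f \<otimes> x [^] ?n" using u mem_adjoin by auto
      have ic: "i \<in> carrier R" using f J.Icarr by blast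
      let ?s = "x [^] (t + t)"
      have sc: "?s \<in> carrier R" using xc by simp
      have eq: "\<zero> \<ominus> ?s \<otimes> z = i \<oplus> f \<otimes> (?s \<otimes> x)" using f(3) xc by (simp add: nat_pow_mult)
      have "?s \<otimes> (z \<ominus> x \<otimes> (\<ominus> f)) = \<ominus> ((\<zero> \<ominus> ?s \<otimes> z) \<ominus> f \<otimes> (?s \<otimes> x))"
        using sc zc xc f(2) by algebra
      also have "\<dots> = \<ominus> ((i \<oplus> f \<otimes> (?s \<otimes> x)) \<ominus> f \<otimes> (?s \<otimes> x))" by (simp only: eq)
      also have "\<dots> = \<ominus> i" using ic f(2) sc xc by algebra
      finally have "?s \<otimes> (z \<ominus> x \<otimes> (\<ominus> f)) \<in> J" using f(1) J.a_inv_closed by simp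
      hence zf: "z \<ominus> x \<otimes> (\<ominus> f) \<in> J" by (rule nzd_pow[rotated]) (use zc xc f(2) in simp)
      have "\<ominus> f \<in> L"
      proof (rule L_quot)
        show "\<ominus> f \<in> carrier R" using f(2) by simp
        fix q assume q: "q \<in> ?p"
        have "q \<otimes> (\<ominus> f \<otimes> x) = q \<otimes> z \<ominus> q \<otimes> (z \<ominus> x \<otimes> (\<ominus> f))"
          using pc[OF q] zc xc f(2) by algebra
        moreover have "q \<otimes> z \<in> J" by (rule L_mult[OF z q])
        moreover have "q \<otimes> (z \<ominus> x \<otimes> (\<ominus> f)) \<in> J" using zf pc[OF q] J.I_l_closed by blast
        ultimately show "q \<otimes> (\<ominus> f \<otimes> x) \<in> J" using ideal_diff_closed[OF J] by metis
      qed
      thus "\<exists>y'\<in>L. z \<ominus> x \<otimes> y' \<in> J" using zf by blast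
    qed
    thus ?thesis using aL a_notin by blast
  qed
qed

end

section \<open>The total quotient ring and the normalization\<close>

lemma (in cring) mem_principal:
  assumes "s \<in> carrier R"
  shows "z \<in> adjoin R {\<zero>} s \<longleftrightarrow> (\<exists>c\<in>carrier R. z = c \<otimes> s)"
  using assms by (auto simp: mem_adjoin)

context cring
begin

lemma nonzerodivisors_closed: "s \<in> nonzerodivisors R \<Longrightarrow> s \<in> carrier R"
  by (simp add: nonzerodivisors_def)

lemma nonzerodivisor_cancel:
  assumes "s \<in> nonzerodivisors R" "x \<in> carrier R" "y \<in> carrier R" "s \<otimes> x = s \<otimes> y"
  shows "x = y"
proof -
  have s: "s \<in> carrier R" using assms nonzerodivisors_closed by blast
  have "s \<otimes> (x \<ominus> y) = s \<otimes> x \<ominus> s \<otimes> y" using s assms(2,3) by algebra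
  also have "\<dots> = \<zero>" using assms s by (simp add: minus_eq r_neg)
  finally have "x \<ominus> y = \<zero>" using assms(1-3) by (simp add: nonzerodivisors_def)
  thus ?thesis using assms(2,3) by simp
qed

lemma one_nonzerodivisor: "\<one> \<in> nonzerodivisors R"
  by (simp add: nonzerodivisors_def)

lemma mult_nonzerodivisors:
  assumes "s \<in> nonzerodivisors R" "t \<in> nonzerodivisors R"
  shows "s \<otimes> t \<in> nonzerodivisors R"
proof -
  have c: "s \<in> carrier R" "t \<in> carrier R" using assms nonzerodivisors_closed by auto
  have "x = \<zero>" if x: "x \<in> carrier R" "(s \<otimes> t) \<otimes> x = \<zero>" for x
  proof -
    have "s \<otimes> (t \<otimes> x) = \<zero>" using x c by (simp add: m_assoc)
    hence "t \<otimes> x = \<zero>" using assms(1) c x(1) unfolding nonzerodivisors_def by blast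
    thus ?thesis using assms(2) x(1) unfolding nonzerodivisors_def by blast
  qed
  thus ?thesis using c unfolding nonzerodivisors_def by blast
qed

lemma pow_nonzerodivisors: "s \<in> nonzerodivisors R \<Longrightarrow> s [^] (n::nat) \<in> nonzerodivisors R"
  by (induction n) (auto intro: one_nonzerodivisor mult_nonzerodivisors)

lemma mem_fraction:
  "(b, t) \<in> fraction R a s \<longleftrightarrow> b \<in> carrier R \<and> t \<in> nonzerodivisors R \<and> a \<otimes> t = b \<otimes> s"
  by (simp add: fraction_def)

lemma fraction_self: "\<lbrakk>a \<in> carrier R; s \<in> nonzerodivisors R\<rbrakk> \<Longrightarrow> (a, s) \<in> fraction R a s"
  by (simp add: mem_fraction)

lemma fraction_eq_iff:
  assumes "a \<in> carrier R" "s \<in> nonzerodivisors R" "b \<in> carrier R" "t \<in> nonzerodivisors R"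
  shows "fraction R a s = fraction R b t \<longleftrightarrow> a \<otimes> t = b \<otimes> s"
proof
  assume "fraction R a s = fraction R b t"
  hence "(a, s) \<in> fraction R b t" using fraction_self assms by metis
  thus "a \<otimes> t = b \<otimes> s" by (simp add: mem_fraction)
next
  note c = assms(1,3) nonzerodivisors_closed[OF assms(2)] nonzerodivisors_closed[OF assms(4)]
  assume eq: "a \<otimes> t = b \<otimes> s"
  have "a \<otimes> u = x \<otimes> s \<longleftrightarrow> b \<otimes> u = x \<otimes> t" if x: "x \<in> carrier R" and u: "u \<in> nonzerodivisors R" for x u
  proof -
    have uc: "u \<in> carrier R" using nonzerodivisors_closed u .
    have "t \<otimes> (a \<otimes> u) = (a \<otimes> t) \<otimes> u" using c uc by algebra
    hence 1: "t \<otimes> (a \<otimes> u) = s \<otimes> (b \<otimes> u)" unfolding eq using c uc by algebra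
    show ?thesis
    proof
      assume "a \<otimes> u = x \<otimes> s"
      hence "s \<otimes> (b \<otimes> u) = t \<otimes> (x \<otimes> s)" using 1 by simp
      also have "\<dots> = s \<otimes> (x \<otimes> t)" using c x by algebra
      finally show "b \<otimes> u = x \<otimes> t" using nonzerodivisor_cancel[OF assms(2)] c uc x by simp
    next
      assume "b \<otimes> u = x \<otimes> t"
      hence "t \<otimes> (a \<otimes> u) = s \<otimes> (x \<otimes> t)" using 1 by simp
      also have "\<dots> = t \<otimes> (x \<otimes> s)" using c x by algebra
      finally show "a \<otimes> u = x \<otimes> s" using nonzerodivisor_cancel[OF assms(4)] c uc x by simp
    qed
  qed
  thus "fraction R a s = fraction R b t" by (auto simp: fraction_def)
qed

abbreviation Q where "Q \<equiv> total_quotient_ring R"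

lemma Q_carrier: "carrier Q = {fraction R a s | a s. a \<in> carrier R \<and> s \<in> nonzerodivisors R}"
  and Q_zero: "\<zero>\<^bsub>Q\<^esub> = fraction R \<zero> \<one>" and Q_one: "\<one>\<^bsub>Q\<^esub> = fraction R \<one> \<one>"
  by (simp_all add: total_quotient_ring_def)

lemma fraction_closed: "\<lbrakk>a \<in> carrier R; s \<in> nonzerodivisors R\<rbrakk> \<Longrightarrow> fraction R a s \<in> carrier Q"
  by (auto simp: Q_carrier)

lemma Q_cases:
  assumes "q \<in> carrier Q"
  obtains a s where "a \<in> carrier R" "s \<in> nonzerodivisors R" "q = fraction R a s"
  using assms by (auto simp: Q_carrier)

text \<open>The operations of the total quotient ring are unions over all representatives; all members
  of such a union agree.\<close>
lemma UN_representatives: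
  assumes "(a, s) \<in> X" "\<And>a' s'. (a', s') \<in> X \<Longrightarrow> f a' s' = Y"
  shows "(\<Union>(a, s)\<in>X. f a s) = Y"
  using assms by (intro UN_constant_eq[of "(a, s)"]) auto

lemma Q_mult:
  assumes a: "a \<in> carrier R" "s \<in> nonzerodivisors R" and b: "b \<in> carrier R" "t \<in> nonzerodivisors R"
  shows "fraction R a s \<otimes>\<^bsub>Q\<^esub> fraction R b t = fraction R (a \<otimes> b) (s \<otimes> t)"
proof -
  have "fraction R (a' \<otimes> b') (s' \<otimes> t') = fraction R (a \<otimes> b) (s \<otimes> t)"
    if "(a', s') \<in> fraction R a s" "(b', t') \<in> fraction R b t" for a' s' b' t'
  proof -
    have a': "a' \<in> carrier R" "s' \<in> nonzerodivisors R" "a \<otimes> s' = a' \<otimes> s"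
      and b': "b' \<in> carrier R" "t' \<in> nonzerodivisors R" "b \<otimes> t' = b' \<otimes> t"
      using that by (auto simp: mem_fraction)
    note c = a(1) b(1) a'(1) b'(1) nonzerodivisors_closed[OF a(2)] nonzerodivisors_closed[OF b(2)]
      nonzerodivisors_closed[OF a'(2)] nonzerodivisors_closed[OF b'(2)]
    have "(a' \<otimes> b') \<otimes> (s \<otimes> t) = (a' \<otimes> s) \<otimes> (b' \<otimes> t)" using c by (simp add: m_ac)
    also have "\<dots> = (a \<otimes> s') \<otimes> (b \<otimes> t')" using a'(3) b'(3) by simp
    also have "\<dots> = (a \<otimes> b) \<otimes> (s' \<otimes> t')" using c by (simp add: m_ac)
    finally show ?thesis
      using fraction_eq_iff[of "a' \<otimes> b'" "s' \<otimes> t'" "a \<otimes> b" "s \<otimes> t"] c a b a' b' mult_nonzerodivisors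
      by simp
  qed
  thus ?thesis unfolding total_quotient_ring_def
    by (simp, intro UN_representatives[OF fraction_self] a b) blast
qed

lemma Q_add:
  assumes a: "a \<in> carrier R" "s \<in> nonzerodivisors R" and b: "b \<in> carrier R" "t \<in> nonzerodivisors R"
  shows "fraction R a s \<oplus>\<^bsub>Q\<^esub> fraction R b t = fraction R (a \<otimes> t \<oplus> b \<otimes> s) (s \<otimes> t)"
proof -
  have "fraction R (a' \<otimes> t' \<oplus> b' \<otimes> s') (s' \<otimes> t') = fraction R (a \<otimes> t \<oplus> b \<otimes> s) (s \<otimes> t)"
    if "(a', s') \<in> fraction R a s" "(b', t') \<in> fraction R b t" for a' s' b' t'
  proof -
    have a': "a' \<in> carrier R" "s' \<in> nonzerodivisors R" "a \<otimes> s' = a' \<otimes> s"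
      and b': "b' \<in> carrier R" "t' \<in> nonzerodivisors R" "b \<otimes> t' = b' \<otimes> t"
      using that by (auto simp: mem_fraction)
    note c = a(1) b(1) a'(1) b'(1) nonzerodivisors_closed[OF a(2)] nonzerodivisors_closed[OF b(2)]
      nonzerodivisors_closed[OF a'(2)] nonzerodivisors_closed[OF b'(2)]
    have "(a' \<otimes> t' \<oplus> b' \<otimes> s') \<otimes> (s \<otimes> t) = (a' \<otimes> s) \<otimes> (t' \<otimes> t) \<oplus> (b' \<otimes> t) \<otimes> (s' \<otimes> s)"
      using c by algebra
    also have "\<dots> = (a \<otimes> s') \<otimes> (t' \<otimes> t) \<oplus> (b \<otimes> t') \<otimes> (s' \<otimes> s)" using a'(3) b'(3) by simp
    also have "\<dots> = (a \<otimes> t \<oplus> b \<otimes> s) \<otimes> (s' \<otimes> t')" using c by algebra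
    finally show ?thesis
      using fraction_eq_iff[of "a' \<otimes> t' \<oplus> b' \<otimes> s'" "s' \<otimes> t'" "a \<otimes> t \<oplus> b \<otimes> s" "s \<otimes> t"]
        c a b a' b' mult_nonzerodivisors by simp
  qed
  thus ?thesis unfolding total_quotient_ring_def
    by (simp, intro UN_representatives[OF fraction_self] a b) blast
qed

lemma Q_smult:
  assumes r: "r \<in> carrier R" and a: "a \<in> carrier R" "s \<in> nonzerodivisors R"
  shows "r \<odot>\<^bsub>Q\<^esub> fraction R a s = fraction R (r \<otimes> a) s"
proof -
  have "fraction R (r \<otimes> a') s' = fraction R (r \<otimes> a) s" if "(a', s') \<in> fraction R a s" for a' s'
  proof -
    have a': "a' \<in> carrier R" "s' \<in> nonzerodivisors R" "a \<otimes> s' = a' \<otimes> s"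
      using that by (auto simp: mem_fraction)
    note c = a(1) a'(1) nonzerodivisors_closed[OF a(2)] nonzerodivisors_closed[OF a'(2)]
    have "(r \<otimes> a') \<otimes> s = (r \<otimes> a) \<otimes> s'" using c r a'(3) by (simp add: m_assoc)
    thus ?thesis using fraction_eq_iff[of "r \<otimes> a'" s' "r \<otimes> a" s] r a a' by simp
  qed
  thus ?thesis unfolding total_quotient_ring_def
    by (simp, intro UN_representatives[OF fraction_self] a)
qed

lemma fraction_eqI:
  assumes "a \<otimes> t = b \<otimes> s" "a \<in> carrier R" "s \<in> nonzerodivisors R" "b \<in> carrier R" "t \<in> nonzerodivisors R"
  shows "fraction R a s = fraction R b t"
  using fraction_eq_iff assms by blast

lemma fraction_zero: "s \<in> nonzerodivisors R \<Longrightarrow> fraction R \<zero> s = \<zero>\<^bsub>Q\<^esub>"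
  unfolding Q_zero by (rule fraction_eqI) (auto simp: nonzerodivisors_closed one_nonzerodivisor)

lemma fraction_add:
  assumes "a \<in> carrier R" "b \<in> carrier R" "s \<in> nonzerodivisors R"
  shows "fraction R (a \<oplus> b) s = fraction R a s \<oplus>\<^bsub>Q\<^esub> fraction R b s"
  unfolding Q_add[OF assms(1,3,2,3)]
proof (rule fraction_eqI)
  note c = assms(1,2) nonzerodivisors_closed[OF assms(3)]
  show "(a \<oplus> b) \<otimes> (s \<otimes> s) = (a \<otimes> s \<oplus> b \<otimes> s) \<otimes> s" using c by algebra
qed (use assms mult_nonzerodivisors nonzerodivisors_closed[OF assms(3)] in auto)

lemma Q_common_denominator:
  assumes "p \<in> carrier Q" "q \<in> carrier Q"
  obtains a b s where "a \<in> carrier R" "b \<in> carrier R" "s \<in> nonzerodivisors R"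
    "p = fraction R a s" "q = fraction R b s"
proof -
  obtain a s where a: "a \<in> carrier R" "s \<in> nonzerodivisors R" "p = fraction R a s"
    using Q_cases[OF assms(1)] .
  obtain b t where b: "b \<in> carrier R" "t \<in> nonzerodivisors R" "q = fraction R b t"
    using Q_cases[OF assms(2)] .
  note c = a(1) b(1) nonzerodivisors_closed[OF a(2)] nonzerodivisors_closed[OF b(2)]
  have "p = fraction R (a \<otimes> t) (s \<otimes> t)"
    unfolding a(3) by (rule fraction_eqI) (use a b c mult_nonzerodivisors in \<open>auto simp: m_ac\<close>)
  moreover have "q = fraction R (b \<otimes> s) (s \<otimes> t)"
    unfolding b(3) by (rule fraction_eqI) (use a b c mult_nonzerodivisors in \<open>auto simp: m_ac\<close>)
  ultimately show thesis using that[of "a \<otimes> t" "b \<otimes> s" "s \<otimes> t"] a b c mult_nonzerodivisors by auto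
qed

lemma Q_abelian_group: "abelian_group Q"
proof (rule abelian_groupI)
  show add_closed: "x \<oplus>\<^bsub>Q\<^esub> y \<in> carrier Q" if "x \<in> carrier Q" "y \<in> carrier Q" for x y
    using that by (rule Q_common_denominator) (simp add: fraction_add[symmetric] fraction_closed)
  show "\<zero>\<^bsub>Q\<^esub> \<in> carrier Q" by (simp add: Q_zero fraction_closed one_nonzerodivisor)
  show "x \<oplus>\<^bsub>Q\<^esub> y = y \<oplus>\<^bsub>Q\<^esub> x" if "x \<in> carrier Q" "y \<in> carrier Q" for x y
    using that by (rule Q_common_denominator) (simp add: fraction_add[symmetric] a_comm)
  show "\<zero>\<^bsub>Q\<^esub> \<oplus>\<^bsub>Q\<^esub> x = x" if x: "x \<in> carrier Q" for x
  proof -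
    obtain a s where "a \<in> carrier R" "s \<in> nonzerodivisors R" "x = fraction R a s" using Q_cases[OF x] .
    thus ?thesis using fraction_add[of \<zero> a s] by (simp add: fraction_zero)
  qed
  show "\<exists>y\<in>carrier Q. y \<oplus>\<^bsub>Q\<^esub> x = \<zero>\<^bsub>Q\<^esub>" if x: "x \<in> carrier Q" for x
  proof -
    obtain a s where a: "a \<in> carrier R" "s \<in> nonzerodivisors R" "x = fraction R a s" using Q_cases[OF x] .
    hence "fraction R (\<ominus> a) s \<oplus>\<^bsub>Q\<^esub> x = \<zero>\<^bsub>Q\<^esub>"
      using fraction_add[of "\<ominus> a" a s] by (simp add: fraction_zero l_neg)
    thus ?thesis using a fraction_closed by (meson a_inv_closed)
  qed
  show "x \<oplus>\<^bsub>Q\<^esub> y \<oplus>\<^bsub>Q\<^esub> z = x \<oplus>\<^bsub>Q\<^esub> (y \<oplus>\<^bsub>Q\<^esub> z)"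
    if xyz: "x \<in> carrier Q" "y \<in> carrier Q" "z \<in> carrier Q" for x y z
  proof -
    obtain a b s where a: "a \<in> carrier R" "b \<in> carrier R" "s \<in> nonzerodivisors R"
      "x = fraction R a s" "y = fraction R b s" using Q_common_denominator[OF xyz(1,2)] .
    obtain e t where e: "e \<in> carrier R" "t \<in> nonzerodivisors R" "z = fraction R e t"
      using Q_cases[OF xyz(3)] .
    note c = a(1,2) e(1) nonzerodivisors_closed[OF a(3)] nonzerodivisors_closed[OF e(2)]
    have eq: "x = fraction R (a \<otimes> t) (s \<otimes> t)" "y = fraction R (b \<otimes> t) (s \<otimes> t)" "z = fraction R (e \<otimes> s) (s \<otimes> t)"
      unfolding a(4,5) e(3)
      by (rule fraction_eqI; use a e c mult_nonzerodivisors in \<open>auto simp: m_ac\<close>)+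
    have st: "s \<otimes> t \<in> nonzerodivisors R" using a e mult_nonzerodivisors by blast
    show ?thesis unfolding eq using c st by (simp add: fraction_add[symmetric] a_assoc)
  qed
qed

lemma Q_module: "module R Q"
proof (rule moduleI[OF is_cring Q_abelian_group])
  show "r \<odot>\<^bsub>Q\<^esub> x \<in> carrier Q" if "r \<in> carrier R" "x \<in> carrier Q" for r x
    using that(2) by (rule Q_cases) (simp add: that(1) Q_smult fraction_closed)
  show "(r \<oplus> r') \<odot>\<^bsub>Q\<^esub> x = r \<odot>\<^bsub>Q\<^esub> x \<oplus>\<^bsub>Q\<^esub> r' \<odot>\<^bsub>Q\<^esub> x"
    if "r \<in> carrier R" "r' \<in> carrier R" "x \<in> carrier Q" for r r' x
    using that(3) by (rule Q_cases) (simp add: that(1,2) Q_smult fraction_add[symmetric] l_distr)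
  show "r \<odot>\<^bsub>Q\<^esub> (x \<oplus>\<^bsub>Q\<^esub> y) = r \<odot>\<^bsub>Q\<^esub> x \<oplus>\<^bsub>Q\<^esub> r \<odot>\<^bsub>Q\<^esub> y"
    if "r \<in> carrier R" "x \<in> carrier Q" "y \<in> carrier Q" for r x y
    using that(2,3) by (rule Q_common_denominator) (simp add: that(1) Q_smult fraction_add[symmetric] r_distr)
  show "(r \<otimes> r') \<odot>\<^bsub>Q\<^esub> x = r \<odot>\<^bsub>Q\<^esub> (r' \<odot>\<^bsub>Q\<^esub> x)"
    if "r \<in> carrier R" "r' \<in> carrier R" "x \<in> carrier Q" for r r' x
    using that(3) by (rule Q_cases) (simp add: that(1,2) Q_smult m_assoc)
  show "\<one> \<odot>\<^bsub>Q\<^esub> x = x" if "x \<in> carrier Q" for x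
    using that by (rule Q_cases) (simp add: Q_smult)
qed

lemma fraction_pow:
  assumes "a \<in> carrier R" "s \<in> nonzerodivisors R"
  shows "fraction R a s [^]\<^bsub>Q\<^esub> (n::nat) = fraction R (a [^] n) (s [^] n)"
proof (induction n)
  case 0
  show ?case by (simp add: Q_one nat_pow_def)
next
  case (Suc n)
  have "fraction R a s [^]\<^bsub>Q\<^esub> Suc n = fraction R a s [^]\<^bsub>Q\<^esub> n \<otimes>\<^bsub>Q\<^esub> fraction R a s"
    by (simp add: nat_pow_def)
  thus ?case using Suc assms pow_nonzerodivisors by (simp add: Q_mult)
qed

abbreviation base where "base \<equiv> (\<lambda>a. fraction R a \<one>) ` carrier R"

lemma base_submodule: "submodule base R Q"
proof -
  interpret Q: module R Q by (rule Q_module)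
  show ?thesis
  proof (rule Q.submoduleI')
    show "base \<subseteq> carrier Q" using fraction_closed one_nonzerodivisor by blast
    show "\<zero>\<^bsub>Q\<^esub> \<in> base" by (auto simp: Q_zero)
    show "x \<oplus>\<^bsub>Q\<^esub> y \<in> base" if "x \<in> base" "y \<in> base" for x y
      using that by (auto simp: fraction_add[symmetric] one_nonzerodivisor)
    show "r \<odot>\<^bsub>Q\<^esub> x \<in> base" if "r \<in> carrier R" "x \<in> base" for r x
      using that by (auto simp: Q_smult one_nonzerodivisor)
  qed
qed

lemma fraction_mem_base:
  assumes "a \<in> carrier R" "s \<in> nonzerodivisors R"
  shows "fraction R a s \<in> base \<longleftrightarrow> a \<in> adjoin R {\<zero>} s"
  using assms nonzerodivisors_closed[OF assms(2)]
  by (auto simp: mem_principal fraction_eq_iff one_nonzerodivisor image_iff)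

text \<open>Annihilators in \<open>Q/R\<close>: the ideal \<open>(sR : a)\<close> is the annihilator of the class of \<open>a/s\<close>.\<close>
lemma Ass_normalization_mod_base:
  "p \<in> Ass R (normalization_mod_base R) \<longleftrightarrow> primeideal p R \<and> (\<exists>a\<in>carrier R. \<exists>s\<in>nonzerodivisors R.
     fraction R a s \<in> normalization R \<and> p = colon_ideal R (adjoin R {\<zero>} s) a)"
proof -
  interpret Q: module R Q by (rule Q_module)
  interpret base: abelian_subgroup base Q by (rule Q.abelian_subgroup_submodule[OF base_submodule])
  let ?M = "Q\<lparr>carrier := normalization R\<rparr>"
  \<comment> \<open>Cosets in the normalization are cosets in \<open>Q\<close>, whose module structure is available.\<close>
  have coset: "base +>\<^bsub>?M\<^esub> x = base +>\<^bsub>Q\<^esub> x" for x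
    by (simp add: a_r_coset_def r_coset_def)
  have norm: "normalization R \<subseteq> carrier Q" by (auto simp: normalization_def Let_def)
  have carr: "carrier (normalization_mod_base R) = (\<lambda>q. base +>\<^bsub>Q\<^esub> q) ` normalization R"
    unfolding normalization_mod_base_def quotient_module_simps A_RCOSETS_def'
    by (auto simp: coset a_r_coset_def' r_coset_def)
  have smult: "r \<odot>\<^bsub>normalization_mod_base R\<^esub> X = r \<odot>\<^bsub>quotient_module Q base\<^esub> X" for r X
    by (simp add: normalization_mod_base_def quotient_module_simps coset)
  have zero: "\<zero>\<^bsub>normalization_mod_base R\<^esub> = base"
    by (simp add: normalization_mod_base_def quotient_module_simps)
  have ann: "{r \<in> carrier R. r \<odot>\<^bsub>normalization_mod_base R\<^esub> (base +>\<^bsub>Q\<^esub> fraction R a s) =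
      \<zero>\<^bsub>normalization_mod_base R\<^esub>} = colon_ideal R (adjoin R {\<zero>} s) a"
    if a: "a \<in> carrier R" "s \<in> nonzerodivisors R" for a s
  proof -
    have "r \<odot>\<^bsub>normalization_mod_base R\<^esub> (base +>\<^bsub>Q\<^esub> fraction R a s) = base \<longleftrightarrow> r \<otimes> a \<in> adjoin R {\<zero>} s"
      if r: "r \<in> carrier R" for r
    proof -
      have "r \<odot>\<^bsub>normalization_mod_base R\<^esub> (base +>\<^bsub>Q\<^esub> fraction R a s) = base +>\<^bsub>Q\<^esub> fraction R (r \<otimes> a) s"
        using quotient_smult[OF Q_module base_submodule r fraction_closed[OF a]] Q_smult[OF r a]
        by (simp add: smult)
      moreover have "base +>\<^bsub>Q\<^esub> fraction R (r \<otimes> a) s = base \<longleftrightarrow> fraction R (r \<otimes> a) s \<in> base"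
        using base.a_rcos_const base.a_rcos_self[OF fraction_closed[of "r \<otimes> a" s]] r a by auto
      ultimately show ?thesis using fraction_mem_base[of "r \<otimes> a" s] r a by simp
    qed
    thus ?thesis by (auto simp: colon_ideal_def zero)
  qed
  show ?thesis
  proof (intro iffI conjI; (elim conjE bexE)?)
    assume p: "p \<in> Ass R (normalization_mod_base R)"
    thus "primeideal p R" by (simp add: Ass_def)
    obtain q where q: "q \<in> normalization R" "p = {r \<in> carrier R. r \<odot>\<^bsub>normalization_mod_base R\<^esub>
        (base +>\<^bsub>Q\<^esub> q) = \<zero>\<^bsub>normalization_mod_base R\<^esub>}"
      using p carr by (auto simp: Ass_def)
    obtain a s where a: "a \<in> carrier R" "s \<in> nonzerodivisors R" "q = fraction R a s"
      using Q_cases norm q(1) by blast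
    show "\<exists>a\<in>carrier R. \<exists>s\<in>nonzerodivisors R. fraction R a s \<in> normalization R \<and>
        p = colon_ideal R (adjoin R {\<zero>} s) a"
      using a q ann[OF a(1,2)] by blast
  next
    fix a s assume *: "primeideal p R" "a \<in> carrier R" "s \<in> nonzerodivisors R"
      "fraction R a s \<in> normalization R" "p = colon_ideal R (adjoin R {\<zero>} s) a"
    have "base +>\<^bsub>Q\<^esub> fraction R a s \<in> carrier (normalization_mod_base R)" using * carr by blast
    thus "p \<in> Ass R (normalization_mod_base R)"
      unfolding Ass_def using *(1,5) ann[OF *(2,3)] by blast
  qed
qed

end

text \<open>If \<open>q = a/s\<close> maps a set \<open>I \<subseteq> R\<close> containing a non-zerodivisor \<open>t\<close> into itself, then
  \<open>t q\<^sup>n \<in> I\<close> for all \<open>n\<close>. The ideal generated by these elements is generated by \<open>n\<close> of them, and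
  dividing by \<open>t\<close> the expression of \<open>t q\<^sup>n\<close> through the previous ones gives an equation of integral
  dependence.\<close>
lemma (in noetherian_ring) fraction_integral:
  assumes "cring R" and a: "a \<in> carrier R" and s: "s \<in> nonzerodivisors R"
    and I: "I \<subseteq> carrier R" and t: "t \<in> I" "t \<in> nonzerodivisors R"
    and stable: "\<And>y. y \<in> I \<Longrightarrow> \<exists>y'\<in>I. a \<otimes> y = s \<otimes> y'"
  shows "fraction R a s \<in> normalization R"
proof -
  interpret cring R by fact
  interpret Q: module R Q by (rule Q_module)
  interpret reg: module R "regular_module R" by (rule module_regular)
  have sc: "s \<in> carrier R" and tc: "t \<in> carrier R" using s t nonzerodivisors_closed by auto
  have "\<forall>y\<in>I. \<exists>y'. y' \<in> I \<and> a \<otimes> y = s \<otimes> y'" using stable by blast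
  from bchoice[OF this] obtain f where f: "\<forall>y\<in>I. f y \<in> I \<and> a \<otimes> y = s \<otimes> f y" by (rule exE)
  define b where "b n = (f ^^ n) t" for n :: nat
  have bI: "b n \<in> I" for n by (induction n) (use t f in \<open>auto simp: b_def\<close>)
  have bc: "b n \<in> carrier R" for n using bI I by blast
  have b_step: "a \<otimes> b n = s \<otimes> b (Suc n)" for n using f bI[of n] by (simp add: b_def)
  have pow: "fraction R (b n) t = fraction R a s [^]\<^bsub>Q\<^esub> n" for n
  proof -
    have "s [^] n \<otimes> b n = a [^] n \<otimes> t"
    proof (induction n)
      case 0
      show ?case using tc by (simp add: b_def)
    next
      case (Suc n)
      have "s [^] Suc n \<otimes> b (Suc n) = s [^] n \<otimes> (s \<otimes> b (Suc n))" using sc bc by (simp add: m_assoc)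
      also have "\<dots> = s [^] n \<otimes> (a \<otimes> b n)" by (simp only: b_step)
      also have "\<dots> = a \<otimes> (s [^] n \<otimes> b n)" using a sc bc by (simp add: m_lcomm)
      also have "\<dots> = a \<otimes> (a [^] n \<otimes> t)" by (simp only: Suc)
      also have "\<dots> = a [^] Suc n \<otimes> t" using a tc by (simp add: m_ac)
      finally show ?case .
    qed
    hence "b n \<otimes> s [^] n = a [^] n \<otimes> t" using bc sc m_comm[of "b n" "s [^] n"] by simp
    thus ?thesis unfolding fraction_pow[OF a s]
      by (rule fraction_eqI) (use bc t a pow_nonzerodivisors[OF s] in auto)
  qed
  obtain F where F: "finite F" "F \<subseteq> range b" "Idl F = Idl (range b)"
    using finite_generating_subset[of "range b"] bc by blast
  then obtain K where K: "finite K" "F = b ` K" by (meson finite_subset_image)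
  then obtain n where n: "K \<subseteq> {..<n}" using finite_nat_iff_bounded by blast
  have n': "K \<subseteq> {..<Suc n}" using n by auto
  have bn: "b ` {..<Suc n} \<subseteq> carrier R" using bc by blast
  have "b (Suc n) \<in> Idl F" using F(3) genideal_self[of "range b"] bc by blast
  moreover have "Idl F \<subseteq> Idl (b ` {..<Suc n})"
    by (rule subset_Idl_subset[OF bn]) (use K(2) n' in blast)
  ultimately obtain c where c: "c \<in> {..<Suc n} \<rightarrow> carrier R"
    "b (Suc n) = lin_comb (regular_module R) c b (Suc n)"
    using genideal_eq_lin_combs[of b "Suc n"] bc by blast
  let ?q = "fraction R a s"
  have qc: "?q [^]\<^bsub>Q\<^esub> i \<in> carrier Q" for i :: nat
    unfolding pow[symmetric] using fraction_closed bc t by blast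
  have hom: "(\<lambda>z. fraction R z t) \<in> module_homs R (regular_module R) Q"
    using t by (auto simp: module_homs_def fraction_closed fraction_add Q_smult)
  have "?q [^]\<^bsub>Q\<^esub> Suc n = fraction R (lin_comb (regular_module R) c b (Suc n)) t"
    unfolding pow[symmetric] by (simp only: c(2)[symmetric])
  also have "\<dots> = lin_comb Q c (\<lambda>i. fraction R (b i) t) (Suc n)"
    by (rule module_homs_lin_comb[OF module_regular Q_module hom c(1)]) (use bc in auto)
  also have "\<dots> = lin_comb Q c (\<lambda>i. ?q [^]\<^bsub>Q\<^esub> i) (Suc n)" by (simp only: pow)
  finally have rel: "?q [^]\<^bsub>Q\<^esub> Suc n = lin_comb Q c (\<lambda>i. ?q [^]\<^bsub>Q\<^esub> i) (Suc n)" .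
  have "lin_comb Q (\<lambda>i. \<ominus> \<one> \<otimes> c i) (\<lambda>i. ?q [^]\<^bsub>Q\<^esub> i) (Suc n) = \<ominus>\<^bsub>Q\<^esub> (?q [^]\<^bsub>Q\<^esub> Suc n)"
  proof -
    have qv: "(\<lambda>i. ?q [^]\<^bsub>Q\<^esub> i) \<in> {..<Suc n} \<rightarrow> carrier Q" using qc by blast
    have "lin_comb Q (\<lambda>i. \<ominus> \<one> \<otimes> c i) (\<lambda>i. ?q [^]\<^bsub>Q\<^esub> i) (Suc n) = \<ominus> \<one> \<odot>\<^bsub>Q\<^esub> (?q [^]\<^bsub>Q\<^esub> Suc n)"
      unfolding rel by (rule Q.lin_comb_coeff_smult[OF c(1) qv]) simp
    also have "\<dots> = \<ominus>\<^bsub>Q\<^esub> (\<one> \<odot>\<^bsub>Q\<^esub> (?q [^]\<^bsub>Q\<^esub> Suc n))" by (rule Q.smult_l_minus[OF one_closed qc])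
    also have "\<dots> = \<ominus>\<^bsub>Q\<^esub> (?q [^]\<^bsub>Q\<^esub> Suc n)" by (simp only: Q.smult_one[OF qc])
    finally show ?thesis .
  qed
  hence eq: "?q [^]\<^bsub>Q\<^esub> Suc n \<oplus>\<^bsub>Q\<^esub> (\<Oplus>\<^bsub>Q\<^esub>i\<in>{..<Suc n}. (\<ominus> \<one> \<otimes> c i) \<odot>\<^bsub>Q\<^esub> (?q [^]\<^bsub>Q\<^esub> i)) = \<zero>\<^bsub>Q\<^esub>"
    unfolding lin_comb_def by (simp only: Q.M.r_neg[OF qc])
  have "(\<lambda>i. \<ominus> \<one> \<otimes> c i) \<in> {..<Suc n} \<rightarrow> carrier R" using c(1) by auto
  with eq have "\<exists>c\<in>{..<Suc n} \<rightarrow> carrier R.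
      ?q [^]\<^bsub>Q\<^esub> Suc n \<oplus>\<^bsub>Q\<^esub> (\<Oplus>\<^bsub>Q\<^esub>i\<in>{..<Suc n}. c i \<odot>\<^bsub>Q\<^esub> (?q [^]\<^bsub>Q\<^esub> i)) = \<zero>\<^bsub>Q\<^esub>"
    by (rule bexI)
  hence "\<exists>n::nat. n > 0 \<and> (\<exists>c\<in>{..<n} \<rightarrow> carrier R.
      ?q [^]\<^bsub>Q\<^esub> n \<oplus>\<^bsub>Q\<^esub> (\<Oplus>\<^bsub>Q\<^esub>i\<in>{..<n}. c i \<odot>\<^bsub>Q\<^esub> (?q [^]\<^bsub>Q\<^esub> i)) = \<zero>\<^bsub>Q\<^esub>)"
    by (intro exI[of _ "Suc n"] conjI) auto
  thus ?thesis
    unfolding normalization_def Let_def using fraction_closed[OF a s] by simp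
qed

section \<open>Heights, dimension and depth\<close>

text \<open>This serves heights, dimension and depth, which are suprema of lengths.\<close>
lemma enat_Sup_obtain:
  assumes "enat k \<le> Sup {enat n | n. P n}" "k > 0"
  obtains n where "P n" "k \<le> n"
proof (rule ccontr)
  assume "\<not> thesis"
  hence "\<And>n. P n \<Longrightarrow> n \<le> k - 1" using that assms(2) by (metis Suc_pred' not_less_eq_eq)
  hence "Sup {enat n | n. P n} \<le> enat (k - 1)" by (intro Sup_least) auto
  hence "enat k \<le> enat (k - 1)" using assms(1) by (rule order_trans[rotated])
  thus False using assms(2) by simp
qed

lemma prime_chain_append:
  assumes P: "prime_chain R P n" and P': "prime_chain R P' k" and "P n = P' 0"
  shows "prime_chain R (\<lambda>i. if i \<le> n then P i else P' (i - n)) (n + k)"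
  unfolding prime_chain_def
proof (intro conjI allI impI)
  fix i assume "i < n + k"
  consider "i < n" | "i = n" "0 < k" | "n < i" using \<open>i < n + k\<close> by linarith
  thus "(if i \<le> n then P i else P' (i - n)) \<subset> (if Suc i \<le> n then P (Suc i) else P' (Suc i - n))"
  proof cases
    case 2
    thus ?thesis using P' assms(3) by (auto simp: prime_chain_def)
  next
    case 3
    thus ?thesis using P' \<open>i < n + k\<close> by (auto simp: prime_chain_def Suc_diff_le)
  qed (use P in \<open>auto simp: prime_chain_def\<close>)
qed (use P P' in \<open>auto simp: prime_chain_def\<close>)

lemma (in cring) genideal_empty: "Idl {} = {\<zero>}"
proof
  show "Idl {} \<subseteq> {\<zero>}" by (rule genideal_minimal[OF zeroideal]) simp
  show "{\<zero>} \<subseteq> Idl {}"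
    using additive_subgroup.zero_closed[OF ideal.axioms(1)[OF genideal_ideal[of "{}"]]] by simp
qed

lemma (in cring) genideal_singleton:
  assumes "s \<in> carrier R"
  shows "Idl {s} = adjoin R {\<zero>} s"
  using cgenideal_eq_genideal[OF assms] mem_principal[OF assms] by (auto simp: cgenideal_def)

context noetherian_local_ring
begin

lemma regular_sequence_1:
  "regular_sequence_in R \<mm> x (Suc 0) \<longleftrightarrow> x 0 \<in> \<mm> \<and> x 0 \<in> nonzerodivisors R"
  using mm_subset by (auto simp: regular_sequence_in_def genideal_empty nonzerodivisors_def)

lemma regular_sequence_2:
  "regular_sequence_in R \<mm> x 2 \<longleftrightarrow> x 0 \<in> \<mm> \<and> x 0 \<in> nonzerodivisors R \<and> x 1 \<in> \<mm> \<and>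
    (\<forall>y\<in>carrier R. x 1 \<otimes> y \<in> adjoin R {\<zero>} (x 0) \<longrightarrow> y \<in> adjoin R {\<zero>} (x 0))"
proof -
  have *: "{..<Suc 0} = {0}" by auto
  have "regular_sequence_in R \<mm> x 2 \<longleftrightarrow> regular_sequence_in R \<mm> x (Suc 0) \<and> x 1 \<in> \<mm> \<and>
    (\<forall>y\<in>carrier R. x 1 \<otimes> y \<in> Idl {x 0} \<longrightarrow> y \<in> Idl {x 0})"
    by (auto simp: regular_sequence_in_def numeral_2_eq_2 less_Suc_eq *)
  thus ?thesis using genideal_singleton mm_subset by (auto simp: regular_sequence_1)
qed

text \<open>Initial segments of regular sequences are regular, so lengths \<open>1\<close> and \<open>2\<close> decide.\<close>
lemma depth_eq_1_iff:
  "depth R \<mm> = 1 \<longleftrightarrow> (\<exists>s\<in>\<mm>. s \<in> nonzerodivisors R) \<and> (\<nexists>x. regular_sequence_in R \<mm> x 2)"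
proof
  assume depth: "depth R \<mm> = 1"
  hence "enat 1 \<le> Sup {enat n | n. \<exists>x. regular_sequence_in R \<mm> x n}"
    by (simp add: depth_def one_enat_def)
  then obtain n x where "regular_sequence_in R \<mm> x n" "1 \<le> n" by (rule enat_Sup_obtain) auto
  hence "regular_sequence_in R \<mm> x (Suc 0)" by (auto simp: regular_sequence_in_def)
  hence "\<exists>s\<in>\<mm>. s \<in> nonzerodivisors R" using regular_sequence_1 by blast
  moreover have "\<not> regular_sequence_in R \<mm> x 2" for x
  proof
    assume "regular_sequence_in R \<mm> x 2"
    hence "enat 2 \<le> depth R \<mm>" unfolding depth_def by (intro Sup_upper) blast
    thus False using depth by (simp add: one_enat_def)
  qed
  ultimately show "(\<exists>s\<in>\<mm>. s \<in> nonzerodivisors R) \<and> (\<nexists>x. regular_sequence_in R \<mm> x 2)" by blast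
next
  assume *: "(\<exists>s\<in>\<mm>. s \<in> nonzerodivisors R) \<and> (\<nexists>x. regular_sequence_in R \<mm> x 2)"
  then obtain s where "s \<in> \<mm>" "s \<in> nonzerodivisors R" by blast
  hence "regular_sequence_in R \<mm> (\<lambda>_. s) (Suc 0)" by (simp add: regular_sequence_1)
  hence "enat (Suc 0) \<le> depth R \<mm>" unfolding depth_def by (intro Sup_upper) blast
  moreover have "depth R \<mm> \<le> enat 1"
    unfolding depth_def
  proof (rule Sup_least, clarify)
    fix n x assume x: "regular_sequence_in R \<mm> x n"
    have "\<not> 2 \<le> n"
    proof
      assume "2 \<le> n"
      hence "regular_sequence_in R \<mm> x 2" using x unfolding regular_sequence_in_def by auto
      thus False using * by blast
    qed
    thus "enat n \<le> enat 1" by simp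
  qed
  ultimately show "depth R \<mm> = 1" by (simp add: one_enat_def)
qed

text \<open>If \<open>\<mm>\<close> is associated to \<open>R/sR\<close>, it is associated to \<open>R/tR\<close> for every non-zerodivisor
  \<open>t \<in> \<mm>\<close>: with \<open>\<mm> a \<subseteq> sR\<close> and \<open>t a = b s\<close> one has \<open>\<mm> b \<subseteq> tR\<close>.\<close>
lemma no_regular_pair:
  assumes s: "s \<in> nonzerodivisors R" and a: "a \<in> carrier R" and mm: "\<mm> = colon_ideal R (adjoin R {\<zero>} s) a"
  shows "\<not> regular_sequence_in R \<mm> x 2"
proof
  assume "regular_sequence_in R \<mm> x 2"
  hence x: "x 0 \<in> \<mm>" "x 0 \<in> nonzerodivisors R" "x 1 \<in> \<mm>"
    and reg: "\<And>y. \<lbrakk>y \<in> carrier R; x 1 \<otimes> y \<in> adjoin R {\<zero>} (x 0)\<rbrakk> \<Longrightarrow> y \<in> adjoin R {\<zero>} (x 0)"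
    unfolding regular_sequence_2 by auto
  have sc: "s \<in> carrier R" using s nonzerodivisors_closed by blast
  have c: "x 0 \<in> carrier R" "x 1 \<in> carrier R" using x mm_subset by auto
  have "x 0 \<otimes> a \<in> adjoin R {\<zero>} s" "x 1 \<otimes> a \<in> adjoin R {\<zero>} s"
    using x mm by (auto simp: colon_ideal_def)
  then obtain b f where b: "b \<in> carrier R" "x 0 \<otimes> a = b \<otimes> s" and f: "f \<in> carrier R" "x 1 \<otimes> a = f \<otimes> s"
    using mem_principal[OF sc] by blast
  have "s \<otimes> (x 1 \<otimes> b) = x 1 \<otimes> (b \<otimes> s)" using sc c b(1) by (simp add: m_ac)
  also have "\<dots> = x 0 \<otimes> (x 1 \<otimes> a)" unfolding b(2)[symmetric] using c a by (simp add: m_lcomm)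
  also have "\<dots> = s \<otimes> (f \<otimes> x 0)" unfolding f(2) using sc c f(1) by (simp add: m_ac)
  finally have "x 1 \<otimes> b = f \<otimes> x 0" using nonzerodivisor_cancel[OF s] c b(1) f(1) by simp
  hence "b \<in> adjoin R {\<zero>} (x 0)" using reg[OF b(1)] mem_principal[OF c(1)] f(1) by blast
  then obtain e where e: "e \<in> carrier R" "b = e \<otimes> x 0" using mem_principal[OF c(1)] by blast
  have "x 0 \<otimes> a = x 0 \<otimes> (e \<otimes> s)" unfolding b(2) e(2) using e(1) c sc by (simp add: m_ac)
  hence "a = e \<otimes> s" using nonzerodivisor_cancel[OF x(2) a] e(1) sc by simp
  hence "\<one> \<in> colon_ideal R (adjoin R {\<zero>} s) a"
    using mem_principal[OF sc] e(1) a by (auto simp: colon_ideal_def)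
  thus False using mm one_notin_mm by simp
qed

lemma obtain_prime_chain_2:
  assumes "krull_dim R \<ge> enat 2"
  obtains P0 P1 where "primeideal P0 R" "primeideal P1 R" "P0 \<subset> P1" "P1 \<subset> \<mm>"
proof -
  from assms obtain n P where "prime_chain R P n" "2 \<le> n"
    unfolding krull_dim_def by (rule enat_Sup_obtain) auto
  hence *: "\<And>i. i \<le> 2 \<Longrightarrow> primeideal (P i) R" "P 0 \<subset> P 1" "P 1 \<subset> P 2"
    by (auto simp: prime_chain_def numeral_2_eq_2)
  have "P 2 \<subseteq> \<mm>" using *(1) primeideal_subset_mm by blast
  thus thesis using that[of "P 0" "P 1"] * by auto
qed

lemma height_mm:
  assumes "krull_dim R \<ge> enat 2"
  shows "height R \<mm> \<ge> enat 2"
proof -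
  obtain P0 P1 where P: "primeideal P0 R" "primeideal P1 R" "P0 \<subset> P1" "P1 \<subset> \<mm>"
    using obtain_prime_chain_2[OF assms] .
  let ?P = "\<lambda>i::nat. if i = 0 then P0 else if i = 1 then P1 else \<mm>"
  have "prime_chain R ?P 2" using P primeideal_mm by (auto simp: prime_chain_def less_2_cases_iff)
  hence "\<exists>P. prime_chain R P 2 \<and> P 2 = \<mm>" by (intro exI[of _ ?P]) simp
  thus ?thesis unfolding height_def by (intro Sup_upper) blast
qed

text \<open>Let \<open>q = a/s\<close> with \<open>\<mm> q \<subseteq> R\<close>. If \<open>\<mm> q\<close> contained a unit \<open>c = y q\<close>, then \<open>z = c\<^sup>-\<^sup>1 (z q) y\<close>
  for \<open>z \<in> \<mm>\<close>, so \<open>\<mm> = yR\<close>; but then a prime \<open>P \<noteq> \<mm>\<close> satisfies \<open>P = yP\<close> and vanishes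
  modulo any smaller prime, contrary to \<open>dim R \<ge> 2\<close>.\<close>
lemma mm_stable_under_fraction:
  assumes dim: "krull_dim R \<ge> enat 2" and s: "s \<in> nonzerodivisors R" and a: "a \<in> carrier R"
    and mm: "\<And>y. y \<in> \<mm> \<Longrightarrow> y \<otimes> a \<in> adjoin R {\<zero>} s" and y: "y \<in> \<mm>"
  shows "\<exists>y'\<in>\<mm>. a \<otimes> y = s \<otimes> y'"
proof -
  have sc: "s \<in> carrier R" using s nonzerodivisors_closed by blast
  have yc: "y \<in> carrier R" using y mm_subset by blast
  obtain c where c: "c \<in> carrier R" "y \<otimes> a = c \<otimes> s" using mm[OF y] mem_principal[OF sc] by blast
  have "c \<in> \<mm>"
  proof (rule ccontr)
    assume "c \<notin> \<mm>"
    then obtain v where v: "v \<in> carrier R" "v \<otimes> c = \<one>" using unit_if_notin_mm[OF c(1)] by blast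
    have multiple: "\<exists>e\<in>carrier R. z = e \<otimes> y" if z: "z \<in> \<mm>" for z
    proof -
      have zc: "z \<in> carrier R" using z mm_subset by blast
      obtain e where e: "e \<in> carrier R" "z \<otimes> a = e \<otimes> s" using mm[OF z] mem_principal[OF sc] by blast
      have "s \<otimes> (c \<otimes> z) = z \<otimes> (c \<otimes> s)" using sc c(1) zc by (simp add: m_ac)
      also have "\<dots> = y \<otimes> (z \<otimes> a)" unfolding c(2)[symmetric] using zc yc a by (simp add: m_lcomm)
      also have "\<dots> = s \<otimes> (e \<otimes> y)" unfolding e(2) using yc e(1) sc by (simp add: m_ac)
      finally have "c \<otimes> z = e \<otimes> y" using nonzerodivisor_cancel[OF s] c(1) zc e(1) yc by simp
      hence "v \<otimes> (c \<otimes> z) = v \<otimes> (e \<otimes> y)" by simp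
      moreover have "v \<otimes> (c \<otimes> z) = z" using v c(1) zc by (simp add: m_assoc[symmetric])
      ultimately have "z = (v \<otimes> e) \<otimes> y" using v(1) e(1) yc by (simp add: m_assoc)
      thus ?thesis using v(1) e(1) by blast
    qed
    obtain P0 P1 where P: "primeideal P0 R" "primeideal P1 R" "P0 \<subset> P1" "P1 \<subset> \<mm>"
      using obtain_prime_chain_2[OF dim] .
    interpret P0: primeideal P0 R by (rule P(1))
    interpret P1: primeideal P1 R by (rule P(2))
    have "y \<notin> P1"
    proof
      assume "y \<in> P1"
      hence "\<mm> \<subseteq> P1" using multiple P1.I_l_closed by blast
      thus False using P(4) by blast
    qed
    have "P1 \<subseteq> P0"
    proof (rule divisible_subset_ideal[OF P0.is_ideal _ y])
      show "P1 \<subseteq> carrier R" using P1.Icarr by blast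
      fix z assume z: "z \<in> P1"
      then obtain e where e: "e \<in> carrier R" "z = e \<otimes> y" using multiple P(4) by blast
      have "e \<in> P1" using P1.I_prime[OF e(1) yc] z e(2) \<open>y \<notin> P1\<close> by blast
      moreover have "z \<ominus> y \<otimes> e = \<zero>" using e yc by (simp add: m_comm minus_eq r_neg)
      ultimately show "\<exists>e\<in>P1. z \<ominus> y \<otimes> e \<in> P0" using P0.zero_closed by metis
    qed
    thus False using P(3) by blast
  qed
  moreover have "a \<otimes> y = s \<otimes> c" using c yc a sc by (simp add: m_comm)
  ultimately show ?thesis by blast
qed

lemma mm_mem_Ass_if_depth_1:
  assumes dim: "krull_dim R \<ge> enat 2" and depth: "depth R \<mm> = 1"
  shows "\<mm> \<in> Ass R (normalization_mod_base R)"
proof -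
  obtain s where s: "s \<in> \<mm>" "s \<in> nonzerodivisors R" and no_pair: "\<And>x. \<not> regular_sequence_in R \<mm> x 2"
    using depth depth_eq_1_iff by blast
  have sc: "s \<in> carrier R" using s mm_subset by blast
  let ?J = "adjoin R {\<zero>} s"
  have J: "ideal ?J R" using ideal_adjoin(1)[OF zeroideal sc] .
  have "\<not> socle_free R \<mm> ?J"
  proof
    assume "socle_free R \<mm> ?J"
    then obtain x where "x \<in> \<mm>" "\<And>y. y \<in> carrier R \<Longrightarrow> x \<otimes> y \<in> ?J \<Longrightarrow> y \<in> ?J"
      using exists_nonzerodivisor_mod[OF J] unfolding socle_free_def by blast
    hence "regular_sequence_in R \<mm> (\<lambda>i. if i = 0 then s else x) 2"
      using s by (simp add: regular_sequence_2)
    thus False using no_pair by blast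
  qed
  then obtain a where a: "a \<in> carrier R" "a \<notin> ?J" and ma: "\<And>x. x \<in> \<mm> \<Longrightarrow> x \<otimes> a \<in> ?J"
    unfolding socle_free_def by blast
  have "colon_ideal R ?J a \<subseteq> \<mm>"
    by (rule proper_ideal_subset_mm[OF ideal_colon[OF J a(1)]]) (use a in \<open>simp add: colon_ideal_def\<close>)
  hence "\<mm> = colon_ideal R ?J a" using ma mm_subset by (auto simp: colon_ideal_def)
  moreover have "fraction R a s \<in> normalization R"
    by (rule fraction_integral[OF is_cring a(1) s(2) mm_subset s])
      (rule mm_stable_under_fraction[OF dim s(2) a(1) ma])
  ultimately show ?thesis using Ass_normalization_mod_base primeideal_mm a(1) s(2) by blast
qed

lemma depth_1_if_mm_mem_Ass:
  assumes "\<mm> \<in> Ass R (normalization_mod_base R)"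
  shows "depth R \<mm> = 1"
proof -
  obtain a s where a: "a \<in> carrier R" "s \<in> nonzerodivisors R" "\<mm> = colon_ideal R (adjoin R {\<zero>} s) a"
    using assms Ass_normalization_mod_base by blast
  have sc: "s \<in> carrier R" using a nonzerodivisors_closed by blast
  have "s \<otimes> a \<in> adjoin R {\<zero>} s" using mem_principal[OF sc] a(1) m_comm[OF sc a(1)] by blast
  hence "s \<in> \<mm>" unfolding a(3) using sc by (simp add: colon_ideal_def)
  thus ?thesis using depth_eq_1_iff a(2) no_regular_pair[OF a(2,1,3)] by blast
qed

end

context resolved_local_ring
begin

lemma B_smult:
  assumes "r \<in> carrier R" "z \<in> B c"
  shows "r \<odot>\<^bsub>E c\<^esub> z \<in> B c"
proof (cases c)
  case 0
  interpret E: module R "E 0" by (rule E_module)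
  show ?thesis using assms 0 by (simp add: B_def)
next
  case (Suc j)
  interpret E: module R "E j" by (rule E_module)
  obtain y where y: "y \<in> \<Gamma> j" "z = \<delta> j y" using assms by (auto simp: B_def Suc)
  hence "r \<odot>\<^bsub>E c\<^esub> z = \<delta> j (r \<odot>\<^bsub>E j\<^esub> y)" using \<delta>_smult assms(1) \<Gamma>_carrier by (simp add: Suc)
  thus ?thesis using E.submoduleE(4)[OF \<Gamma>_submodule assms(1) y(1)] by (auto simp: B_def Suc)
qed

lemma ext_killed_if_finite_length:
  assumes fin: "\<And>i. i < n \<Longrightarrow> finite_length R (local_cohomology R \<mm> E \<delta> i)"
    and x: "x \<in> \<mm>" and "j < n"
  shows "\<exists>t::nat. ext_killed R \<mm> j {\<zero>} (x [^] t)"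
proof -
  have xc: "x \<in> carrier R" using x mm_subset by blast
  have "\<exists>t::nat. \<forall>z\<in>\<Gamma> c \<inter> Z c. x [^] t \<odot>\<^bsub>E c\<^esub> z \<in> B c" if "c < n" for c
  proof (rule cohomology_killed[OF fin[OF that] x])
    fix t :: nat
    assume "\<And>z. z \<in> \<Gamma> c \<inter> Z c \<Longrightarrow> x [^] t \<odot>\<^bsub>E c\<^esub> z \<in> B c"
    thus ?thesis by (intro exI ballI)
  qed
  then obtain t :: "nat \<Rightarrow> nat" where t: "\<And>c z. \<lbrakk>c < n; z \<in> \<Gamma> c \<inter> Z c\<rbrakk> \<Longrightarrow> x [^] t c \<odot>\<^bsub>E c\<^esub> z \<in> B c"
    by metis
  define T where "T = Max (t ` {..<n})"
  have "x [^] T \<odot>\<^bsub>E c\<^esub> z \<in> B c" if c: "c < n" and z: "z \<in> \<Gamma> c \<inter> Z c" for c z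
  proof -
    interpret E: module R "E c" by (rule E_module)
    have "t c \<le> T" unfolding T_def using c by (intro Max_ge) auto
    hence "x [^] T = x [^] (T - t c) \<otimes> x [^] t c" using xc by (simp add: nat_pow_mult)
    hence "x [^] T \<odot>\<^bsub>E c\<^esub> z = x [^] (T - t c) \<odot>\<^bsub>E c\<^esub> (x [^] t c \<odot>\<^bsub>E c\<^esub> z)"
      using xc z by (simp add: E.smult_assoc1 Z_iff)
    thus ?thesis using B_smult[OF _ t[OF c z]] xc by simp
  qed
  from ext_killed_ring[OF _ this \<open>j < n\<close>] have "ext_killed R \<mm> j {\<zero>} ((x [^] T) [^] n)" using xc by simp
  thus ?thesis using xc by (metis nat_pow_pow)
qed

text \<open>A prime \<open>p = (sR : a) \<noteq> \<mm>\<close> satisfies \<open>dim R/p \<ge> d - 1\<close>: it remains an associated prime of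
  \<open>R/sR\<close> modulo torsion, because a power of \<open>\<mm>\<close> that multiplies \<open>r\<close> into \<open>p\<close> contains an element
  outside \<open>p\<close>. If its height were at least \<open>2\<close>, the two chains would combine to one longer than
  \<open>d\<close>.\<close>
lemma Ass_height_ge_2_subset:
  assumes fin: "\<And>i. i < d \<Longrightarrow> finite_length R (local_cohomology R \<mm> E \<delta> i)"
    and dim: "krull_dim R = enat d" and d: "d \<ge> 2"
  shows "height_ge R (Ass R (normalization_mod_base R)) 2 \<subseteq> {\<mm>}"
proof
  fix p assume "p \<in> height_ge R (Ass R (normalization_mod_base R)) 2"
  hence p: "p \<in> Ass R (normalization_mod_base R)" "enat 2 \<le> height R p" by (auto simp: height_ge_def)
  obtain a s where a: "a \<in> carrier R" "s \<in> nonzerodivisors R" "p = colon_ideal R (adjoin R {\<zero>} s) a"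
    and prime: "primeideal p R" using p(1) Ass_normalization_mod_base by blast
  interpret p: primeideal p R by (rule prime)
  have sc: "s \<in> carrier R" using a nonzerodivisors_closed by blast
  let ?J = "adjoin R {\<zero>} s"
  have J: "ideal ?J R" using ideal_adjoin(1)[OF zeroideal sc] .
  show "p \<in> {\<mm>}"
  proof (rule ccontr)
    assume "p \<notin> {\<mm>}"
    then obtain x where x: "x \<in> \<mm>" "x \<notin> p" using primeideal_subset_mm[OF prime] by blast
    have xc: "x \<in> carrier R" using x mm_subset by blast
    have x_pow: "x [^] n \<notin> p" for n :: nat
    proof (induction n)
      case 0
      show ?case using p.one_imp_carrier p.I_notcarr by auto
    next
      case (Suc n)
      thus ?case using p.I_prime[of "x [^] n" x] xc x(2) by auto
    qed
    obtain J' l where J': "ideal J' R" "?J \<subseteq> J'" "socle_free R \<mm> J'"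
      and l: "\<And>z r. \<lbrakk>z \<in> J'; r \<in> ideal_pow R \<mm> l\<rbrakk> \<Longrightarrow> r \<otimes> z \<in> ?J"
      using obtain_saturation[OF J] by blast
    have p_eq: "colon_ideal R J' a = p"
    proof
      show "p \<subseteq> colon_ideal R J' a" unfolding a(3) colon_ideal_def using J'(2) by blast
      show "colon_ideal R J' a \<subseteq> p"
      proof
        fix r assume "r \<in> colon_ideal R J' a"
        hence r: "r \<in> carrier R" "r \<otimes> a \<in> J'" by (auto simp: colon_ideal_def)
        have "x [^] l \<otimes> (r \<otimes> a) \<in> ?J" using l[OF r(2) pow_mem_ideal_pow[OF ideal_mm x(1)]] .
        hence "x [^] l \<otimes> r \<in> p"
          unfolding a(3) colon_ideal_def using a(1) xc r(1) by (simp add: m_assoc)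
        thus "r \<in> p" using p.I_prime[of "x [^] l" r] x_pow xc r(1) by blast
      qed
    qed
    have killed: "\<exists>t::nat. ext_killed R \<mm> (d - 2) J' (z [^] t)" if z: "z \<in> \<mm>" for z
    proof -
      have zc: "z \<in> carrier R" using z mm_subset by blast
      have "Suc (d - 2) < d" using d by simp
      then obtain t :: nat where "ext_killed R \<mm> (Suc (d - 2)) {\<zero>} (z [^] t)"
        using ext_killed_if_finite_length[OF fin z] by blast
      hence "ext_killed R \<mm> (d - 2) ?J (z [^] t \<otimes> z [^] t)"
        by (intro ext_killed_mod_nonzerodivisor[OF zeroideal _ sc])
          (use zc a(2) in \<open>auto simp: nonzerodivisors_def\<close>)
      hence "ext_killed R \<mm> (d - 2) J' (z [^] t \<otimes> z [^] t \<otimes> z [^] l)"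
        by (intro ext_killed_extend_ideal[OF J J'(2)])
          (use zc l pow_mem_ideal_pow[OF ideal_mm z] in auto)
      hence "ext_killed R \<mm> (d - 2) J' (z [^] (t + t + l))" using zc by (simp add: nat_pow_mult)
      thus ?thesis by blast
    qed
    obtain P' where P': "prime_chain R P' (Suc (d - 2))" "P' 0 = p"
      using exists_prime_chain_above_associated_prime[OF J'(1,3) killed a(1)] prime p_eq by auto
    from p(2) obtain n P where P: "prime_chain R P n" "P n = p" "2 \<le> n"
      unfolding height_def by (rule enat_Sup_obtain) auto
    have "prime_chain R (\<lambda>i. if i \<le> n then P i else P' (i - n)) (n + Suc (d - 2))"
      by (rule prime_chain_append[OF P(1) P'(1)]) (simp add: P(2) P'(2))
    hence "enat (n + Suc (d - 2)) \<le> krull_dim R"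
      unfolding krull_dim_def by (intro Sup_upper) blast
    thus False using dim P(3) d by simp
  qed
qed

end

theorem proposition2p16:
  fixes R :: "('a, 'b) ring_scheme" and m :: "'a set" and d :: nat
  assumes "noetherian_ring R" and "local_ring R m" and "adically_complete R m"
    and "krull_dim R = enat d" and "d \<ge> 2"
    and "generalized_Cohen_Macaulay TYPE('e) R m"
  shows "height_ge R (Ass R (normalization_mod_base R)) 2 \<subseteq> {m} \<and>
    (reduced_ring R \<longrightarrow>
      (height_ge R (Ass R (normalization_mod_base R)) 2 = {m} \<longleftrightarrow> depth R m = 1))"
proof -
  have "cring R" using assms(2) by (simp add: local_ring_def)
  then interpret cring R .
  interpret noetherian_ring R by (rule assms(1))
  interpret noetherian_local_ring R m by unfold_locales (rule assms(2))
  obtain E :: "nat \<Rightarrow> ('a, 'e) module" and \<epsilon> \<delta> where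
    res: "injective_resolution R (regular_module R) E \<epsilon> \<delta>"
    and fin: "\<And>i. enat i < krull_dim R \<Longrightarrow> finite_length R (local_cohomology R m E \<delta> i)"
    using assms(6) unfolding generalized_Cohen_Macaulay_def by blast
  interpret resolved_local_ring R m E \<epsilon> \<delta> by unfold_locales (rule res)
  have subset: "height_ge R (Ass R (normalization_mod_base R)) 2 \<subseteq> {m}"
    by (rule Ass_height_ge_2_subset[OF _ assms(4,5)]) (use fin assms(4) in simp)
  have dim: "krull_dim R \<ge> enat 2" using assms(4,5) by simp
  have "height_ge R (Ass R (normalization_mod_base R)) 2 = {m} \<longleftrightarrow> depth R m = 1"
  proof
    assume "height_ge R (Ass R (normalization_mod_base R)) 2 = {m}"
    thus "depth R m = 1" using depth_1_if_mm_mem_Ass by (auto simp: height_ge_def)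
  next
    assume "depth R m = 1"
    hence "m \<in> height_ge R (Ass R (normalization_mod_base R)) 2"
      using mm_mem_Ass_if_depth_1[OF dim] height_mm[OF dim] by (simp add: height_ge_def)
    thus "height_ge R (Ass R (normalization_mod_base R)) 2 = {m}" using subset by blast
  qed
  thus ?thesis using subset by blast
qed

end
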